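(* Let $d\ge1$, $w\in\mathbb R$, and let $V=(V(n))_{n\in\mathbb Z^d}$ be a bounded real-valued sequence. Assume there are $m\in\mathbb N$ and $0\le r<q$ such that, as $|n|\to+\infty$, $$V(n)=O\Big(\ln_{m+1}^{-q}(|n|)\prod_{j=0}^m\ln_j^{-r}(|n|)\Big)\quad\text{and}\quad n_i(V-\tau_iV)(n)=O\Big(\ln_{m+1}^{-q}(|n|)\prod_{j=0}^m\ln_j^{-r}(|n|)\Big)\ \ \forall\,1\le i\le d .$$ Let $H_2=\Delta+V+W_2$ and $\mu(H_2):=[0,4d]\setminus\big(\{0,4,\dots,4d-4,4d\}\cup\{2d\}\big)$. If $E\in\mu(H_2)$, then there is an open interval $I$ containing $E$ that contains at most finitely many eigenvalues of $H_2$ (including multiplicities). The corresponding eigenfunctions, if any, decay sub-exponentially. In dimension $d=1$ the point spectrum of $H_2$ is void in $(0,4)\setminus\{2\}$.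
   Context: $\mathbb N=\{0,1,2,\dots\}$. $\mathscr H=\ell^2(\mathbb Z^d)$; for $n=(n_1,\dots,n_d)\in\mathbb Z^d$, $|n|^2=n_1^2+\dots+n_d^2$, $\langle n\rangle=\sqrt{1+|n|^2}$. Iterated logarithms on $[1,+\infty)$: $\ln_0(x):=1$, $\ln_1(x):=\ln(1+x)$, $\ln_j(x):=\ln(1+\ln_{j-1}(x))$ for $j\ge2$; $\ln_j^p(x):=(\ln_j(x))^p$. Operators on $\mathscr H$: $(S_i\psi)(n)=\psi(n_1,\dots,n_i-1,\dots,n_d)$, with adjoint $S_i^*=S_i^{-1}$. $\Delta=\sum_{i=1}^d(2-S_i-S_i^* )$. $V$ is multiplication by $V(n)$; $(\tau_iV)(n)=V(n_1,\dots,n_i-1,\dots,n_d)$. $(W_2\psi)(n)=w\,(-1)^{n_1+\dots+n_d}|n|^{-1}\psi(n)$ for $n\ne0$, $(W_2\psi)(0)=0$. A sequence $\psi\in\ell^2(\mathbb Z^d)$ decays sub-exponentially if there are $c>0$ and $\gamma\in(0,1)$ such that $\sum_{n}e^{2c\langle n\rangle^\gamma}|\psi(n)|^2<\infty$. *)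

theory Defs
  imports
    "HOL-Analysis.Analysis"
    "HOL-Library.Function_Algebras"
    "HOL-Library.Landau_Symbols"
begin

section \<open>The lattice\<close>

text \<open>The lattice of dimension \<open>d\<close> is \<^typ>\<open>int ^ 'd\<close> with \<open>d = CARD('d)\<close>, so \<open>d \<ge> 1\<close> is automatic.\<close>

definition lnorm :: "int ^ 'd \<Rightarrow> real" where
  "lnorm n = sqrt (\<Sum>i\<in>UNIV. (real_of_int (n $ i))\<^sup>2)"

definition jap :: "int ^ 'd \<Rightarrow> real" where
  "jap n = sqrt (1 + (lnorm n)\<^sup>2)"

text \<open>The filter of the limit \<open>|n| \<rightarrow> +\<infinity>\<close>.\<close>

definition lat_infinity :: "(int ^ 'd) filter" where
  "lat_infinity = filtercomap lnorm at_top"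

section \<open>Iterated logarithms and the decay rate\<close>

fun iter_ln :: "nat \<Rightarrow> real \<Rightarrow> real" where
  "iter_ln 0 x = 1"
| "iter_ln (Suc 0) x = ln (1 + x)"
| "iter_ln (Suc (Suc j)) x = ln (1 + iter_ln (Suc j) x)"

definition decay_rate :: "nat \<Rightarrow> real \<Rightarrow> real \<Rightarrow> real \<Rightarrow> real" where
  "decay_rate m q r x = iter_ln (m + 1) x powr (- q) * (\<Prod>j=0..m. iter_ln j x powr (- r))"

section \<open>Square-summable functions\<close>

definition ell2 :: "('a \<Rightarrow> complex) set" where
  "ell2 = {\<psi>. (\<lambda>n. (cmod (\<psi> n))\<^sup>2) summable_on UNIV}"

abbreviation (input) cscale :: "complex \<Rightarrow> ('a \<Rightarrow> complex) \<Rightarrow> 'a \<Rightarrow> complex" where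
  "cscale c \<psi> \<equiv> (\<lambda>n. c * \<psi> n)"

interpretation cfun: vector_space "cscale :: complex \<Rightarrow> ('a \<Rightarrow> complex) \<Rightarrow> 'a \<Rightarrow> complex"
  by unfold_locales (auto simp: fun_eq_iff algebra_simps)

definition finite_dimensional :: "('a \<Rightarrow> complex) set \<Rightarrow> bool" where
  "finite_dimensional X \<longleftrightarrow> (\<exists>B. finite B \<and> X \<subseteq> cfun.span B)"

definition decays_subexp :: "(int ^ 'd \<Rightarrow> complex) \<Rightarrow> bool" where
  "decays_subexp \<psi> \<longleftrightarrow> (\<exists>c \<gamma>. 0 < c \<and> 0 < \<gamma> \<and> \<gamma> < 1 \<and>
     (\<lambda>n. exp (2 * c * jap n powr \<gamma>) * (cmod (\<psi> n))\<^sup>2) summable_on UNIV)"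

section \<open>Operators\<close>

text \<open>The operators below are bounded on \<^term>\<open>ell2\<close> (for bounded \<open>V\<close>). They are given by formulas
  that make sense on all functions; \<open>H2_ell2\<close> shows that they act on \<^term>\<open>ell2\<close>, and the
  spectral notions only consider vectors of \<^term>\<open>ell2\<close>.

  The shift serves both as \<open>S\<^sub>i\<close> (on complex functions) and as \<open>\<tau>\<^sub>i\<close> (on real potentials).\<close>

definition shift :: "'d \<Rightarrow> (int ^ 'd \<Rightarrow> 'b) \<Rightarrow> int ^ 'd \<Rightarrow> 'b" where
  "shift i f n = f (n - axis i 1)"

definition shift_adj :: "'d \<Rightarrow> (int ^ 'd \<Rightarrow> 'b) \<Rightarrow> int ^ 'd \<Rightarrow> 'b" where
  "shift_adj i f n = f (n + axis i 1)"

lemma shift_adj_shift: "shift_adj i (shift i f) = f" "shift i (shift_adj i f) = f"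
  by (simp_all add: shift_def shift_adj_def fun_eq_iff)

lemma shift_adjoint:
  fixes \<phi> \<psi> :: "int ^ 'd \<Rightarrow> complex"
  shows "(\<Sum>\<^sub>\<infinity>n. cnj (shift i \<phi> n) * \<psi> n) = (\<Sum>\<^sub>\<infinity>n. cnj (\<phi> n) * shift_adj i \<psi> n)"
proof -
  have "bij (\<lambda>n :: int ^ 'd. n + axis i 1)"
    by (rule bij_betw_byWitness[where f' = "\<lambda>n. n - axis i 1"]) auto
  from infsum_reindex_bij_betw[OF this, of "\<lambda>n. cnj (shift i \<phi> n) * \<psi> n"]
  show ?thesis by (simp add: shift_def shift_adj_def)
qed

definition Laplacian :: "(int ^ 'd \<Rightarrow> complex) \<Rightarrow> int ^ 'd \<Rightarrow> complex" where
  "Laplacian \<psi> n = (\<Sum>i\<in>UNIV. 2 * \<psi> n - shift i \<psi> n - shift_adj i \<psi> n)"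

definition mult_op :: "(int ^ 'd \<Rightarrow> real) \<Rightarrow> (int ^ 'd \<Rightarrow> complex) \<Rightarrow> int ^ 'd \<Rightarrow> complex" where
  "mult_op V \<psi> n = complex_of_real (V n) * \<psi> n"

definition w2 :: "real \<Rightarrow> int ^ 'd \<Rightarrow> real" where
  "w2 w n = (if n = 0 then 0 else w * (- 1) powi (\<Sum>i\<in>UNIV. n $ i) / lnorm n)"

definition H2 :: "real \<Rightarrow> (int ^ 'd \<Rightarrow> real) \<Rightarrow> (int ^ 'd \<Rightarrow> complex) \<Rightarrow> int ^ 'd \<Rightarrow> complex" where
  "H2 w V \<psi> n = Laplacian \<psi> n + mult_op V \<psi> n + mult_op (w2 w) \<psi> n"

section \<open>Eigenvalues\<close>

definition eigenspace :: "(('a \<Rightarrow> complex) \<Rightarrow> 'a \<Rightarrow> complex) \<Rightarrow> complex \<Rightarrow> ('a \<Rightarrow> complex) set" where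
  "eigenspace T z = {\<psi> \<in> ell2. T \<psi> = cscale z \<psi>}"

definition point_spectrum :: "(('a \<Rightarrow> complex) \<Rightarrow> 'a \<Rightarrow> complex) \<Rightarrow> complex set" where
  "point_spectrum T = {z. \<exists>\<psi> \<in> eigenspace T z. \<psi> \<noteq> 0}"

text \<open>The set \<open>\<mu>(H\<^sub>2)\<close> in dimension \<open>d\<close>.\<close>

definition mu_H2 :: "nat \<Rightarrow> real set" where
  "mu_H2 d = {0..4 * real d} - ({4 * real k | k. k \<le> d} \<union> {2 * real d})"

section \<open>The operators act on square-summable functions\<close>

lemma ell2_add:
  assumes "f \<in> ell2" "g \<in> ell2"
  shows "(\<lambda>n. f n + g n) \<in> ell2"
proof -
  have "(\<lambda>n. 2 * (cmod (f n))\<^sup>2 + 2 * (cmod (g n))\<^sup>2) summable_on UNIV"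
    using assms by (intro summable_on_add summable_on_cmult_right) (auto simp: ell2_def)
  moreover have "(cmod (f n + g n))\<^sup>2 \<le> 2 * (cmod (f n))\<^sup>2 + 2 * (cmod (g n))\<^sup>2" for n
  proof -
    have "(cmod (f n + g n))\<^sup>2 \<le> (cmod (f n) + cmod (g n))\<^sup>2"
      by (intro power_mono norm_triangle_ineq) auto
    moreover have "0 \<le> (cmod (f n) - cmod (g n))\<^sup>2" by simp
    ultimately show ?thesis by (simp add: power2_eq_square algebra_simps)
  qed
  ultimately show ?thesis
    unfolding ell2_def mem_Collect_eq by (rule summable_on_comparison_test) simp_all
qed

lemma ell2_mult:
  assumes "f \<in> ell2" "\<And>n. cmod (b n) \<le> B"
  shows "(\<lambda>n. b n * f n) \<in> ell2"
proof -
  have "(\<lambda>n. B\<^sup>2 * (cmod (f n))\<^sup>2) summable_on UNIV"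
    using assms by (intro summable_on_cmult_right) (auto simp: ell2_def)
  moreover have "(cmod (b n * f n))\<^sup>2 \<le> B\<^sup>2 * (cmod (f n))\<^sup>2" for n
    using assms(2)[of n] by (auto simp: norm_mult power_mult_distrib intro!: mult_right_mono power_mono)
  ultimately show ?thesis
    unfolding ell2_def mem_Collect_eq by (rule summable_on_comparison_test) simp_all
qed

lemma ell2_sum:
  assumes "finite A" "\<And>i. i \<in> A \<Longrightarrow> f i \<in> ell2"
  shows "(\<lambda>n. \<Sum>i\<in>A. f i n) \<in> ell2"
  using assms
proof (induction rule: finite_induct)
  case empty
  show ?case by (simp add: ell2_def)
next
  case (insert a A)
  then show ?case using ell2_add[of "f a" "\<lambda>n. \<Sum>i\<in>A. f i n"] by simp
qed

lemma ell2_shift: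
  assumes "f \<in> ell2"
  shows "shift i f \<in> ell2" "shift_adj i f \<in> ell2"
proof -
  have "bij (\<lambda>n :: int ^ 'a. n - axis i 1)" "bij (\<lambda>n :: int ^ 'a. n + axis i 1)"
    by (rule bij_betw_byWitness[where f' = "\<lambda>n. n + axis i 1"], auto)
       (rule bij_betw_byWitness[where f' = "\<lambda>n. n - axis i 1"], auto)
  from this[THEN summable_on_reindex_bij_betw, of "\<lambda>n. (cmod (f n))\<^sup>2"]
  show "shift i f \<in> ell2" "shift_adj i f \<in> ell2"
    using assms by (simp_all add: ell2_def shift_def shift_adj_def)
qed

lemma lnorm_ge_1:
  assumes "n \<noteq> 0"
  shows "1 \<le> lnorm n"
proof -
  obtain i where "n $ i \<noteq> 0" using assms by (auto simp: vec_eq_iff)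
  then have "1 \<le> \<bar>real_of_int (n $ i)\<bar>" by linarith
  then have "1 \<le> (real_of_int (n $ i))\<^sup>2" using abs_le_square_iff[of 1 "real_of_int (n $ i)"] by simp
  also have "\<dots> \<le> (\<Sum>i\<in>UNIV. (real_of_int (n $ i))\<^sup>2)"
    by (rule member_le_sum) auto
  finally show ?thesis unfolding lnorm_def by simp
qed

lemma w2_bounded: "\<bar>w2 w n\<bar> \<le> \<bar>w\<bar>"
proof (cases "n = 0")
  case False
  have "\<bar>(- 1 :: real) powi k\<bar> = 1" for k
    by (simp add: power_int_abs)
  moreover have "\<bar>w\<bar> / lnorm n \<le> \<bar>w\<bar>"
    using lnorm_ge_1[OF False] by (simp add: divide_le_eq mult_le_cancel_left1)
  ultimately show ?thesis
    using False lnorm_ge_1[OF False] by (simp add: w2_def abs_mult)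
qed (simp add: w2_def)

lemma H2_ell2:
  assumes "bounded (range V)" "\<psi> \<in> ell2"
  shows "H2 w V \<psi> \<in> ell2"
proof -
  obtain B where B: "\<And>n. \<bar>V n\<bar> \<le> B"
    using assms(1) by (auto simp: bounded_iff)
  have neg: "(\<lambda>n. - f n) \<in> ell2" if "f \<in> ell2" for f :: "int ^ 'a \<Rightarrow> complex"
    using that by (simp add: ell2_def)
  have "Laplacian \<psi> = (\<lambda>n. \<Sum>i\<in>UNIV. 2 * \<psi> n + (- shift i \<psi> n) + (- shift_adj i \<psi> n))"
    by (auto simp: Laplacian_def fun_eq_iff)
  also have "\<dots> \<in> ell2"
    by (intro ell2_sum ell2_add neg ell2_shift ell2_mult[where B = 2] assms) auto
  finally have "Laplacian \<psi> \<in> ell2" .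
  moreover have "mult_op V \<psi> \<in> ell2" unfolding mult_op_def
    by (rule ell2_mult[OF assms(2), of _ B]) (simp add: B)
  moreover have "mult_op (w2 w) \<psi> \<in> ell2" unfolding mult_op_def
    by (rule ell2_mult[OF assms(2), of _ "\<bar>w\<bar>"]) (simp add: w2_bounded)
  ultimately show ?thesis
    unfolding H2_def[abs_def] by (intro ell2_add)
qed

end

theory Submission
  imports Defs
begin

text \<open>
  Why the theorem holds. On an eigenfunction \<open>\<psi>\<close> with eigenvalue \<open>x\<close> the equation reads
  \<open>(e + V + W) \<psi> = T \<psi>\<close>, where \<open>e = 2 d - x\<close>, \<open>T\<close> is the sum over all directions of
  \<open>T\<^sub>i = S\<^sub>i + S\<^sub>i\<^sup>*\<close>, and \<open>W = W\<^sub>2\<close>. The generator of dilations \<open>B = \<Sum>\<^sub>i B\<^sub>i\<close> satisfies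
  \<open>[T\<^sub>i, B\<^sub>i] = - D\<^sub>i\<^sup>2 \<ge> 0\<close> with \<open>D\<^sub>i = S\<^sub>i - S\<^sub>i\<^sup>*\<close>, and this commutator is strictly positive at energies
  that are not thresholds. The hypotheses on \<open>V\<close> give \<open>V \<rightarrow> 0\<close> and \<open>n\<^sub>i (V - \<tau>\<^sub>i V) \<rightarrow> 0\<close>, so \<open>V\<close>
  and its commutator with \<open>B\<close> vanish at infinity. The commutator of \<open>W\<close> with \<open>B\<close> does not: up to
  vanishing terms it is \<open>2 w\<close> times the checkerboard sign times the hopping terms
  \<open>(n\<^sub>i / |n|) S\<^sub>i\<close>. But the sign anticommutes with \<open>T\<close>,
  hence maps approximate eigenvectors of \<open>T\<close> at \<open>e\<close> to approximate eigenvectors at \<open>- e\<close>, and for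
  \<open>e \<noteq> 0\<close>, that is \<open>x \<noteq> 2 d\<close>, the expectation of that commutator tends to zero
  (\<open>ip_checker_tendsto_0\<close>).

  The central result is \<open>no_escape\<close>: a bounded sequence \<open>u\<^sub>k\<close> of approximate eigenfunctions, at
  energies converging to a good energy, that tends to zero pointwise tends to zero in norm. Indeed,
  pairing the equation with \<open>B u\<^sub>k\<close> forces all \<open>D\<^sub>i u\<^sub>k\<close> to zero, so \<open>u\<^sub>k\<close> concentrates at the corners of
  the joint spectrum of the \<open>T\<^sub>i\<close>, where each \<open>T\<^sub>i\<close> is \<open>\<plusminus> 2\<close> (\<open>l2_null_if_not_threshold\<close>). Working with
  sequences replaces both the functional calculus and compact operators, and finitely
  supported functions avoid the domain of the unbounded operator \<open>B\<close>.

  The equation in \<open>no_escape\<close> contains a further term \<open>g \<Sum>\<^sub>i n\<^sub>i D\<^sub>i u\<close> with \<open>g \<ge> 0\<close>. It arises when \<open>\<psi>\<close>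
  is multiplied by \<open>e\<^sup>F\<close> with \<open>F\<close> radially increasing and slowly varying, and it enters the virial
  identity with a favourable sign (the Froese-Herbst argument). Cutting off \<open>e\<^sup>F \<psi>\<close> at a large radius
  produces approximate eigenfunctions (\<open>truncated_eigenfunction\<close>). With \<open>F = 0\<close> the result says that
  normalized eigenfunctions near a good energy have a uniform amount of mass in a fixed ball
  (\<open>eigenfunction_mass_in_ball\<close>), which bounds the multiplicities and, by Bessel's inequality, the
  number of eigenvalues. With \<open>F\<close> ranging over bounded approximations of \<open>\<langle>n\<rangle>\<^sup>1\<^sup>/\<^sup>4\<close> it says that
  \<open>e\<^sup>F \<psi>\<close> stays bounded in norm, which is the decay (\<open>eigenfunction_decay\<close>).

  In dimension one, solutions of the three-term recurrence have a quadratic energy whose relative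
  change from \<open>j\<close> to \<open>j + 1\<close> is \<open>o(1 / j)\<close>, once the contribution of \<open>W\<close> is summed by parts. So \<open>j\<close> times
  the energy is eventually increasing, and a nonzero solution is not square-summable
  (\<open>square_summable_solution_vanishes\<close>).
\<close>


section \<open>Decay at infinity on the lattice\<close>

lemma coord_le_lnorm: "\<bar>real_of_int (n $ i)\<bar> \<le> lnorm n"
proof -
  have "(real_of_int (n $ i))\<^sup>2 \<le> (\<Sum>i\<in>UNIV. (real_of_int (n $ i))\<^sup>2)"
    by (rule member_le_sum) auto
  then have "sqrt ((real_of_int (n $ i))\<^sup>2) \<le> lnorm n"
    unfolding lnorm_def by (rule real_sqrt_le_mono)
  then show ?thesis by simp
qed

lemma lnorm_nonneg: "0 \<le> lnorm n"
  unfolding lnorm_def by (simp add: sum_nonneg)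

lemma lnorm_0 [simp]: "lnorm 0 = 0"
  unfolding lnorm_def by simp

lemma lnorm_add_le: "lnorm (a + b) \<le> lnorm a + lnorm b"
  using L2_set_triangle_ineq[of "\<lambda>i. real_of_int (a $ i)" "\<lambda>i. real_of_int (b $ i)" UNIV]
  unfolding lnorm_def L2_set_def by simp

lemma lnorm_uminus: "lnorm (- a) = lnorm a"
  unfolding lnorm_def by simp

lemma lnorm_axis: "lnorm (axis i 1) = 1"
proof -
  have "(\<Sum>j\<in>UNIV. (real_of_int ((axis i (1::int)) $ j))\<^sup>2) = (\<Sum>j\<in>UNIV. if j = i then 1 else 0)"
    by (rule sum.cong) (auto simp: axis_def)
  then show ?thesis unfolding lnorm_def by simp
qed

lemma lnorm_step:
  "\<bar>lnorm (n + axis i 1) - lnorm n\<bar> \<le> 1" "\<bar>lnorm (n - axis i 1) - lnorm n\<bar> \<le> 1"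
  using lnorm_add_le[of n "axis i 1"] lnorm_add_le[of "n + axis i 1" "- axis i 1"]
    lnorm_add_le[of n "- axis i 1"] lnorm_add_le[of "n - axis i 1" "axis i 1"]
  by (simp_all add: lnorm_uminus lnorm_axis)

lemma finite_lattice_ball: "finite {n :: int ^ 'd. lnorm n \<le> R}"
proof -
  have "{n :: int ^ 'd. lnorm n \<le> R} \<subseteq> vec_lambda ` (Pi\<^sub>E UNIV (\<lambda>_. {- \<lceil>R\<rceil>..\<lceil>R\<rceil>}))"
  proof
    fix n :: "int ^ 'd" assume "n \<in> {n. lnorm n \<le> R}"
    then have "\<bar>real_of_int (n $ i)\<bar> \<le> R" for i
      using coord_le_lnorm[of n i] by simp
    then have "\<bar>n $ i\<bar> \<le> \<lceil>R\<rceil>" for i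
      by (metis ceiling_mono ceiling_of_int of_int_abs)
    then have "(\<lambda>i. n $ i) \<in> Pi\<^sub>E UNIV (\<lambda>_. {- \<lceil>R\<rceil>..\<lceil>R\<rceil>})"
      by (auto simp: abs_le_iff minus_le_iff)
    then show "n \<in> vec_lambda ` (Pi\<^sub>E UNIV (\<lambda>_. {- \<lceil>R\<rceil>..\<lceil>R\<rceil>}))"
      by (metis image_eqI vec_nth_inverse)
  qed
  then show ?thesis by (rule finite_subset) (intro finite_imageI finite_PiE, auto)
qed

lemma filterlim_lnorm_cofinite: "filterlim lnorm at_top cofinite"
  unfolding filterlim_at_top
proof
  fix Z :: real
  have "finite {n :: int ^ 'a. \<not> Z \<le> lnorm n}"
    by (rule finite_subset[OF _ finite_lattice_ball[of Z]]) auto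
  then show "\<forall>\<^sub>F n :: int ^ 'a in cofinite. Z \<le> lnorm n"
    unfolding eventually_cofinite .
qed

lemma cofinite_le_lat_infinity: "cofinite \<le> (lat_infinity :: (int ^ 'd) filter)"
  unfolding lat_infinity_def
  using filterlim_lnorm_cofinite filterlim_iff_le_filtercomap by blast



lemma iter_ln_at_top: "filterlim (iter_ln (Suc j)) at_top at_top"
proof (induction j)
  case 0
  show ?case
    by (simp, rule filterlim_compose[OF ln_at_top], rule filterlim_tendsto_add_at_top[OF tendsto_const filterlim_ident])
next
  case (Suc j)
  have "filterlim (\<lambda>x. ln (1 + iter_ln (Suc j) x)) at_top at_top"
    by (rule filterlim_compose[OF ln_at_top], rule filterlim_tendsto_add_at_top[OF tendsto_const Suc])
  then show ?case by simp
qed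

text \<open>The factor with the exponent \<open>- q < 0\<close> tends to zero, and all others are eventually at most one.\<close>

lemma decay_rate_tendsto_0:
  assumes "0 \<le> r" "r < q"
  shows "(decay_rate m q r \<longlongrightarrow> 0) at_top"
proof -
  have "((\<lambda>x. iter_ln (m + 1) x powr (- q)) \<longlongrightarrow> 0) at_top"
    using tendsto_neg_powr[of "- q" "iter_ln (Suc m)", OF _ iter_ln_at_top[of m]] assms by simp
  moreover have "\<forall>\<^sub>F x in at_top. norm (\<Prod>j=0..m. iter_ln j x powr (- r)) \<le> 1"
  proof -
    have "\<forall>\<^sub>F x in at_top. \<forall>j\<in>{0..m}. 1 \<le> iter_ln j x"
    proof (rule eventually_ball_finite)
      show "\<forall>j\<in>{0..m}. \<forall>\<^sub>F x in at_top. 1 \<le> iter_ln j x"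
      proof
        fix j show "\<forall>\<^sub>F x in at_top. 1 \<le> iter_ln j x"
          using iter_ln_at_top[of "j - 1"] by (cases j) (auto simp: filterlim_at_top)
      qed
    qed simp
    then show ?thesis
    proof eventually_elim
      case (elim x)
      have "0 \<le> iter_ln j x powr (- r) \<and> iter_ln j x powr (- r) \<le> 1" if "j \<in> {0..m}" for j
        using elim that assms(1) powr_mono[of "-r" 0 "iter_ln j x"] by (auto simp del: iter_ln.simps split: if_splits)
      then have "0 \<le> (\<Prod>j=0..m. iter_ln j x powr (- r)) \<and> (\<Prod>j=0..m. iter_ln j x powr (- r)) \<le> 1"
        using prod_le_1[of "{0..m}" "\<lambda>j. iter_ln j x powr (- r)"] by (auto intro!: prod_nonneg)
      then show ?case by (simp add: abs_prod)
    qed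
  qed
  ultimately have "((\<lambda>x. iter_ln (m + 1) x powr (- q) * (\<Prod>j=0..m. iter_ln j x powr (- r))) \<longlongrightarrow> 0) at_top"
    by (intro lim_null_mult_right_bounded)
  then show ?thesis unfolding decay_rate_def[abs_def] .
qed

lemma tendsto_0_of_bigo_decay:
  fixes f :: "int ^ 'd \<Rightarrow> real"
  assumes "0 \<le> r" "r < q" "f \<in> O[lat_infinity](\<lambda>n. decay_rate m q r (lnorm n))"
  shows "(f \<longlongrightarrow> 0) cofinite"
proof -
  have "((\<lambda>n :: int ^ 'd. decay_rate m q r (lnorm n)) \<longlongrightarrow> 0) cofinite"
    by (rule filterlim_compose[OF decay_rate_tendsto_0 filterlim_lnorm_cofinite]) (use assms in auto)
  moreover have "f \<in> O[cofinite](\<lambda>n. decay_rate m q r (lnorm n))"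
    using assms(3) cofinite_le_lat_infinity landau_o.big.filter_mono by blast
  ultimately have "f \<in> o[cofinite](\<lambda>_. 1)"
    by (intro landau_o.big_small_trans[of f _ "\<lambda>n. decay_rate m q r (lnorm n)"] smalloI_tendsto) auto
  then show ?thesis by (auto dest: smalloD_tendsto)
qed

section \<open>Sequences of finitely supported functions\<close>

definition fsupp :: "('a \<Rightarrow> real) \<Rightarrow> bool" where
  "fsupp u \<longleftrightarrow> finite {n. u n \<noteq> 0}"

definition ip :: "('a \<Rightarrow> real) \<Rightarrow> ('a \<Rightarrow> real) \<Rightarrow> real" where
  "ip u v = (\<Sum>\<^sub>\<infinity>n. u n * v n)"

abbreviation sq_sum :: "('a \<Rightarrow> real) \<Rightarrow> real" where
  "sq_sum u \<equiv> ip u u"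

lemma fsupp_mono: "fsupp u \<Longrightarrow> (\<And>n. u n = 0 \<Longrightarrow> v n = 0) \<Longrightarrow> fsupp v"
  unfolding fsupp_def by (rule finite_subset[of _ "{n. u n \<noteq> 0}"]) auto

lemma tendsto_0_squeeze:
  fixes f g :: "nat \<Rightarrow> real"
  assumes "\<And>k. 0 \<le> f k" "\<And>k. f k \<le> g k" "g \<longlonglongrightarrow> 0"
  shows "f \<longlonglongrightarrow> 0"
  using tendsto_sandwich[of "\<lambda>_. 0" f sequentially g 0] assms by simp

lemma fsupp_dom:
  assumes "fsupp u" "\<And>n. \<bar>v n\<bar> \<le> c n * \<bar>u n\<bar>"
  shows "fsupp v"
proof (rule fsupp_mono[OF assms(1)])
  show "v n = 0" if "u n = 0" for n using assms(2)[of n] that by simp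
qed

lemma abs_le_mult_cancel:
  fixes x y c :: real
  assumes "\<bar>x\<bar> \<le> c * \<bar>y\<bar>"
  shows "\<bar>x\<bar> \<le> \<bar>c * y\<bar>"
  using assms mult_right_mono[OF abs_ge_self[of c] abs_ge_zero[of y]] by (simp add: abs_mult)

lemma fsupp_intros [intro, simp]:
  "fsupp (\<lambda>n. 0)"
  "fsupp u \<Longrightarrow> fsupp v \<Longrightarrow> fsupp (\<lambda>n. u n + v n)"
  "fsupp u \<Longrightarrow> fsupp v \<Longrightarrow> fsupp (\<lambda>n. u n - v n)"
  "fsupp u \<Longrightarrow> fsupp (\<lambda>n. - u n)"
  "fsupp u \<Longrightarrow> fsupp (\<lambda>n. c n * u n)"
  "fsupp u \<Longrightarrow> fsupp (\<lambda>n. u n * c n)"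
proof -
  show "fsupp (\<lambda>n. 0)" by (simp add: fsupp_def)
  assume u: "fsupp u"
  show "fsupp (\<lambda>n. - u n)" "fsupp (\<lambda>n. c n * u n)" "fsupp (\<lambda>n. u n * c n)"
    by (rule fsupp_mono[OF u]; simp)+
  assume v: "fsupp v"
  have "finite ({n. u n \<noteq> 0} \<union> {n. v n \<noteq> 0})" using u v by (simp add: fsupp_def)
  then show "fsupp (\<lambda>n. u n + v n)" "fsupp (\<lambda>n. u n - v n)"
    unfolding fsupp_def by (rule finite_subset[rotated]; auto)+
qed

lemma fsupp_sum [intro]:
  "(\<And>i. i \<in> A \<Longrightarrow> fsupp (f i)) \<Longrightarrow> fsupp (\<lambda>n. \<Sum>i\<in>A. f i n)"
  by (induction A rule: infinite_finite_induct) auto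

lemma ip_summable [simp]:
  "fsupp u \<Longrightarrow> (\<lambda>n. u n * v n) summable_on UNIV"
  "fsupp v \<Longrightarrow> (\<lambda>n. u n * v n) summable_on UNIV"
  by (rule finite_nonzero_values_imp_summable_on; simp add: fsupp_def; rule finite_subset[rotated]; auto)+

lemma ip_eq_sum:
  assumes "finite A" "\<And>n. n \<notin> A \<Longrightarrow> u n = 0 \<or> v n = 0"
  shows "ip u v = (\<Sum>n\<in>A. u n * v n)"
proof -
  have "ip u v = (\<Sum>\<^sub>\<infinity>n\<in>A. u n * v n)"
    unfolding ip_def by (rule infsum_cong_neutral) (use assms(2) in auto)
  then show ?thesis using assms(1) by simp
qed

lemma ip_commute: "ip u v = ip v u"
  unfolding ip_def by (simp add: mult.commute)

lemma ip_add_left: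
  assumes "fsupp u" "fsupp v"
  shows "ip (\<lambda>n. u n + v n) w = ip u w + ip v w"
  unfolding ip_def by (subst infsum_add[symmetric]) (use assms in \<open>simp_all add: algebra_simps\<close>)

lemma ip_minus_left: "ip (\<lambda>n. - u n) w = - ip u w"
  unfolding ip_def by (simp add: infsum_uminus)

lemma ip_diff_left:
  assumes "fsupp u" "fsupp v"
  shows "ip (\<lambda>n. u n - v n) w = ip u w - ip v w"
  using ip_add_left[of u "\<lambda>n. - v n" w] assms by (simp add: ip_minus_left)

lemma ip_scale_left: "ip (\<lambda>n. c * u n) w = c * ip u w"
  unfolding ip_def by (simp add: mult.assoc infsum_cmult_right')

lemma ip_sum_left:
  assumes "\<And>i. i \<in> A \<Longrightarrow> fsupp (f i)"
  shows "ip (\<lambda>n. \<Sum>i\<in>A. f i n) w = (\<Sum>i\<in>A. ip (f i) w)"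
  using assms
proof (induction A rule: infinite_finite_induct)
  case (insert a A)
  then show ?case using ip_add_left[of "f a" "\<lambda>n. \<Sum>i\<in>A. f i n" w] by auto
qed (simp_all add: ip_def)

lemma ip_add_right: "fsupp u \<Longrightarrow> fsupp v \<Longrightarrow> ip w (\<lambda>n. u n + v n) = ip w u + ip w v"
  and ip_diff_right: "fsupp u \<Longrightarrow> fsupp v \<Longrightarrow> ip w (\<lambda>n. u n - v n) = ip w u - ip w v"
  and ip_minus_right: "ip w (\<lambda>n. - u n) = - ip w u"
  and ip_scale_right: "ip w (\<lambda>n. c * u n) = c * ip w u"
  and ip_sum_right: "(\<And>i. i \<in> A \<Longrightarrow> fsupp (f i)) \<Longrightarrow> ip w (\<lambda>n. \<Sum>i\<in>A. f i n) = (\<Sum>i\<in>A. ip w (f i))"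
  using ip_add_left[of u v w] ip_diff_left[of u v w] ip_minus_left[of u w] ip_scale_left[of c u w]
    ip_sum_left[of A f w]
  by (simp_all add: ip_commute)

lemma ip_mult_move: "ip (\<lambda>n. c n * u n) v = ip u (\<lambda>n. c n * v n)"
  unfolding ip_def by (simp add: algebra_simps)

lemma sq_sum_nonneg: "0 \<le> sq_sum u"
  unfolding ip_def by (rule infsum_nonneg) simp

lemma sq_sum_mono:
  assumes "fsupp u" "\<And>n. \<bar>v n\<bar> \<le> \<bar>u n\<bar>"
  shows "sq_sum v \<le> sq_sum u"
proof -
  have "fsupp v" by (rule fsupp_dom[OF assms(1), of v "\<lambda>_. 1"]) (simp add: assms(2))
  moreover have "v n * v n \<le> u n * u n" for n
    using assms(2)[of n] by (simp flip: power2_eq_square add: abs_le_square_iff)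
  ultimately show ?thesis unfolding ip_def using assms(1) by (intro infsum_mono) simp_all
qed

lemma sq_sum_scale: "sq_sum (\<lambda>n. c * u n) = c\<^sup>2 * sq_sum u"
  by (simp add: ip_scale_left ip_scale_right power2_eq_square)

lemma sq_sum_add_le:
  assumes "fsupp u" "fsupp v"
  shows "sq_sum (\<lambda>n. u n + v n) \<le> 2 * sq_sum u + 2 * sq_sum v"
proof -
  have "0 \<le> sq_sum (\<lambda>n. u n - v n)" by (rule sq_sum_nonneg)
  then show ?thesis using assms
    by (simp add: ip_add_left ip_diff_left ip_add_right ip_diff_right ip_commute[of v u])
qed

lemma ip_Cauchy_Schwarz:
  assumes "fsupp u" "fsupp v"
  shows "(ip u v)\<^sup>2 \<le> sq_sum u * sq_sum v"
proof -
  let ?A = "{n. u n \<noteq> 0} \<union> {n. v n \<noteq> 0}"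
  have f: "finite ?A" using assms by (simp add: fsupp_def)
  show ?thesis
    using Cauchy_Schwarz_ineq_sum[of u v ?A]
    by (subst (1 2 3) ip_eq_sum[OF f]) (auto simp: power2_eq_square)
qed

text \<open>Limits in norm along sequences: in the sequel \<^term>\<open>l2_null (\<lambda>k n. u k n - v k n)\<close>
  plays the role of equality up to a compact operator.\<close>

definition l2_bounded :: "(nat \<Rightarrow> 'a \<Rightarrow> real) \<Rightarrow> bool" where
  "l2_bounded u \<longleftrightarrow> (\<forall>k. fsupp (u k)) \<and> (\<exists>C. \<forall>k. sq_sum (u k) \<le> C)"

definition l2_null :: "(nat \<Rightarrow> 'a \<Rightarrow> real) \<Rightarrow> bool" where
  "l2_null u \<longleftrightarrow> (\<forall>k. fsupp (u k)) \<and> (\<lambda>k. sq_sum (u k)) \<longlonglongrightarrow> 0"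

lemma l2_null_imp_bounded: "l2_null u \<Longrightarrow> l2_bounded u"
  unfolding l2_null_def l2_bounded_def
  by (auto dest!: convergentI convergent_imp_Bseq simp: Bseq_def abs_le_iff) blast

lemma l2_bounded_dom:
  assumes u: "l2_bounded u" and le: "\<And>k n. \<bar>v k n\<bar> \<le> C * \<bar>u k n\<bar>"
  shows "l2_bounded v"
proof -
  obtain B where B: "\<And>k. sq_sum (u k) \<le> B" using u by (auto simp: l2_bounded_def)
  have fs: "fsupp (u k)" for k using u by (simp add: l2_bounded_def)
  have "\<bar>v k n\<bar> \<le> \<bar>C * u k n\<bar>" for k n
    using le by (rule abs_le_mult_cancel)
  then have "sq_sum (v k) \<le> C\<^sup>2 * sq_sum (u k)" for k
    using sq_sum_mono[of "\<lambda>n. C * u k n" "v k"] fs by (simp add: sq_sum_scale)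
  moreover have "C\<^sup>2 * sq_sum (u k) \<le> C\<^sup>2 * B" for k by (simp add: B mult_left_mono)
  moreover have "fsupp (v k)" for k
    using fs le by (rule fsupp_dom)
  ultimately show ?thesis unfolding l2_bounded_def by (meson order_trans)
qed

lemma l2_null_dom:
  assumes u: "l2_null u" and le: "\<And>k n. \<bar>v k n\<bar> \<le> C * \<bar>u k n\<bar>"
  shows "l2_null v"
proof -
  have fs: "fsupp (u k)" for k using u by (simp add: l2_null_def)
  have "\<bar>v k n\<bar> \<le> \<bar>C * u k n\<bar>" for k n
    using le by (rule abs_le_mult_cancel)
  then have "sq_sum (v k) \<le> C\<^sup>2 * sq_sum (u k)" for k
    using sq_sum_mono[of "\<lambda>n. C * u k n" "v k"] fs by (simp add: sq_sum_scale)
  moreover have "(\<lambda>k. C\<^sup>2 * sq_sum (u k)) \<longlonglongrightarrow> 0"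
    using u by (intro tendsto_mult_right_zero) (simp add: l2_null_def)
  ultimately have "(\<lambda>k. sq_sum (v k)) \<longlonglongrightarrow> 0"
    by (rule tendsto_0_squeeze[OF sq_sum_nonneg])
  moreover have "fsupp (v k)" for k
    using fs le by (rule fsupp_dom)
  ultimately show ?thesis unfolding l2_null_def by simp
qed

lemma l2_bounded_add:
  assumes "l2_bounded u" "l2_bounded v"
  shows "l2_bounded (\<lambda>k n. u k n + v k n)"
proof -
  obtain B C where "\<And>k. sq_sum (u k) \<le> B" "\<And>k. sq_sum (v k) \<le> C"
    and fs: "\<And>k. fsupp (u k)" "\<And>k. fsupp (v k)"
    using assms by (auto simp: l2_bounded_def)
  then have "sq_sum (\<lambda>n. u k n + v k n) \<le> 2 * B + 2 * C" for k
    using sq_sum_add_le[of "u k" "v k"] by (meson add_mono mult_left_mono order_trans zero_le_numeral)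
  then show ?thesis unfolding l2_bounded_def using fs by auto
qed

lemma l2_null_add:
  assumes "l2_null u" "l2_null v"
  shows "l2_null (\<lambda>k n. u k n + v k n)"
proof -
  have fs: "\<And>k. fsupp (u k)" "\<And>k. fsupp (v k)" using assms by (auto simp: l2_null_def)
  have "(\<lambda>k. 2 * sq_sum (u k) + 2 * sq_sum (v k)) \<longlonglongrightarrow> 2 * 0 + 2 * 0"
    using assms by (intro tendsto_intros) (auto simp: l2_null_def)
  then have "(\<lambda>k. sq_sum (\<lambda>n. u k n + v k n)) \<longlonglongrightarrow> 0"
    using fs by (intro tendsto_0_squeeze[OF sq_sum_nonneg sq_sum_add_le]) simp_all
  then show ?thesis unfolding l2_null_def using fs by simp
qed

lemma l2_bounded_scale: "l2_bounded u \<Longrightarrow> l2_bounded (\<lambda>k n. c * u k n)"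
  by (erule l2_bounded_dom[where C = "\<bar>c\<bar>"]) (simp add: abs_mult)

lemma l2_null_scale: "l2_null u \<Longrightarrow> l2_null (\<lambda>k n. c * u k n)"
  by (erule l2_null_dom[where C = "\<bar>c\<bar>"]) (simp add: abs_mult)

lemma l2_null_diff: "l2_null u \<Longrightarrow> l2_null v \<Longrightarrow> l2_null (\<lambda>k n. u k n - v k n)"
  using l2_null_add[of u "\<lambda>k n. - 1 * v k n"] l2_null_scale[of v "- 1"] by simp

lemma l2_bounded_diff: "l2_bounded u \<Longrightarrow> l2_bounded v \<Longrightarrow> l2_bounded (\<lambda>k n. u k n - v k n)"
  using l2_bounded_add[of u "\<lambda>k n. - 1 * v k n"] l2_bounded_scale[of v "- 1"] by simp

lemma l2_null_zero: "l2_null (\<lambda>k n. 0)"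
  by (simp add: l2_null_def ip_def)

lemma l2_null_sum:
  "(\<And>i. i \<in> A \<Longrightarrow> l2_null (f i)) \<Longrightarrow> l2_null (\<lambda>k n. \<Sum>i\<in>A. f i k n)"
  by (induction A rule: infinite_finite_induct) (auto intro: l2_null_zero l2_null_add)

lemma l2_bounded_sum:
  "(\<And>i. i \<in> A \<Longrightarrow> l2_bounded (f i)) \<Longrightarrow> l2_bounded (\<lambda>k n. \<Sum>i\<in>A. f i k n)"
  by (induction A rule: infinite_finite_induct)
     (auto intro: l2_null_imp_bounded[OF l2_null_zero] l2_bounded_add)

lemma ip_tendsto_0:
  assumes u: "l2_bounded u" and v: "l2_null v"
  shows "(\<lambda>k. ip (u k) (v k)) \<longlonglongrightarrow> 0"
proof -
  obtain B where B: "\<And>k. sq_sum (u k) \<le> B" using u by (auto simp: l2_bounded_def)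
  have "(ip (u k) (v k))\<^sup>2 \<le> B * sq_sum (v k)" for k
    using ip_Cauchy_Schwarz[of "u k" "v k"] B[of k] u v
      mult_right_mono[OF B[of k] sq_sum_nonneg[of "v k"]]
    by (auto simp: l2_bounded_def l2_null_def intro: order_trans)
  moreover have "(\<lambda>k. B * sq_sum (v k)) \<longlonglongrightarrow> 0"
    using v by (intro tendsto_mult_right_zero) (simp add: l2_null_def)
  ultimately have "(\<lambda>k. (ip (u k) (v k))\<^sup>2) \<longlonglongrightarrow> 0"
    by (rule tendsto_0_squeeze[OF zero_le_power2])
  from tendsto_real_sqrt[OF this] show ?thesis
    by (simp add: tendsto_rabs_zero_iff)
qed

text \<open>The substitute for compactness: a coefficient that vanishes at infinity
  annihilates in the limit every bounded sequence that tends to zero pointwise.\<close>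

lemma l2_null_of_local:
  assumes u: "l2_bounded u" and pw: "\<And>n. (\<lambda>k. u k n) \<longlonglongrightarrow> 0"
    and \<eta>: "(\<eta> \<longlongrightarrow> 0) cofinite" and le: "\<And>k n. \<bar>v k n\<bar> \<le> \<eta> n * \<bar>u k n\<bar>"
  shows "l2_null v"
proof -
  obtain B where B: "\<And>k. sq_sum (u k) \<le> B" using u by (auto simp: l2_bounded_def)
  have "0 \<le> B" using B[of 0] sq_sum_nonneg[of "u 0"] by linarith
  have fs: "fsupp (u k)" for k using u by (simp add: l2_bounded_def)
  have fv: "fsupp (v k)" for k
    using fs le by (rule fsupp_dom)
  have "(\<lambda>k. sq_sum (v k)) \<longlonglongrightarrow> 0"
  proof (rule LIMSEQ_I)
    fix \<epsilon> :: real assume "0 < \<epsilon>"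
    \<comment> \<open>Outside a finite set the coefficient is below \<open>\<delta>\<close>, which costs at most \<open>\<delta>\<^sup>2 B \<le> \<epsilon> / 2\<close>.\<close>
    define \<delta> where "\<delta> = sqrt (\<epsilon> / (2 * (B + 1)))"
    have "0 < \<delta>" using \<open>0 < \<epsilon>\<close> \<open>0 \<le> B\<close> by (simp add: \<delta>_def)
    have \<delta>B: "\<delta>\<^sup>2 * B \<le> \<epsilon> / 2"
      using \<open>0 < \<epsilon>\<close> \<open>0 \<le> B\<close> by (simp add: \<delta>_def field_simps)
    define A where "A = {n. \<not> \<bar>\<eta> n\<bar> < \<delta>}"
    have "finite A"
      using tendstoD[OF \<eta> \<open>0 < \<delta>\<close>] by (simp add: eventually_cofinite A_def)
    have bound: "sq_sum (v k) \<le> (\<Sum>n\<in>A. (\<eta> n * u k n)\<^sup>2) + \<delta>\<^sup>2 * B" for k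
    proof -
      let ?f = "\<lambda>n. if n \<in> A then \<eta> n * u k n else 0"
      have ff: "fsupp ?f" by (rule fsupp_mono[OF fs[of k]]) auto
      have "v k n * v k n \<le> ?f n * ?f n + \<delta>\<^sup>2 * (u k n * u k n)" for n
      proof (cases "n \<in> A")
        case True
        have "\<bar>v k n\<bar> \<le> \<bar>\<eta> n * u k n\<bar>"
          using le by (rule abs_le_mult_cancel)
        then have "(v k n)\<^sup>2 \<le> (\<eta> n * u k n)\<^sup>2" by (simp add: abs_le_square_iff)
        then show ?thesis using True by (simp add: power2_eq_square add_increasing2)
      next
        case False
        then have "\<bar>\<eta> n\<bar> \<le> \<delta>" by (auto simp: A_def)
        then have "\<bar>v k n\<bar> \<le> \<bar>\<delta> * u k n\<bar>"
          using order_trans[OF le[of k n] mult_right_mono[of "\<eta> n" \<delta> "\<bar>u k n\<bar>"]] \<open>0 < \<delta>\<close>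
          by (simp add: abs_mult abs_le_iff)
        then have "(v k n)\<^sup>2 \<le> (\<delta> * u k n)\<^sup>2" by (simp add: abs_le_square_iff)
        then show ?thesis using False by (simp add: power2_eq_square mult_ac)
      qed
      then have "sq_sum (v k) \<le> (\<Sum>\<^sub>\<infinity>n. ?f n * ?f n + \<delta>\<^sup>2 * (u k n * u k n))"
        unfolding ip_def by (intro infsum_mono summable_on_add summable_on_cmult_right ip_summable ff fv fs)
      also have "\<dots> = sq_sum ?f + \<delta>\<^sup>2 * sq_sum (u k)"
        unfolding ip_def
        by (subst infsum_add) (auto intro!: summable_on_cmult_right ip_summable ff fs simp: infsum_cmult_right' simp del: if_split)
      also have "sq_sum ?f = (\<Sum>n\<in>A. (\<eta> n * u k n)\<^sup>2)"
        using \<open>finite A\<close> by (subst ip_eq_sum[where A = A]) (auto simp: power2_eq_square)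
      finally show ?thesis using mult_left_mono[OF B[of k], of "\<delta>\<^sup>2"] by simp
    qed
    have "(\<lambda>k. \<Sum>n\<in>A. (\<eta> n * u k n)\<^sup>2) \<longlonglongrightarrow> (\<Sum>n\<in>A. (\<eta> n * 0)\<^sup>2)"
      by (intro tendsto_intros pw)
    then have "\<forall>\<^sub>F k in sequentially. (\<Sum>n\<in>A. (\<eta> n * u k n)\<^sup>2) < \<epsilon> / 2"
      by (rule order_tendstoD) (use \<open>0 < \<epsilon>\<close> in simp)
    then obtain N where "\<And>k. N \<le> k \<Longrightarrow> (\<Sum>n\<in>A. (\<eta> n * u k n)\<^sup>2) < \<epsilon> / 2"
      by (auto simp: eventually_sequentially)
    then have "norm (sq_sum (v k) - 0) < \<epsilon>" if "N \<le> k" for k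
      using bound[of k] \<delta>B that sq_sum_nonneg[of "v k"] by force
    then show "\<exists>N. \<forall>k\<ge>N. norm (sq_sum (v k) - 0) < \<epsilon>" by blast
  qed
  then show ?thesis unfolding l2_null_def using fv by simp
qed

section \<open>Hopping operators and their commutators\<close>

definition hop_sum :: "'d \<Rightarrow> (int ^ 'd \<Rightarrow> real) \<Rightarrow> int ^ 'd \<Rightarrow> real" where
  "hop_sum i u n = shift i u n + shift_adj i u n"

definition hop_diff :: "'d \<Rightarrow> (int ^ 'd \<Rightarrow> real) \<Rightarrow> int ^ 'd \<Rightarrow> real" where
  "hop_diff i u n = shift i u n - shift_adj i u n"

text \<open>The antisymmetric form of \<open>n\<^sub>i (S\<^sub>i - S\<^sub>i\<^sup>*)\<close>, up to a factor \<open>\<i>\<close> the part in direction \<open>i\<close> of the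
  generator of dilations on the lattice. The shift by one in the second coefficient is what makes
  it antisymmetric.\<close>

definition dilation :: "'d \<Rightarrow> (int ^ 'd \<Rightarrow> real) \<Rightarrow> int ^ 'd \<Rightarrow> real" where
  "dilation i u n = real_of_int (n $ i) * shift i u n - (real_of_int (n $ i) + 1) * shift_adj i u n"

lemma bij_lattice_step: "bij (\<lambda>n :: int ^ 'd. n + axis i 1)" "bij (\<lambda>n :: int ^ 'd. n - axis i 1)"
  by (rule bij_betw_byWitness[where f' = "\<lambda>n. n - axis i 1"], auto)
     (rule bij_betw_byWitness[where f' = "\<lambda>n. n + axis i 1"], auto)

lemma fsupp_shift [intro, simp]:
  assumes "fsupp u"
  shows "fsupp (shift i u)" "fsupp (shift_adj i u)"
proof -
  have "{n. shift i u n \<noteq> 0} = (\<lambda>n. n + axis i 1) ` {n. u n \<noteq> 0}"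
    by (force simp: shift_def image_iff intro: exI[of _ "_ - axis i 1"])
  moreover have "{n. shift_adj i u n \<noteq> 0} = (\<lambda>n. n - axis i 1) ` {n. u n \<noteq> 0}"
    by (force simp: shift_adj_def image_iff intro: exI[of _ "_ + axis i 1"])
  ultimately show "fsupp (shift i u)" "fsupp (shift_adj i u)"
    using assms by (simp_all add: fsupp_def)
qed

lemma fsupp_hop [intro, simp]:
  assumes "fsupp u"
  shows "fsupp (hop_sum i u)" "fsupp (hop_diff i u)" "fsupp (dilation i u)"
  unfolding hop_sum_def[abs_def] hop_diff_def[abs_def] dilation_def[abs_def]
  using assms by (auto intro!: fsupp_intros)

lemma ip_shift: "ip (shift i u) v = ip u (shift_adj i v)"
  unfolding ip_def
  using infsum_reindex_bij_betw[OF bij_lattice_step(1), of "\<lambda>n. shift i u n * v n" i]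
  by (simp add: shift_def shift_adj_def)

lemma ip_shift_adj: "ip (shift_adj i u) v = ip u (shift i v)"
  using ip_shift[of i v u] by (simp add: ip_commute)

lemma sq_sum_shift [simp]: "sq_sum (shift i u) = sq_sum u" "sq_sum (shift_adj i u) = sq_sum u"
  by (simp_all add: ip_shift ip_shift_adj shift_adj_shift)

lemma ip_hop_sum:
  assumes "fsupp u" "fsupp v"
  shows "ip (hop_sum i u) v = ip u (hop_sum i v)"
  unfolding hop_sum_def[abs_def]
  using assms by (simp add: ip_add_left ip_add_right ip_shift ip_shift_adj)

lemma ip_hop_diff:
  assumes "fsupp u" "fsupp v"
  shows "ip (hop_diff i u) v = - ip u (hop_diff i v)"
  unfolding hop_diff_def[abs_def]
  using assms by (simp add: ip_diff_left ip_diff_right ip_shift ip_shift_adj)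

lemma ip_dilation:
  assumes "fsupp u" "fsupp v"
  shows "ip (dilation i u) v = - ip u (dilation i v)"
proof -
  have "ip (dilation i u) v
      = ip (\<lambda>n. real_of_int (n $ i) * shift i u n) v
        - ip (\<lambda>n. (real_of_int (n $ i) + 1) * shift_adj i u n) v"
    unfolding dilation_def[abs_def] using assms by (simp add: ip_diff_left)
  also have "ip (\<lambda>n. real_of_int (n $ i) * shift i u n) v
      = ip u (\<lambda>n. (real_of_int (n $ i) + 1) * shift_adj i v n)"
    unfolding ip_mult_move ip_shift
    by (rule arg_cong[where f = "ip u"], rule ext) (simp add: shift_adj_def axis_def)
  also have "ip (\<lambda>n. (real_of_int (n $ i) + 1) * shift_adj i u n) v
      = ip u (\<lambda>n. real_of_int (n $ i) * shift i v n)"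
    unfolding ip_mult_move ip_shift_adj
    by (rule arg_cong[where f = "ip u"], rule ext) (simp add: shift_def axis_def)
  finally show ?thesis
    unfolding dilation_def[abs_def] using assms by (simp add: ip_diff_right)
qed

lemma hop_sum_dilation_commute:
  "i \<noteq> j \<Longrightarrow> hop_sum j (dilation i u) = dilation i (hop_sum j u)"
  by (rule ext) (simp add: hop_sum_def dilation_def shift_def shift_adj_def axis_def algebra_simps)

lemma hop_sum_dilation_commutator:
  "hop_sum i (dilation i u) n = dilation i (hop_sum i u) n - hop_diff i (hop_diff i u) n"
  by (simp add: hop_sum_def dilation_def hop_diff_def shift_def shift_adj_def axis_def algebra_simps)



lemma hop_sum_hop_sum: "hop_sum i (hop_sum i u) n = hop_diff i (hop_diff i u) n + 4 * u n"
  by (simp add: hop_sum_def hop_diff_def shift_def shift_adj_def algebra_simps)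

text \<open>The positive commutator: hopping in direction \<open>i\<close> commutes with the other generators of
  dilations, and its commutator with its own is the square of \<^const>\<open>hop_diff\<close>, which only
  vanishes at the band edges.\<close>

lemma ip_dilation_hop_sum:
  assumes "fsupp u"
  shows "2 * ip (dilation i u) (hop_sum j u) = (if i = j then sq_sum (hop_diff i u) else 0)"
proof -
  have 1: "ip (dilation i u) (hop_sum j u) = - ip u (dilation i (hop_sum j u))"
    using assms by (simp add: ip_dilation)
  have 2: "ip (dilation i u) (hop_sum j u) = ip u (hop_sum j (dilation i u))"
    using assms ip_hop_sum[of u "dilation i u" j] by (simp add: ip_commute)
  show ?thesis
  proof (cases "i = j")
    case True
    have "ip u (hop_sum i (dilation i u)) = ip u (dilation i (hop_sum i u)) - ip u (hop_diff i (hop_diff i u))"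
      unfolding hop_sum_dilation_commutator[abs_def] using assms by (simp add: ip_diff_right)
    moreover have "ip u (hop_diff i (hop_diff i u)) = - sq_sum (hop_diff i u)"
      using assms by (simp add: ip_hop_diff)
    ultimately show ?thesis using 1 2 True by simp
  next
    case False
    then show ?thesis using 1 2 by (simp add: hop_sum_dilation_commute)
  qed
qed

lemma l2_bounded_shift:
  "l2_bounded u \<Longrightarrow> l2_bounded (\<lambda>k. shift i (u k))" "l2_bounded u \<Longrightarrow> l2_bounded (\<lambda>k. shift_adj i (u k))"
  unfolding l2_bounded_def by auto

lemma l2_null_shift:
  "l2_null u \<Longrightarrow> l2_null (\<lambda>k. shift i (u k))" "l2_null u \<Longrightarrow> l2_null (\<lambda>k. shift_adj i (u k))"
  unfolding l2_null_def by auto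

lemma l2_bounded_hop:
  assumes "l2_bounded u"
  shows "l2_bounded (\<lambda>k. hop_sum i (u k))" "l2_bounded (\<lambda>k. hop_diff i (u k))"
  unfolding hop_sum_def[abs_def] hop_diff_def[abs_def]
  using l2_bounded_add l2_bounded_diff l2_bounded_shift[OF assms] by blast+

lemma l2_null_hop:
  assumes "l2_null u"
  shows "l2_null (\<lambda>k. hop_sum i (u k))" "l2_null (\<lambda>k. hop_diff i (u k))"
  unfolding hop_sum_def[abs_def] hop_diff_def[abs_def]
  using l2_null_add l2_null_diff l2_null_shift[OF assms] by blast+

text \<open>The values of \<open>\<Sum>\<^sub>i T\<^sub>i\<close> at the corners of \<open>[- 2, 2]\<^sup>J\<close>, where all velocities \<open>4 - T\<^sub>i\<^sup>2\<close> vanish.\<close>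

definition threshold_sums :: "'d set \<Rightarrow> real set" where
  "threshold_sums J = {\<Sum>i\<in>J. s i | s. \<forall>i\<in>J. s i = 2 \<or> s i = - 2}"

text \<open>A sequence on which every \<^term>\<open>hop_diff i\<close> vanishes lives at the corners of the spectrum,
  where each \<^term>\<open>hop_sum i\<close> is \<open>\<plusminus> 2\<close>. The splitting \<open>4 u = (2 + T) u + (2 - T) u\<close> with
  \<open>T = hop_sum j\<close> peels off one direction at a time, and no corner is compatible with an energy
  that is not a threshold.\<close>

lemma l2_null_if_not_threshold:
  fixes u :: "nat \<Rightarrow> int ^ 'd \<Rightarrow> real"
  assumes "finite J" "l2_bounded u" "\<And>i. i \<in> J \<Longrightarrow> l2_null (\<lambda>k. hop_diff i (u k))"
    and "l2_null (\<lambda>k n. (\<Sum>i\<in>J. hop_sum i (u k) n) - e * u k n)"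
    and "e \<notin> threshold_sums J"
  shows "l2_null u"
  using assms
proof (induction J arbitrary: u e rule: finite_induct)
  case empty
  then have "e \<noteq> 0" by (auto simp: threshold_sums_def)
  moreover have "l2_null (\<lambda>k n. (- 1 / e) * (0 - e * u k n))"
    using empty.prems(3) by (intro l2_null_scale) simp
  ultimately show ?case by simp
next
  case (insert j J)
  define w where "w \<sigma> k n = hop_sum j (u k) n + \<sigma> * 2 * u k n" for \<sigma> :: real and k n
  have w_hop: "hop_sum i (w \<sigma> k) n = hop_sum j (hop_sum i (u k)) n + \<sigma> * 2 * hop_sum i (u k) n"
    "hop_diff i (w \<sigma> k) n = hop_sum j (hop_diff i (u k)) n + \<sigma> * 2 * hop_diff i (u k) n" for \<sigma> i k n
    by (simp_all add: w_def[abs_def] hop_sum_def hop_diff_def shift_def shift_adj_def algebra_simps)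
  have null: "l2_null (w \<sigma>)" if \<sigma>: "\<sigma> = 1 \<or> \<sigma> = -1" for \<sigma>
  proof (rule insert.IH)
    show "l2_bounded (w \<sigma>)"
      unfolding w_def[abs_def]
      by (intro l2_bounded_add l2_bounded_hop l2_bounded_scale insert.prems)
    show "l2_null (\<lambda>k. hop_diff i (w \<sigma> k))" if "i \<in> J" for i
      unfolding w_hop(2)[abs_def] using that
      by (intro l2_null_add l2_null_hop(1) l2_null_scale insert.prems) auto
    \<comment> \<open>Apply \<open>T\<^sub>j + 2 \<sigma>\<close> to the null sequence \<open>?R\<close> and use \<open>T\<^sub>j\<^sup>2 = D\<^sub>j\<^sup>2 + 4\<close>.\<close>
    let ?R = "\<lambda>k n. (\<Sum>i\<in>insert j J. hop_sum i (u k) n) - e * u k n"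
    have sum_shift: "(\<Sum>i\<in>J. hop_sum j (hop_sum i (u k)) n) = hop_sum j (\<lambda>n. \<Sum>i\<in>J. hop_sum i (u k) n) n" for k n
      by (simp add: hop_sum_def shift_def shift_adj_def sum.distrib)
    have lin: "hop_sum j (?R k) n = hop_sum j (hop_sum j (u k)) n
        + hop_sum j (\<lambda>n. \<Sum>i\<in>J. hop_sum i (u k) n) n - e * hop_sum j (u k) n" for k n
      using insert.hyps by (simp add: hop_sum_def shift_def shift_adj_def algebra_simps)
    have "l2_null (\<lambda>k n. hop_sum j (?R k) n + \<sigma> * 2 * ?R k n - hop_diff j (hop_diff j (u k)) n)"
      by (rule l2_null_diff[OF l2_null_add[OF l2_null_hop(1)[OF insert.prems(3)] l2_null_scale[OF insert.prems(3)]]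
            l2_null_hop(2)[OF insert.prems(2)]]) simp
    also have "(\<lambda>k n. hop_sum j (?R k) n + \<sigma> * 2 * ?R k n - hop_diff j (hop_diff j (u k)) n)
        = (\<lambda>k n. (\<Sum>i\<in>J. hop_sum i (w \<sigma> k) n) - (e - \<sigma> * 2) * w \<sigma> k n)"
    proof (intro ext)
      fix k n
      have "(\<Sum>i\<in>J. hop_sum i (w \<sigma> k) n) = hop_sum j (\<lambda>n. \<Sum>i\<in>J. hop_sum i (u k) n) n
          + \<sigma> * 2 * (\<Sum>i\<in>J. hop_sum i (u k) n)"
        unfolding w_hop sum.distrib sum_shift by (simp add: sum_distrib_left)
      then show "hop_sum j (?R k) n + \<sigma> * 2 * ?R k n - hop_diff j (hop_diff j (u k)) n
          = (\<Sum>i\<in>J. hop_sum i (w \<sigma> k) n) - (e - \<sigma> * 2) * w \<sigma> k n"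
        unfolding lin hop_sum_hop_sum w_def using insert.hyps \<sigma>
        by (auto simp: algebra_simps)
    qed
    finally show "l2_null (\<lambda>k n. (\<Sum>i\<in>J. hop_sum i (w \<sigma> k) n) - (e - \<sigma> * 2) * w \<sigma> k n)" .
    show "e - \<sigma> * 2 \<notin> threshold_sums J"
    proof
      assume "e - \<sigma> * 2 \<in> threshold_sums J"
      then obtain s where s: "e - \<sigma> * 2 = (\<Sum>i\<in>J. s i)" "\<forall>i\<in>J. s i = 2 \<or> s i = - 2"
        by (auto simp: threshold_sums_def)
      have "e = (\<Sum>i\<in>insert j J. (s(j := \<sigma> * 2)) i)"
        using insert.hyps s(1) by (simp add: sum.If_cases[symmetric]) (smt (verit) sum.cong)
      moreover have "\<forall>i\<in>insert j J. (s(j := \<sigma> * 2)) i = 2 \<or> (s(j := \<sigma> * 2)) i = - 2"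
        using s(2) \<sigma> by auto
      ultimately have "e \<in> threshold_sums (insert j J)"
        unfolding threshold_sums_def by blast
      then show False using insert.prems by simp
    qed
  qed
  have "l2_null (\<lambda>k n. (1/4) * (w 1 k n - w (-1) k n))"
    by (intro l2_null_scale l2_null_diff null) auto
  then show ?case by (simp add: w_def)
qed

section \<open>The oscillating part of the potential\<close>

definition checker :: "int ^ 'd \<Rightarrow> real" where
  "checker n = (- 1) powi (\<Sum>i\<in>UNIV. n $ i)"

lemma abs_checker [simp]: "\<bar>checker n\<bar> = 1"
  by (simp add: checker_def power_int_abs)

lemma w2_eq: "w2 w n = w * checker n / lnorm n"
  by (simp add: w2_def checker_def)

lemma checker_step:
  "checker (n + axis i 1) = - checker n" "checker (n - axis i 1) = - checker n"
proof -
  have s: "(\<Sum>j\<in>UNIV. (axis i (1::int)) $ j) = 1"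
    by (simp add: axis_def)
  show "checker (n + axis i 1) = - checker n" "checker (n - axis i 1) = - checker n"
    by (simp_all add: checker_def sum.distrib sum_subtractf s power_int_add power_int_diff)
qed

lemma tendsto_cofinite_step:
  fixes f :: "int ^ 'd \<Rightarrow> real"
  assumes "(f \<longlongrightarrow> L) cofinite"
  shows "((\<lambda>n. f (n + axis i 1)) \<longlongrightarrow> L) cofinite" "((\<lambda>n. f (n - axis i 1)) \<longlongrightarrow> L) cofinite"
proof -
  have "filterlim h cofinite cofinite" if "inj h" for h :: "int ^ 'd \<Rightarrow> int ^ 'd"
    unfolding filterlim_iff eventually_cofinite
  proof (intro allI impI)
    fix P :: "int ^ 'd \<Rightarrow> bool" assume "finite {x. \<not> P x}"
    then have "finite (h -` {x. \<not> P x})" using that by (intro finite_vimageI)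
    then show "finite {x. \<not> P (h x)}" by (simp add: vimage_def)
  qed
  then show "((\<lambda>n. f (n + axis i 1)) \<longlongrightarrow> L) cofinite" "((\<lambda>n. f (n - axis i 1)) \<longlongrightarrow> L) cofinite"
    by (auto intro!: filterlim_compose[OF assms] simp: inj_def)
qed

lemma inverse_lnorm_tendsto_0: "((\<lambda>n :: int ^ 'd. 1 / (lnorm n - 1)) \<longlongrightarrow> 0) cofinite"
proof -
  have "filterlim (\<lambda>n :: int ^ 'd. - 1 + lnorm n) at_top cofinite"
    by (rule filterlim_tendsto_add_at_top[OF tendsto_const filterlim_lnorm_cofinite])
  then show ?thesis
    using tendsto_inverse_0_at_top by (simp add: divide_inverse add.commute[of "- 1"])
qed

lemma eventually_lnorm_gt: "\<forall>\<^sub>F n :: int ^ 'd in cofinite. R < lnorm n"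
  using filterlim_lnorm_cofinite by (auto simp: filterlim_at_top_dense)

definition direction :: "'d \<Rightarrow> int ^ 'd \<Rightarrow> real" where
  "direction i n = real_of_int (n $ i) / lnorm n"

lemma abs_direction_le: "\<bar>direction i n\<bar> \<le> 1"
  using coord_le_lnorm[of n i] lnorm_nonneg[of n]
  by (auto simp: direction_def divide_le_eq_1)

text \<open>On the lattice a unit step changes \<open>n / |n|\<close> by \<open>O(1 / |n|)\<close>, so multiplication by it
  commutes with hopping up to terms that vanish at infinity.\<close>

lemma direction_slowly_varying:
  "((\<lambda>n. direction i (n - axis j 1) - direction i n) \<longlongrightarrow> 0) cofinite"
proof (rule Lim_null_comparison)
  show "((\<lambda>n :: int ^ 'a. 2 * (1 / (lnorm n - 1))) \<longlongrightarrow> 0) cofinite"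
    by (rule tendsto_mult_right_zero[OF inverse_lnorm_tendsto_0])
  show "\<forall>\<^sub>F n in cofinite. norm (direction i (n - axis j 1) - direction i n) \<le> 2 * (1 / (lnorm n - 1))"
    using eventually_lnorm_gt[of 1]
  proof eventually_elim
    case (elim n)
    let ?m = "n - axis j (1::int)"
    define a b where "a = lnorm n" and "b = lnorm ?m"
    have ab: "\<bar>b - a\<bar> \<le> 1" "1 < a" using lnorm_step(2)[of n j] elim by (auto simp: a_def b_def)
    have "\<bar>real_of_int (?m $ i) - real_of_int (n $ i)\<bar> \<le> 1"
      by (simp add: axis_def)
    moreover have "\<bar>real_of_int (n $ i)\<bar> \<le> a" using coord_le_lnorm a_def by simp
    ultimately obtain x y where xy: "real_of_int (?m $ i) = x" "real_of_int (n $ i) = y" "\<bar>x - y\<bar> \<le> 1" "\<bar>y\<bar> \<le> a"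
      by blast
    have "0 < b" using ab by linarith
    have "x / b - y / a = (x - y) / b + y / a * ((a - b) / b)"
      using \<open>0 < b\<close> ab by (simp add: field_simps)
    moreover have "\<bar>(x - y) / b\<bar> \<le> 1 / b" using xy \<open>0 < b\<close> by (simp add: divide_right_mono)
    moreover have "\<bar>y / a * ((a - b) / b)\<bar> \<le> 1 * (1 / b)"
      unfolding abs_mult using xy \<open>0 < b\<close> ab
      by (intro mult_mono) (auto simp: divide_right_mono abs_minus_commute)
    moreover have "1 / b \<le> 1 / (a - 1)" using ab by (intro divide_left_mono) auto
    ultimately show ?case
      unfolding direction_def xy a_def[symmetric] b_def[symmetric] real_norm_def by linarith
  qed
qed

text \<open>A unit step flips the sign of \<^term>\<open>w2 w\<close>, so its difference does not gain a factor
  \<open>1 / |n|\<close>: it is twice the potential, and the factor \<open>n\<^sub>i\<close> leaves a term of order one.\<close>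

lemma w2_commutator:
  "((\<lambda>n. real_of_int (n $ i) * (w2 w n - shift i (w2 w) n) - 2 * w * (checker n * direction i n)) \<longlongrightarrow> 0) cofinite"
proof (rule Lim_null_comparison)
  show "((\<lambda>n :: int ^ 'a. \<bar>w\<bar> * (1 / (lnorm n - 1))) \<longlongrightarrow> 0) cofinite"
    by (rule tendsto_mult_right_zero[OF inverse_lnorm_tendsto_0])
  show "\<forall>\<^sub>F n in cofinite. norm (real_of_int (n $ i) * (w2 w n - shift i (w2 w) n) - 2 * w * (checker n * direction i n))
      \<le> \<bar>w\<bar> * (1 / (lnorm n - 1))"
    using eventually_lnorm_gt[of 1]
  proof eventually_elim
    case (elim n)
    define a b where "a = lnorm n" and "b = lnorm (n - axis i 1)"
    define y where "y = real_of_int (n $ i)"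
    have ab: "\<bar>b - a\<bar> \<le> 1" "1 < a" using lnorm_step(2)[of n i] elim by (auto simp: a_def b_def)
    have y: "\<bar>y\<bar> \<le> a" using coord_le_lnorm[of n i] by (simp add: a_def y_def)
    have "0 < b" using ab by linarith
    have "real_of_int (n $ i) * (w2 w n - shift i (w2 w) n) - 2 * w * (checker n * direction i n)
        = w * checker n * (y / a * ((a - b) / b))"
      unfolding w2_eq shift_def direction_def checker_step a_def[symmetric] b_def[symmetric] y_def[symmetric]
      using \<open>0 < b\<close> ab by (simp add: field_simps)
    moreover have "\<bar>y / a * ((a - b) / b)\<bar> \<le> 1 * (1 / b)"
      unfolding abs_mult using y \<open>0 < b\<close> ab
      by (intro mult_mono) (auto simp: divide_right_mono abs_minus_commute)
    moreover have "1 / b \<le> 1 / (a - 1)" using ab by (intro divide_left_mono) auto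
    ultimately have eq: "norm (real_of_int (n $ i) * (w2 w n - shift i (w2 w) n) - 2 * w * (checker n * direction i n))
        = \<bar>w\<bar> * \<bar>y / a * ((a - b) / b)\<bar>" and le: "\<bar>y / a * ((a - b) / b)\<bar> \<le> 1 / (a - 1)"
      unfolding real_norm_def by (simp_all only: abs_mult abs_checker mult_1_right mult_1_left)
    show ?case
      unfolding eq a_def[symmetric] by (rule mult_left_mono[OF le abs_ge_zero])
  qed
qed

definition hop_total :: "(int ^ 'd \<Rightarrow> real) \<Rightarrow> int ^ 'd \<Rightarrow> real" where
  "hop_total u n = (\<Sum>i\<in>UNIV. hop_sum i u n)"

lemma fsupp_hop_total [intro, simp]: "fsupp u \<Longrightarrow> fsupp (hop_total u)"
  unfolding hop_total_def[abs_def] by (intro fsupp_sum fsupp_hop)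

lemma ip_hop_total:
  assumes "fsupp u" "fsupp v"
  shows "ip (hop_total u) v = ip u (hop_total v)"
  unfolding hop_total_def[abs_def] using assms by (simp add: ip_sum_left ip_sum_right ip_hop_sum)

lemma hop_total_checker: "hop_total (\<lambda>n. checker n * v n) n = - (checker n * hop_total v n)"
  by (simp add: hop_total_def hop_sum_def shift_def shift_adj_def checker_step sum_distrib_left
      sum_negf[symmetric] algebra_simps)

lemma shift_tendsto_0:
  assumes "\<And>n. (\<lambda>k. u k n) \<longlonglongrightarrow> (0::real)"
  shows "(\<lambda>k. shift i (u k) n) \<longlonglongrightarrow> 0" "(\<lambda>k. shift_adj i (u k) n) \<longlonglongrightarrow> 0"
  using assms by (simp_all add: shift_def shift_adj_def)

lemma hop_diff_tendsto_0:
  assumes "\<And>n. (\<lambda>k. u k n) \<longlonglongrightarrow> (0::real)"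
  shows "(\<lambda>k. hop_diff i (u k) n) \<longlonglongrightarrow> 0"
  using tendsto_diff[OF shift_tendsto_0[OF assms]] by (simp add: hop_diff_def)



text \<open>The checkerboard sign turns the hopping operator \<open>T\<close> into \<open>- T\<close>, so it maps approximate
  eigenvectors of energy \<open>e\<close> to approximate eigenvectors of energy \<open>- e\<close>. For \<open>e \<noteq> 0\<close> the two are
  asymptotically orthogonal. The slowly varying factor \<open>\<theta>\<close> does not disturb this.\<close>

lemma ip_checker_tendsto_0:
  fixes u :: "nat \<Rightarrow> int ^ 'd \<Rightarrow> real"
  assumes u: "l2_bounded u" and pw: "\<And>n. (\<lambda>k. u k n) \<longlonglongrightarrow> 0"
    and approx: "l2_null (\<lambda>k n. hop_total (u k) n - e * u k n)" and "e \<noteq> 0"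
    and \<theta>: "\<And>n. \<bar>\<theta> n\<bar> \<le> 1" "\<And>j. ((\<lambda>n. \<theta> (n - axis j 1) - \<theta> n) \<longlongrightarrow> 0) cofinite"
  shows "(\<lambda>k. ip (u k) (\<lambda>n. checker n * (\<theta> n * shift i (u k) n))) \<longlonglongrightarrow> 0"
proof -
  define v where "v k n = \<theta> n * shift i (u k) n" for k n
  have fs: "fsupp (u k)" "fsupp (v k)" for k
    using u by (auto simp: l2_bounded_def v_def[abs_def])
  have "\<bar>\<theta> n * x\<bar> \<le> 1 * \<bar>x\<bar>" for n x
    using mult_right_mono[OF \<theta>(1)[of n] abs_ge_zero[of x]] by (simp add: abs_mult)
  then have dom: "\<bar>v k n\<bar> \<le> 1 * \<bar>shift i (u k) n\<bar>"
    "\<bar>\<theta> n * shift i (\<lambda>n. hop_total (u k) n - e * u k n) n\<bar> \<le> 1 * \<bar>shift i (\<lambda>n. hop_total (u k) n - e * u k n) n\<bar>" for k n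
    by (simp_all add: v_def)
  have Jv: "l2_bounded (\<lambda>k n. checker n * v k n)"
    by (rule l2_bounded_dom[OF l2_bounded_shift(1)[OF u], of _ 1 i]) (use dom in \<open>simp add: abs_mult\<close>)
  have Ju: "l2_bounded (\<lambda>k n. checker n * u k n)"
    by (rule l2_bounded_dom[OF u, of _ 1]) (simp add: abs_mult)
  have "((\<lambda>n. \<theta> (n + axis j 1) - \<theta> n) \<longlongrightarrow> 0) cofinite" for j
    using tendsto_minus[OF tendsto_cofinite_step(1)[OF \<theta>(2)[of j], of j]] by simp
  then have \<theta>': "((\<lambda>n. \<bar>\<theta> (n + axis j 1) - \<theta> n\<bar>) \<longlongrightarrow> 0) cofinite"
    "((\<lambda>n. \<bar>\<theta> (n - axis j 1) - \<theta> n\<bar>) \<longlongrightarrow> 0) cofinite" for j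
    using \<theta>(2) by (simp_all add: tendsto_rabs_zero_iff)
  have eq: "hop_total (v k) n - e * v k n
      = (\<Sum>j\<in>UNIV. (\<theta> (n - axis j 1) - \<theta> n) * shift j (shift i (u k)) n
            + (\<theta> (n + axis j 1) - \<theta> n) * shift_adj j (shift i (u k)) n)
        + \<theta> n * shift i (\<lambda>n. hop_total (u k) n - e * u k n) n" for k n
    by (simp add: hop_total_def hop_sum_def v_def shift_def shift_adj_def algebra_simps
        sum.distrib sum_subtractf sum_distrib_left)
  have v_approx: "l2_null (\<lambda>k n. hop_total (v k) n - e * v k n)"
    unfolding eq
  proof (intro l2_null_add l2_null_sum)
    show "l2_null (\<lambda>k n. (\<theta> (n - axis j 1) - \<theta> n) * shift j (shift i (u k)) n)" for j
      by (rule l2_null_of_local[OF l2_bounded_shift(1)[OF l2_bounded_shift(1)[OF u, of i], of j]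
            shift_tendsto_0(1)[OF shift_tendsto_0(1)[OF pw]] \<theta>'(2)[of j]]) (simp add: abs_mult)
    show "l2_null (\<lambda>k n. (\<theta> (n + axis j 1) - \<theta> n) * shift_adj j (shift i (u k)) n)" for j
      by (rule l2_null_of_local[OF l2_bounded_shift(2)[OF l2_bounded_shift(1)[OF u, of i], of j]
            shift_tendsto_0(2)[OF shift_tendsto_0(1)[OF pw]] \<theta>'(1)[of j]]) (simp add: abs_mult)
    show "l2_null (\<lambda>k n. \<theta> n * shift i (\<lambda>n. hop_total (u k) n - e * u k n) n)"
      by (rule l2_null_dom[OF l2_null_shift(1)[OF approx] dom(2)])
  qed
  \<comment> \<open>Moving \<open>T\<close> across the scalar product, \<open>e J\<close> equals both \<open>\<langle>T u, s v\<rangle>\<close> and \<open>- \<langle>u, s T v\<rangle> = - e J\<close>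
    up to \<open>o(1)\<close>, where \<open>s\<close> is the checkerboard sign.\<close>
  define J where "J k = ip (u k) (\<lambda>n. checker n * v k n)" for k
  have "2 * e * J k = - ip (\<lambda>n. checker n * v k n) (\<lambda>n. hop_total (u k) n - e * u k n)
      - ip (\<lambda>n. checker n * u k n) (\<lambda>n. hop_total (v k) n - e * v k n)" for k
  proof -
    have "ip (hop_total (u k)) (\<lambda>n. checker n * v k n) = ip (u k) (hop_total (\<lambda>n. checker n * v k n))"
      using fs by (simp add: ip_hop_total)
    also have "\<dots> = - ip (u k) (\<lambda>n. checker n * hop_total (v k) n)"
      unfolding hop_total_checker[abs_def] by (simp add: ip_minus_right)
    finally have 1: "ip (hop_total (u k)) (\<lambda>n. checker n * v k n) = - ip (\<lambda>n. checker n * u k n) (hop_total (v k))"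
      by (simp add: ip_mult_move)
    have 2: "ip (\<lambda>n. checker n * u k n) (v k) = J k" by (simp add: J_def ip_mult_move)
    have 3: "ip (\<lambda>n. checker n * v k n) (u k) = J k" by (simp add: J_def ip_commute)
    have 4: "ip (\<lambda>n. checker n * v k n) (hop_total (u k)) = - ip (\<lambda>n. checker n * u k n) (hop_total (v k))"
      using 1 by (simp add: ip_commute)
    show ?thesis
      using fs 2 3 4 by (simp add: ip_diff_right ip_scale_right)
  qed
  moreover have "(\<lambda>k. - ip (\<lambda>n. checker n * v k n) (\<lambda>n. hop_total (u k) n - e * u k n)
      - ip (\<lambda>n. checker n * u k n) (\<lambda>n. hop_total (v k) n - e * v k n)) \<longlonglongrightarrow> - 0 - 0"
    by (intro tendsto_diff tendsto_minus ip_tendsto_0[OF Jv approx] ip_tendsto_0[OF Ju v_approx])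
  ultimately have "(\<lambda>k. 2 * e * J k) \<longlonglongrightarrow> 0" by simp
  from tendsto_mult_right_zero[OF this, of "1 / (2 * e)"] \<open>e \<noteq> 0\<close>
  show ?thesis by (simp add: J_def[abs_def] v_def[abs_def])
qed

section \<open>No approximate eigenfunctions escape to infinity\<close>

lemma ip_dilation_mult:
  assumes "fsupp u"
  shows "ip (dilation i u) (\<lambda>n. U n * u n)
    = ip (shift i u) (\<lambda>n. real_of_int (n $ i) * (U n - shift i U n) * u n)"
proof -
  have "ip (\<lambda>n. (real_of_int (n $ i) + 1) * shift_adj i u n) (\<lambda>n. U n * u n)
      = ip u (\<lambda>n. real_of_int (n $ i) * shift i U n * shift i u n)"
    unfolding ip_mult_move ip_shift_adj
    by (rule arg_cong[where f = "ip u"], rule ext) (simp add: shift_def axis_def algebra_simps)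
  also have "\<dots> = ip (shift i u) (\<lambda>n. real_of_int (n $ i) * shift i U n * u n)"
    unfolding ip_def by (simp add: mult_ac)
  finally have "ip (dilation i u) (\<lambda>n. U n * u n)
      = ip (shift i u) (\<lambda>n. real_of_int (n $ i) * (U n * u n))
        - ip (shift i u) (\<lambda>n. real_of_int (n $ i) * shift i U n * u n)"
    unfolding dilation_def[abs_def] using assms by (simp add: ip_diff_left ip_mult_move)
  also have "\<dots> = ip (shift i u) (\<lambda>n. real_of_int (n $ i) * (U n * u n) - real_of_int (n $ i) * shift i U n * u n)"
    using assms by (simp add: ip_diff_right)
  finally show ?thesis by (simp add: algebra_simps)
qed

lemma ip_dilation_self: "fsupp u \<Longrightarrow> ip (dilation i u) u = 0"
  using ip_dilation[of u u i] by (simp add: ip_commute)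

lemma l2_null_scalar:
  assumes u: "l2_bounded u" and c: "c \<longlonglongrightarrow> 0"
  shows "l2_null (\<lambda>k n. c k * u k n)"
proof -
  obtain B where B: "\<And>k. sq_sum (u k) \<le> B" using u by (auto simp: l2_bounded_def)
  have "(\<lambda>k. (c k)\<^sup>2 * B) \<longlonglongrightarrow> 0\<^sup>2 * B" by (intro tendsto_intros c)
  then have "(\<lambda>k. (c k)\<^sup>2 * B) \<longlonglongrightarrow> 0" by simp
  moreover have "sq_sum (\<lambda>n. c k * u k n) \<le> (c k)\<^sup>2 * B" for k
    unfolding sq_sum_scale by (rule mult_left_mono[OF B zero_le_power2])
  ultimately have "(\<lambda>k. sq_sum (\<lambda>n. c k * u k n)) \<longlonglongrightarrow> 0"
    by (intro tendsto_0_squeeze[OF sq_sum_nonneg])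
  then show ?thesis using u by (simp add: l2_null_def l2_bounded_def)
qed

text \<open>Pairing the equation with \<open>B u\<close>, where \<open>B\<close> is the sum of the dilation generators, gives half of
  \<open>\<Sum>\<^sub>i |D\<^sub>i u|\<^sup>2\<close> on the side of \<open>T\<close>. On the other side, \<open>e u\<close> contributes nothing because \<open>B\<close> is
  antisymmetric, the potentials contribute \<open>o(1)\<close>, and the term with \<open>g\<close> contributes
  \<open>- \<langle>C u, g C u\<rangle> \<le> 0\<close> up to \<open>o(1)\<close>, where \<open>C = \<Sum>\<^sub>i n\<^sub>i D\<^sub>i\<close> differs from \<open>B\<close> by a bounded operator.
  The remainder \<open>\<rho>\<close> has to be small even after multiplication by \<open>|n|\<close>, because \<open>B\<close> grows
  like \<open>|n|\<close>.\<close>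

lemma no_escape:
  fixes u :: "nat \<Rightarrow> int ^ 'd \<Rightarrow> real"
  assumes u: "l2_bounded u" and pw: "\<And>n. (\<lambda>k. u k n) \<longlonglongrightarrow> 0"
    and V: "(V \<longlongrightarrow> 0) cofinite"
    and dV: "\<And>i. ((\<lambda>n. real_of_int (n $ i) * (V n - shift i V n)) \<longlongrightarrow> 0) cofinite"
    and \<epsilon>: "\<epsilon> \<longlonglongrightarrow> e" "e \<noteq> 0" "e \<notin> threshold_sums (UNIV :: 'd set)"
    and g: "\<And>k n. 0 \<le> g k n" "\<And>k n i. g k n * \<bar>real_of_int (n $ i)\<bar> \<le> \<eta> n" "(\<eta> \<longlongrightarrow> 0) cofinite"
    and \<rho>: "\<And>k n. \<rho> k n = (\<epsilon> k + V n + w2 w n) * u k n - hop_total (u k) n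
              - g k n * (\<Sum>i\<in>UNIV. real_of_int (n $ i) * hop_diff i (u k) n)"
    and \<rho>_null: "l2_null (\<lambda>k n. (1 + lnorm n) * \<rho> k n)"
  shows "l2_null u"
proof -
  have fs [simp]: "fsupp (u k)" for k using u by (simp add: l2_bounded_def)
  define C where "C k n = (\<Sum>i\<in>UNIV. real_of_int (n $ i) * hop_diff i (u k) n)" for k n
  define B where "B k n = (\<Sum>i\<in>UNIV. dilation i (u k) n)" for k n
  have fsC [simp]: "fsupp (C k)" and fsB [simp]: "fsupp (B k)" for k
    unfolding C_def[abs_def] B_def[abs_def] by (auto intro!: fsupp_sum)
  have fs\<rho> [simp]: "fsupp (\<rho> k)" for k
    unfolding \<rho>[abs_def] C_def[symmetric] by (intro fsupp_intros fsupp_hop_total fs fsC)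
  have W: "((w2 w :: int ^ 'd \<Rightarrow> real) \<longlongrightarrow> 0) cofinite"
  proof (rule Lim_null_comparison)
    show "((\<lambda>n :: int ^ 'd. \<bar>w\<bar> * (1 / (lnorm n - 1))) \<longlongrightarrow> 0) cofinite"
      by (rule tendsto_mult_right_zero[OF inverse_lnorm_tendsto_0])
    show "\<forall>\<^sub>F n :: int ^ 'd in cofinite. norm (w2 w n) \<le> \<bar>w\<bar> * (1 / (lnorm n - 1))"
      using eventually_lnorm_gt[of 1]
      by eventually_elim (simp add: w2_eq abs_mult divide_left_mono)
  qed
  have pot_null: "l2_null (\<lambda>k n. U n * u k n)" if "(U \<longlongrightarrow> 0) cofinite" for U
    by (rule l2_null_of_local[OF u pw, of "\<lambda>n. \<bar>U n\<bar>"]) (use that in \<open>simp_all add: abs_mult tendsto_rabs_zero_iff\<close>)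
  have gC: "l2_null (\<lambda>k n. g k n * C k n)"
  proof -
    have "l2_null (\<lambda>k n. \<Sum>i\<in>UNIV. g k n * real_of_int (n $ i) * hop_diff i (u k) n)"
    proof (rule l2_null_sum)
      fix i
      show "l2_null (\<lambda>k n. g k n * real_of_int (n $ i) * hop_diff i (u k) n)"
      proof (rule l2_null_of_local[OF l2_bounded_hop(2)[OF u, of i] hop_diff_tendsto_0[OF pw] g(3)])
        fix k n
        have "\<bar>g k n * real_of_int (n $ i)\<bar> \<le> \<eta> n" using g(1,2) by (simp add: abs_mult)
        then show "\<bar>g k n * real_of_int (n $ i) * hop_diff i (u k) n\<bar> \<le> \<eta> n * \<bar>hop_diff i (u k) n\<bar>"
          unfolding abs_mult[of _ "hop_diff i (u k) n"] by (rule mult_right_mono) simp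
      qed
    qed
    then show ?thesis by (simp add: C_def sum_distrib_left mult.assoc)
  qed
  have \<rho>0: "l2_null \<rho>"
  proof (rule l2_null_dom[OF \<rho>_null, of _ 1])
    fix k n
    show "\<bar>\<rho> k n\<bar> \<le> 1 * \<bar>(1 + lnorm n) * \<rho> k n\<bar>"
      using mult_right_mono[of 1 "\<bar>1 + lnorm n\<bar>" "\<bar>\<rho> k n\<bar>"] lnorm_nonneg[of n] by (simp add: abs_mult)
  qed
  have \<epsilon>0: "l2_null (\<lambda>k n. (\<epsilon> k - e) * u k n)"
    by (rule l2_null_scalar[OF u LIM_zero[OF \<epsilon>(1)]])
  have approx: "l2_null (\<lambda>k n. hop_total (u k) n - e * u k n)"
  proof -
    have "l2_null (\<lambda>k n. (\<epsilon> k - e) * u k n + V n * u k n + w2 w n * u k n - g k n * C k n - \<rho> k n)"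
      by (intro l2_null_diff l2_null_add \<epsilon>0 pot_null V W gC \<rho>0)
    then show ?thesis by (simp add: \<rho> C_def algebra_simps)
  qed
  have B_eq: "B k n = C k n - (\<Sum>i\<in>UNIV. shift_adj i (u k) n)" for k n
    by (simp add: B_def C_def dilation_def hop_diff_def sum_subtractf[symmetric] algebra_simps)
  have comm_V: "(\<lambda>k. ip (dilation i (u k)) (\<lambda>n. V n * u k n)) \<longlonglongrightarrow> 0" for i
    unfolding ip_dilation_mult[OF fs]
    by (rule ip_tendsto_0[OF l2_bounded_shift(1)[OF u] pot_null[OF dV]])
  have comm_W: "(\<lambda>k. ip (dilation i (u k)) (\<lambda>n. w2 w n * u k n)) \<longlonglongrightarrow> 0" for i
  proof -
    let ?\<kappa> = "\<lambda>n. real_of_int (n $ i) * (w2 w n - shift i (w2 w) n) - 2 * w * (checker n * direction i n)"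
    have "ip (dilation i (u k)) (\<lambda>n. w2 w n * u k n)
        = ip (shift i (u k)) (\<lambda>n. ?\<kappa> n * u k n)
          + 2 * w * ip (u k) (\<lambda>n. checker n * (direction i n * shift i (u k) n))" for k
    proof -
      have "ip (dilation i (u k)) (\<lambda>n. w2 w n * u k n)
          = ip (shift i (u k)) (\<lambda>n. ?\<kappa> n * u k n + 2 * w * (checker n * direction i n * u k n))"
        unfolding ip_dilation_mult[OF fs] by (rule arg_cong[where f = "ip _"]) (simp add: algebra_simps)
      also have "\<dots> = ip (shift i (u k)) (\<lambda>n. ?\<kappa> n * u k n)
          + 2 * w * ip (shift i (u k)) (\<lambda>n. checker n * direction i n * u k n)"
        by (simp add: ip_add_right ip_scale_right)
      also have "ip (shift i (u k)) (\<lambda>n. checker n * direction i n * u k n)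
          = ip (u k) (\<lambda>n. checker n * (direction i n * shift i (u k) n))"
        unfolding ip_def by (simp add: mult_ac)
      finally show ?thesis .
    qed
    moreover have "(\<lambda>k. ip (shift i (u k)) (\<lambda>n. ?\<kappa> n * u k n)
          + 2 * w * ip (u k) (\<lambda>n. checker n * (direction i n * shift i (u k) n))) \<longlonglongrightarrow> 0 + 2 * w * 0"
      by (intro tendsto_add tendsto_mult_left ip_tendsto_0[OF l2_bounded_shift(1)[OF u] pot_null[OF w2_commutator]]
          ip_checker_tendsto_0[OF u pw approx \<epsilon>(2) abs_direction_le direction_slowly_varying])
    ultimately show ?thesis by simp
  qed
  have ip_B\<rho>: "(\<lambda>k. ip (B k) (\<rho> k)) \<longlonglongrightarrow> 0"
  proof -
    have wt: "l2_null (\<lambda>k n. (real_of_int (n $ i) + c) * \<rho> k n)" if "\<bar>c\<bar> \<le> 1" for i c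
    proof (rule l2_null_dom[OF \<rho>_null, of _ 1])
      fix k n
      have "\<bar>real_of_int (n $ i) + c\<bar> \<le> \<bar>1 + lnorm n\<bar>"
        using coord_le_lnorm[of n i] lnorm_nonneg[of n] that by linarith
      then show "\<bar>(real_of_int (n $ i) + c) * \<rho> k n\<bar> \<le> 1 * \<bar>(1 + lnorm n) * \<rho> k n\<bar>"
        by (simp add: abs_mult mult_right_mono)
    qed
    have "ip (B k) (\<rho> k) = (\<Sum>i\<in>UNIV. ip (shift i (u k)) (\<lambda>n. (real_of_int (n $ i) + 0) * \<rho> k n)
        - ip (shift_adj i (u k)) (\<lambda>n. (real_of_int (n $ i) + 1) * \<rho> k n))" for k
      unfolding B_def[abs_def] dilation_def
      by (subst ip_sum_left) (auto simp: ip_diff_left ip_mult_move intro!: sum.cong)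
    moreover have "(\<lambda>k. \<Sum>i\<in>UNIV. ip (shift i (u k)) (\<lambda>n. (real_of_int (n $ i) + 0) * \<rho> k n)
        - ip (shift_adj i (u k)) (\<lambda>n. (real_of_int (n $ i) + 1) * \<rho> k n)) \<longlonglongrightarrow> (\<Sum>i\<in>(UNIV :: 'd set). 0 - 0)"
      by (intro tendsto_sum tendsto_diff ip_tendsto_0 l2_bounded_shift u wt) auto
    ultimately show ?thesis by simp
  qed
  define R where "R k = (\<Sum>i\<in>UNIV. ip (dilation i (u k)) (\<lambda>n. V n * u k n) + ip (dilation i (u k)) (\<lambda>n. w2 w n * u k n))
      + ip (\<lambda>n. \<Sum>i\<in>UNIV. shift_adj i (u k) n) (\<lambda>n. g k n * C k n) - ip (B k) (\<rho> k)" for k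
  have "R \<longlonglongrightarrow> (\<Sum>i\<in>(UNIV :: 'd set). 0 + 0) + 0 - 0"
    unfolding R_def[abs_def]
    by (intro tendsto_diff tendsto_add tendsto_sum comm_V comm_W ip_B\<rho> ip_tendsto_0[OF _ gC]
        l2_bounded_sum l2_bounded_shift u)
  then have R: "R \<longlonglongrightarrow> 0" by simp
  have virial: "(\<Sum>i\<in>UNIV. sq_sum (hop_diff i (u k))) \<le> 2 * R k" for k
  proof -
    have B_mult: "ip (B k) (\<lambda>n. U n * u k n) = (\<Sum>i\<in>UNIV. ip (dilation i (u k)) (\<lambda>n. U n * u k n))" for U
      unfolding B_def[abs_def] by (rule ip_sum_left) simp
    have Bu: "ip (B k) (u k) = 0"
      unfolding B_def[abs_def] by (subst ip_sum_left) (simp_all add: ip_dilation_self)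
    have "(\<Sum>i\<in>UNIV. sq_sum (hop_diff i (u k)))
        = (\<Sum>i\<in>UNIV. \<Sum>j\<in>UNIV. 2 * ip (dilation i (u k)) (hop_sum j (u k)))"
      by (simp add: ip_dilation_hop_sum)
    also have "\<dots> = 2 * ip (B k) (hop_total (u k))"
      unfolding B_def[abs_def] hop_total_def[abs_def]
      by (simp add: ip_sum_left ip_sum_right sum_distrib_left)
    also have "hop_total (u k) = (\<lambda>n. \<epsilon> k * u k n + V n * u k n + w2 w n * u k n - g k n * C k n - \<rho> k n)"
      by (rule ext) (simp add: \<rho> C_def algebra_simps)
    also have "ip (B k) \<dots> = (\<Sum>i\<in>UNIV. ip (dilation i (u k)) (\<lambda>n. V n * u k n))
        + (\<Sum>i\<in>UNIV. ip (dilation i (u k)) (\<lambda>n. w2 w n * u k n)) - ip (B k) (\<lambda>n. g k n * C k n) - ip (B k) (\<rho> k)"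
      by (simp add: ip_diff_right ip_add_right ip_scale_right Bu B_mult)
    also have "ip (B k) (\<lambda>n. g k n * C k n)
        = ip (C k) (\<lambda>n. g k n * C k n) - ip (\<lambda>n. \<Sum>i\<in>UNIV. shift_adj i (u k) n) (\<lambda>n. g k n * C k n)"
      unfolding B_eq[abs_def] by (rule ip_diff_left) (auto intro!: fsupp_sum)
    finally have "(\<Sum>i\<in>UNIV. sq_sum (hop_diff i (u k))) = 2 * (R k - ip (C k) (\<lambda>n. g k n * C k n))"
      by (simp add: R_def sum.distrib)
    moreover have "0 \<le> ip (C k) (\<lambda>n. g k n * C k n)"
      unfolding ip_def mult.left_commute[of "C k _"] using g(1) by (intro infsum_nonneg) simp
    ultimately show ?thesis by simp
  qed
  have D_null: "l2_null (\<lambda>k. hop_diff i (u k))" for i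
  proof -
    have "sq_sum (hop_diff i (u k)) \<le> 2 * R k" for k
      by (rule order_trans[OF member_le_sum virial]) (auto simp: sq_sum_nonneg)
    moreover have "(\<lambda>k. 2 * R k) \<longlonglongrightarrow> 0" using R by (rule tendsto_mult_right_zero)
    ultimately have "(\<lambda>k. sq_sum (hop_diff i (u k))) \<longlonglongrightarrow> 0"
      by (rule tendsto_0_squeeze[OF sq_sum_nonneg])
    then show ?thesis by (simp add: l2_null_def)
  qed
  show ?thesis
    by (rule l2_null_if_not_threshold[of UNIV, OF _ u D_null _ \<epsilon>(3)])
       (use approx in \<open>simp_all add: hop_total_def\<close>)
qed

section \<open>Slowly growing weights\<close>

text \<open>The function \<open>(t / (1 + c t))\<^sup>p\<close> with \<open>p = 1/8\<close>: bounded for \<open>c > 0\<close>, and increasing to \<open>t\<^sup>p\<close> as \<open>c\<close>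
  decreases to zero, with estimates for two derivatives that do not depend on \<open>c\<close>. Inserting
  \<open>t = \<langle>n\<rangle>\<^sup>2\<close> gives weights \<open>F\<close> with \<open>|\<nabla>F|\<^sup>2 = O(|n|\<^sup>4\<^sup>p\<^sup>-\<^sup>2)\<close>. Since the dilation generator costs a
  factor \<open>|n|\<close>, quadratic errors in \<open>\<nabla>F\<close> are negligible for \<open>p < 1/4\<close>.\<close>

definition ramp :: "real \<Rightarrow> real \<Rightarrow> real" where
  "ramp c t = t powr (1/8) * (1 + c * t) powr (- 1/8)"

definition ramp_deriv :: "real \<Rightarrow> real \<Rightarrow> real" where
  "ramp_deriv c t = 1/8 * t powr (- 7/8) * (1 + c * t) powr (- 9/8)"

lemma powr_nonpos_le_1:
  fixes z a :: real
  assumes "1 \<le> z" "a \<le> 0"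
  shows "z powr a \<le> 1"
  using powr_mono[of a 0 z] assms by simp

lemma ramp_has_derivative:
  assumes "0 \<le> c" "0 < t"
  shows "(ramp c has_real_derivative ramp_deriv c t) (at t)"
proof -
  have pos: "0 < 1 + c * t" using assms by (simp add: add_pos_nonneg)
  have "(ramp c has_real_derivative
      1/8 * t powr (1/8 - 1) * (1 + c * t) powr (- 1/8)
        + t powr (1/8) * (- 1/8 * (1 + c * t) powr (- 1/8 - 1) * c)) (at t)"
    unfolding ramp_def[abs_def] using assms pos
    by (auto intro!: derivative_eq_intros simp: field_simps)
  moreover have "1/8 * t powr (1/8 - 1) * (1 + c * t) powr (- 1/8)
        + t powr (1/8) * (- 1/8 * (1 + c * t) powr (- 1/8 - 1) * c) = ramp_deriv c t"
  proof -
    define X Y where "X = t powr (- 7/8)" and "Y = (1 + c * t) powr (- 9/8)"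
    have "t powr (1/8 - 1) = X" "t powr (1/8) = t * X"
      using assms powr_mult_base[of t "- 7/8"] by (simp_all add: X_def)
    moreover have "(1 + c * t) powr (- 1/8 - 1) = Y" "(1 + c * t) powr (- 1/8) = (1 + c * t) * Y"
      using pos powr_mult_base[of "1 + c * t" "- 9/8"] by (simp_all add: Y_def)
    ultimately show ?thesis
      unfolding ramp_deriv_def X_def[symmetric] Y_def[symmetric] by (simp add: field_simps)
  qed
  ultimately show ?thesis by simp
qed

lemma ramp_deriv_has_derivative:
  assumes "0 \<le> c" "0 < t"
  shows "\<exists>D. (ramp_deriv c has_real_derivative D) (at t) \<and> \<bar>D\<bar> \<le> 1/4 * t powr (- 15/8)"
proof -
  define z where "z = 1 + c * t"
  have z: "1 \<le> z" "c * t \<le> z" using assms by (auto simp: z_def)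
  define D where "D = 1/8 * (- 7/8 * t powr (- 7/8 - 1) * z powr (- 9/8)
        + t powr (- 7/8) * (- 9/8 * z powr (- 9/8 - 1) * c))"
  have "(ramp_deriv c has_real_derivative D) (at t)"
    unfolding ramp_deriv_def[abs_def] D_def z_def using assms
    by (auto intro!: derivative_eq_intros simp: add_pos_nonneg field_simps)
  moreover have "\<bar>D\<bar> \<le> 1/4 * t powr (- 15/8)"
  proof -
    have t: "t powr (- 7/8) = t * t powr (- 15/8)"
      using assms powr_mult_base[of t "- 15/8"] by simp
    have z1: "z powr (- 9/8) = z * z powr (- 17/8)"
      using z powr_mult_base[of z "- 17/8"] by simp
    have z2: "0 \<le> z powr (- 9/8)" "z powr (- 9/8) \<le> 1"
      using z by (auto intro: powr_nonpos_le_1)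
    have z3: "0 \<le> c * t * z powr (- 17/8)" "c * t * z powr (- 17/8) \<le> 1"
      using assms z1 z2(2) order_trans[OF mult_right_mono[OF z(2), of "z powr (- 17/8)"], of 1] by simp_all
    have "D = - (1/64) * t powr (- 15/8) * (7 * z powr (- 9/8) + 9 * (c * t * z powr (- 17/8)))"
      unfolding D_def t by (simp add: algebra_simps)
    moreover have "\<bar>7 * z powr (- 9/8) + 9 * (c * t * z powr (- 17/8))\<bar> \<le> 16"
      using z2 z3 by linarith
    ultimately show ?thesis
      using mult_left_mono[of "\<bar>7 * z powr (- 9/8) + 9 * (c * t * z powr (- 17/8))\<bar>" 16 "1/64 * t powr (- 15/8)"]
      by (simp add: abs_mult)
  qed
  ultimately show ?thesis by blast
qed

text \<open>The range \<open>t / 3 \<le> s\<close> covers \<open>s = |n \<plusminus> e\<^sub>i|\<^sup>2 + 1\<close> for \<open>t = |n|\<^sup>2 + 1\<close>, uniformly in \<open>n\<close>.\<close>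

lemma ramp_Taylor:
  assumes c: "0 \<le> c" and t: "1 \<le> t" and s: "t / 3 \<le> s"
  shows "\<bar>ramp c s - ramp c t - ramp_deriv c t * (s - t)\<bar> \<le> 9/4 * t powr (- 15/8) * (s - t)\<^sup>2"
proof -
  obtain D where D: "\<And>x. 0 < x \<Longrightarrow> (ramp_deriv c has_real_derivative D x) (at x)"
    "\<And>x. 0 < x \<Longrightarrow> \<bar>D x\<bar> \<le> 1/4 * x powr (- 15/8)"
    using ramp_deriv_has_derivative[OF c] by metis
  define f where "f i = (if i = 0 then ramp c else if i = 1 then ramp_deriv c else D)" for i :: nat
  define B where "B = 9/4 * t powr (- 15/8)"
  have Bd: "\<bar>D x\<bar> \<le> B" if "t / 3 \<le> x" for x
  proof -
    have "(3::real) powr (15/8) \<le> 9"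
      using powr_mono[of "15/8" 2 "3::real"] by simp
    have "\<bar>D x\<bar> \<le> 1/4 * x powr (- 15/8)" using D(2) t that by simp
    also have "\<dots> \<le> 1/4 * (t/3) powr (- 15/8)"
      using t that powr_mono2'[of "- 15/8" "t/3" x] by simp
    also have "(t/3) powr (- 15/8) = t powr (- 15/8) * 3 powr (15/8)"
      using t by (simp add: powr_divide powr_minus field_simps)
    also have "1/4 * (t powr (- 15/8) * 3 powr (15/8)) \<le> B"
      unfolding B_def using \<open>(3::real) powr (15/8) \<le> 9\<close> mult_left_mono[of "3 powr (15/8)" 9 "t powr (- 15/8)"] by simp
    finally show ?thesis .
  qed
  have "norm (f 0 s - (\<Sum>i\<le>1. f i t * (s - t) ^ i / fact i)) \<le> B * norm (s - t) ^ Suc 1 / fact 1"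
  proof (rule field_Taylor[of "{t/3..}"])
    show "(f i has_field_derivative f (Suc i) x) (at x within {t/3..})" if "x \<in> {t/3..}" "i \<le> 1" for i x
    proof -
      have "0 < x" using that t by simp
      then have "(f i has_field_derivative f (Suc i) x) (at x)"
        using that D(1)[of x] ramp_has_derivative[OF c, of x] by (cases i) (auto simp: f_def)
      then show ?thesis by (rule has_field_derivative_at_within)
    qed
    show "norm (f (Suc 1) x) \<le> B" if "x \<in> {t/3..}" for x
      using Bd[of x] that by (simp add: f_def)
  qed (use s t in auto)
  then have "norm (ramp c s - (ramp c t + ramp_deriv c t * (s - t))) \<le> B * (norm (s - t))\<^sup>2"
    by (simp add: f_def numeral_2_eq_2)
  then show ?thesis by (simp add: B_def diff_diff_eq)
qed

lemma ramp_deriv_bounds: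
  assumes "0 \<le> c" "1 \<le> t"
  shows "0 \<le> ramp_deriv c t" "ramp_deriv c t \<le> 1/8 * t powr (- 7/8)"
proof -
  have "(1 + c * t) powr (- 9/8) \<le> 1"
    using assms by (intro powr_nonpos_le_1) auto
  then show "0 \<le> ramp_deriv c t" "ramp_deriv c t \<le> 1/8 * t powr (- 7/8)"
    using mult_left_mono[of "(1 + c * t) powr (- 9/8)" 1 "1/8 * t powr (- 7/8)"] by (simp_all add: ramp_deriv_def)
qed

text \<open>A crude constant for the next lemma, where \<open>A\<close> denotes the difference of \<open>ramp\<close> across a step:
  \<open>21\<close> comes from the linearization of \<open>A\<close>, \<open>22\<^sup>2 exp 22\<close> from
  \<open>|exp A - 1 - A| \<le> A\<^sup>2 exp |A|\<close> with \<open>|A| \<le> 22\<close>, and the factor \<open>2\<close> from the weight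
  \<open>1 + |n| \<le> 2 \<langle>n\<rangle>\<close>.\<close>

definition step_const :: real where
  "step_const = 2 * (21 + 484 * exp 22)"

text \<open>With \<open>x = \<plusminus> n\<^sub>i\<close> and \<open>t = \<langle>n\<rangle>\<^sup>2\<close> the two bounds are the ones required of admissible weights.
  In powers of \<open>z = t\<^sup>-\<^sup>1\<^sup>/\<^sup>8\<close> the derivative is \<open>O(z\<^sup>7)\<close>, the gradient term \<open>O(z\<^sup>3)\<close>,
  its square \<open>O(z\<^sup>6)\<close>, and the factor \<open>|n| \<le> z\<^sup>-\<^sup>4\<close> leaves \<open>O(z\<^sup>2)\<close>.\<close>

lemma ramp_step:
  fixes c t x :: real
  assumes c: "0 \<le> c" and t: "1 \<le> t" and x: "x\<^sup>2 \<le> t - 1"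
  shows "2 * ramp_deriv c t * \<bar>x\<bar> \<le> step_const * t powr (- 1/4)"
    and "(1 + sqrt (t - 1)) * \<bar>exp (ramp c t - ramp c (t + 2 * x + 1)) - 1 + 2 * ramp_deriv c t * x\<bar>
      \<le> step_const * t powr (- 1/4)"
proof -
  define z where "z = t powr (- 1/8)"
  have z: "0 < z" "z \<le> 1" using t powr_nonpos_le_1[of t "- 1/8"] by (simp_all add: z_def)
  have zp: "z ^ k = t powr (- real k / 8)" for k
    using t by (simp add: z_def powr_power)
  have z7: "t powr (- 7/8) = z ^ 7" and z15: "t powr (- 15/8) = z ^ 15" and z2: "t powr (- 1/4) = z ^ 2"
    using zp[of 7] zp[of 15] zp[of 2] by simp_all
  have "z ^ 8 = 1 / t" using zp[of 8] t by (simp add: powr_minus_divide)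
  then have tz: "t = 1 / z ^ 8" using z by (simp add: field_simps)
  define y where "y = 1 / z ^ 4"
  have y: "1 \<le> y" "y\<^sup>2 = t"
  proof -
    show "1 \<le> y" using z power_le_one[of z 4] by (simp add: y_def)
    have "(z ^ 4)\<^sup>2 = z ^ 8" by (simp flip: power_mult)
    then show "y\<^sup>2 = t" by (simp add: y_def tz power_divide)
  qed
  have "x\<^sup>2 \<le> y\<^sup>2" unfolding y(2) using x by linarith
  then have xy: "\<bar>x\<bar> \<le> y" using y(1) abs_le_square_iff[of x y] by linarith
  have "sqrt (t - 1) \<le> sqrt (y\<^sup>2)" unfolding y(2) by simp
  then have sq: "sqrt (t - 1) \<le> y" using y(1) by simp
  have d: "0 \<le> ramp_deriv c t" "ramp_deriv c t \<le> 1/8 * z ^ 7"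
    using ramp_deriv_bounds[OF c t] unfolding z7 by simp_all
  have y_z: "y * z ^ 7 = z ^ 3" "y * z ^ 6 = z ^ 2"
    using z by (simp_all add: y_def field_simps flip: power_add)
  have small: "2 * ramp_deriv c t * \<bar>x\<bar> \<le> 1/4 * z ^ 3"
  proof -
    have "ramp_deriv c t * \<bar>x\<bar> \<le> 1/8 * z ^ 7 * y" using d xy z by (intro mult_mono) auto
    also have "\<dots> = 1/8 * z ^ 3" using y_z by (simp add: mult.commute)
    finally show ?thesis by simp
  qed
  have mono: "z ^ k \<le> z ^ j" if "j \<le> k" for j k using z that by (intro power_decreasing) auto
  have "1 \<le> 2 * (21 + 484 * y)" if "0 \<le> y" for y :: real using that by simp
  from this[OF exp_ge_zero] have sc: "1 \<le> step_const" unfolding step_const_def .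
  show "2 * ramp_deriv c t * \<bar>x\<bar> \<le> step_const * t powr (- 1/4)"
  proof -
    have "1/4 * z ^ 3 \<le> 1 * z ^ 2" using mono[of 2 3] zero_less_power[OF z(1), of 2] by linarith
    also have "\<dots> \<le> step_const * z ^ 2" using sc z by (intro mult_right_mono) auto
    finally show ?thesis using small unfolding z2 by simp
  qed
  define A where "A = ramp c t - ramp c (t + 2 * x + 1)"
  have A1: "\<bar>A + 2 * ramp_deriv c t * x\<bar> \<le> 21 * z ^ 7"
  proof -
    \<comment> \<open>\<open>3 (t + 2 x + 1) - t \<ge> 2 (x + 3/2)\<^sup>2 + 1/2\<close> because \<open>t \<ge> x\<^sup>2 + 1\<close>\<close>
    have "0 \<le> 2 * (x + 3/2)\<^sup>2" by simp
    then have "t / 3 \<le> t + 2 * x + 1" using x by (simp add: power2_eq_square algebra_simps)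
    from ramp_Taylor[OF c t this]
    have T: "\<bar>- A - ramp_deriv c t * (2 * x + 1)\<bar> \<le> 9/4 * z ^ 15 * (2 * x + 1)\<^sup>2"
      unfolding z15 by (simp add: A_def algebra_simps)
    have "(2 * x + 1)\<^sup>2 \<le> (3 * y)\<^sup>2"
      using xy y by (intro abs_le_square_iff[THEN iffD1]) auto
    then have "9/4 * z ^ 15 * (2 * x + 1)\<^sup>2 \<le> 9/4 * z ^ 15 * (3 * y)\<^sup>2"
      using z by (intro mult_left_mono) auto
    also have "\<dots> = 81/4 * z ^ 7"
      using z by (simp add: y_def field_simps flip: power_add power_mult)
    finally have "9/4 * z ^ 15 * (2 * x + 1)\<^sup>2 \<le> 81/4 * z ^ 7" .
    moreover have "A + 2 * ramp_deriv c t * x = - (- A - ramp_deriv c t * (2 * x + 1)) - ramp_deriv c t"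
      by (simp add: algebra_simps)
    moreover have "0 \<le> z ^ 7" using z by simp
    ultimately show ?thesis using T d by linarith
  qed
  have A2: "\<bar>A\<bar> \<le> 22 * z ^ 3"
  proof -
    have "\<bar>2 * ramp_deriv c t * x\<bar> \<le> 1/4 * z ^ 3" using small d by (simp add: abs_mult)
    moreover have "\<bar>A\<bar> \<le> \<bar>A + 2 * ramp_deriv c t * x\<bar> + \<bar>2 * ramp_deriv c t * x\<bar>"
      using abs_triangle_ineq4[of "A + 2 * ramp_deriv c t * x" "2 * ramp_deriv c t * x"] by simp
    moreover have "z ^ 7 \<le> z ^ 3" "0 < z ^ 3" using mono[of 3 7] z by simp_all
    ultimately show ?thesis using A1 by linarith
  qed
  have A3: "\<bar>exp A - 1 - A\<bar> \<le> exp 22 * (484 * z ^ 6)"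
  proof -
    have "norm (exp A - (\<Sum>k\<le>1. A ^ k / fact k)) \<le> exp (norm A) * (norm A ^ Suc 1) / fact 1"
      by (rule Taylor_exp_field)
    then have "\<bar>exp A - 1 - A\<bar> \<le> exp \<bar>A\<bar> * \<bar>A\<bar>\<^sup>2" by (simp add: algebra_simps power2_eq_square)
    also have "\<dots> \<le> exp 22 * (22 * z ^ 3)\<^sup>2"
    proof (intro mult_mono power_mono)
      show "exp \<bar>A\<bar> \<le> exp 22" using A2 mono[of 0 3] by simp
    qed (use A2 in auto)
    also have "(22 * z ^ 3)\<^sup>2 = 484 * z ^ 6" by (simp add: power_mult_distrib flip: power_mult)
    finally show ?thesis .
  qed
  have "\<bar>exp A - 1 + 2 * ramp_deriv c t * x\<bar> \<le> (21 + 484 * exp 22) * z ^ 6"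
    using A1 A3 mono[of 6 7] by (simp add: algebra_simps)
  then have "(1 + sqrt (t - 1)) * \<bar>exp A - 1 + 2 * ramp_deriv c t * x\<bar>
      \<le> (2 * y) * ((21 + 484 * exp 22) * z ^ 6)"
    using sq y t by (intro mult_mono) auto
  also have "\<dots> = step_const * (y * z ^ 6)" by (simp add: step_const_def)
  finally show "(1 + sqrt (t - 1)) * \<bar>exp (ramp c t - ramp c (t + 2 * x + 1)) - 1 + 2 * ramp_deriv c t * x\<bar>
      \<le> step_const * t powr (- 1/4)"
    unfolding y_z z2 A_def .
qed

text \<open>Conjugating the hopping operators with \<open>e\<^sup>F\<close> multiplies the two shifts in direction \<open>i\<close> by
  \<open>exp (F(n) - F(n \<mp> e\<^sub>i))\<close>. These factors have to agree with \<open>1 \<plusminus> g n\<^sub>i\<close>, that is, \<open>F\<close> has to be radially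
  increasing with gradient \<open>g n\<close>, up to errors that stay small when multiplied by \<open>|n|\<close>.\<close>

definition admissible_weight :: "(int ^ 'd \<Rightarrow> real) \<Rightarrow> (int ^ 'd \<Rightarrow> real) \<Rightarrow> (int ^ 'd \<Rightarrow> real) \<Rightarrow> bool" where
  "admissible_weight \<eta> F g \<longleftrightarrow> (\<forall>n. 0 \<le> g n) \<and> (\<forall>n i. g n * \<bar>real_of_int (n $ i)\<bar> \<le> \<eta> n) \<and>
    (\<forall>n i. (1 + lnorm n) * \<bar>exp (F n - F (n - axis i 1)) - 1 - g n * real_of_int (n $ i)\<bar> \<le> \<eta> n) \<and>
    (\<forall>n i. (1 + lnorm n) * \<bar>exp (F n - F (n + axis i 1)) - 1 + g n * real_of_int (n $ i)\<bar> \<le> \<eta> n)"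

definition ramp_weight :: "real \<Rightarrow> int ^ 'd \<Rightarrow> real" where
  "ramp_weight c n = ramp c (1 + (lnorm n)\<^sup>2)"

definition ramp_bound :: "int ^ 'd \<Rightarrow> real" where
  "ramp_bound n = step_const * (1 + (lnorm n)\<^sup>2) powr (- 1/4)"

lemma lnorm_sq_step:
  "(lnorm (n + axis i 1))\<^sup>2 = (lnorm n)\<^sup>2 + 2 * real_of_int (n $ i) + 1"
  "(lnorm (n - axis i 1))\<^sup>2 = (lnorm n)\<^sup>2 - 2 * real_of_int (n $ i) + 1"
proof -
  have sq: "(lnorm n)\<^sup>2 = (\<Sum>j\<in>UNIV. (real_of_int (n $ j))\<^sup>2)" for n :: "int ^ 'a"
    unfolding lnorm_def by (simp add: sum_nonneg)
  have "(real_of_int ((n + axis i 1) $ j))\<^sup>2 = (real_of_int (n $ j))\<^sup>2 + (if j = i then 2 * real_of_int (n $ i) + 1 else 0)"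
    "(real_of_int ((n - axis i 1) $ j))\<^sup>2 = (real_of_int (n $ j))\<^sup>2 + (if j = i then - 2 * real_of_int (n $ i) + 1 else 0)" for j
    by (auto simp: axis_def power2_eq_square algebra_simps)
  then show "(lnorm (n + axis i 1))\<^sup>2 = (lnorm n)\<^sup>2 + 2 * real_of_int (n $ i) + 1"
    "(lnorm (n - axis i 1))\<^sup>2 = (lnorm n)\<^sup>2 - 2 * real_of_int (n $ i) + 1"
    unfolding sq by (simp_all add: sum.distrib del: vector_add_component vector_minus_component)
qed

lemma ramp_weight_admissible:
  assumes "0 \<le> c"
  shows "admissible_weight ramp_bound (ramp_weight c) (\<lambda>n. 2 * ramp_deriv c (1 + (lnorm n)\<^sup>2))"
  unfolding admissible_weight_def
proof (intro conjI allI)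
  fix n :: "int ^ 'a" and i
  let ?t = "1 + (lnorm n)\<^sup>2" and ?x = "real_of_int (n $ i)"
  have t: "1 \<le> ?t" by simp
  have "?x\<^sup>2 \<le> (lnorm n)\<^sup>2"
    using coord_le_lnorm[of n i] lnorm_nonneg[of n] by (simp add: abs_le_square_iff[symmetric])
  then have x: "?x\<^sup>2 \<le> ?t - 1" "(- ?x)\<^sup>2 \<le> ?t - 1" by simp_all
  have s: "1 + sqrt (?t - 1) = 1 + lnorm n" using lnorm_nonneg[of n] by simp
  show "0 \<le> 2 * ramp_deriv c ?t" using ramp_deriv_bounds[OF assms t] by simp
  show "2 * ramp_deriv c ?t * \<bar>?x\<bar> \<le> ramp_bound n"
    unfolding ramp_bound_def by (rule ramp_step(1)[OF assms t x(1)])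
  show "(1 + lnorm n) * \<bar>exp (ramp_weight c n - ramp_weight c (n + axis i 1)) - 1 + 2 * ramp_deriv c ?t * ?x\<bar> \<le> ramp_bound n"
    using ramp_step(2)[OF assms t x(1)] unfolding s ramp_weight_def ramp_bound_def lnorm_sq_step
    by (simp add: algebra_simps)
  show "(1 + lnorm n) * \<bar>exp (ramp_weight c n - ramp_weight c (n - axis i 1)) - 1 - 2 * ramp_deriv c ?t * ?x\<bar> \<le> ramp_bound n"
    using ramp_step(2)[OF assms t x(2)] unfolding s ramp_weight_def ramp_bound_def lnorm_sq_step
    by (simp add: algebra_simps)
qed

lemma ramp_bound_tendsto_0: "(ramp_bound \<longlongrightarrow> 0) (cofinite :: (int ^ 'd) filter)"
proof -
  have "filterlim (\<lambda>n :: int ^ 'd. 1 + (lnorm n)\<^sup>2) at_top cofinite"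
    by (intro filterlim_tendsto_add_at_top[OF tendsto_const] filterlim_pow_at_top filterlim_lnorm_cofinite) simp
  then have "((\<lambda>n :: int ^ 'd. (1 + (lnorm n)\<^sup>2) powr (- 1/4)) \<longlongrightarrow> 0) cofinite"
    by (intro tendsto_neg_powr) auto
  then show ?thesis unfolding ramp_bound_def[abs_def] by (rule tendsto_mult_right_zero)
qed

lemma ramp_bounded:
  assumes "0 < c" "1 \<le> t"
  shows "ramp c t \<le> (1 / c) powr (1/8)"
proof -
  have "ramp c t = (t / (1 + c * t)) powr (1/8)"
    using assms by (simp add: ramp_def powr_divide powr_minus_divide add_nonneg_nonneg)
  also have "\<dots> \<le> (1 / c) powr (1/8)"
    using assms by (intro powr_mono2) (auto simp: field_simps add_pos_pos)
  finally show ?thesis .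
qed

lemma ramp_weight_bounded: "0 < c \<Longrightarrow> ramp_weight c n \<le> (1 / c) powr (1/8)"
  unfolding ramp_weight_def by (rule ramp_bounded) auto

lemma ramp_le:
  assumes "0 \<le> c" "1 \<le> t"
  shows "ramp c t \<le> ramp 0 t"
  using assms powr_nonpos_le_1[of "1 + c * t" "- 1/8"] mult_left_mono[of "(1 + c * t) powr (-1/8)" 1 "t powr (1/8)"]
  by (simp add: ramp_def)

lemma ramp_weight_le: "0 \<le> c \<Longrightarrow> ramp_weight c n \<le> ramp_weight 0 n"
  unfolding ramp_weight_def by (rule ramp_le) auto

lemma ramp_weight_tendsto: "(\<lambda>k. ramp_weight (1 / real (Suc k)) n) \<longlonglongrightarrow> ramp_weight 0 n"
proof -
  let ?t = "1 + (lnorm n)\<^sup>2"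
  have "(\<lambda>k. 1 / real (Suc k)) \<longlonglongrightarrow> 0"
    by (rule LIMSEQ_Suc[OF lim_1_over_n])
  then have L: "(\<lambda>k. (1 + 1 / real (Suc k) * ?t)) \<longlonglongrightarrow> 1 + 0 * ?t"
    by (intro tendsto_add tendsto_mult tendsto_const)
  have "(\<lambda>k. ?t powr (1/8) * (1 + 1 / real (Suc k) * ?t) powr (- 1/8)) \<longlonglongrightarrow> ?t powr (1/8) * (1 + 0 * ?t) powr (- 1/8)"
    by (intro tendsto_mult tendsto_const tendsto_powr[OF L]) simp
  then show ?thesis by (simp add: ramp_weight_def ramp_def)
qed

section \<open>Truncated eigenfunctions\<close>

text \<open>The operator has real coefficients, so real and imaginary parts of eigenfunctions are again
  eigenfunctions. The equation is solved for the hopping terms: \<open>2 d\<close> is the diagonal of the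
  Laplacian.\<close>

definition real_eigenfunction :: "real \<Rightarrow> (int ^ 'd \<Rightarrow> real) \<Rightarrow> real \<Rightarrow> (int ^ 'd \<Rightarrow> real) \<Rightarrow> bool" where
  "real_eigenfunction w V x \<psi> \<longleftrightarrow> (\<lambda>n. (\<psi> n)\<^sup>2) summable_on UNIV \<and>
     (\<forall>n. (2 * real CARD('d) - x + V n + w2 w n) * \<psi> n = hop_total \<psi> n)"

lemma lattice_ball_sums:
  fixes f :: "int ^ 'd \<Rightarrow> real"
  assumes "f summable_on UNIV"
  shows "(\<lambda>k. \<Sum>n\<in>{n. lnorm n \<le> real k}. f n) \<longlonglongrightarrow> (\<Sum>\<^sub>\<infinity>n. f n)"
proof -
  have "(sum f \<longlongrightarrow> (\<Sum>\<^sub>\<infinity>n. f n)) (finite_subsets_at_top UNIV)"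
    using assms has_sum_infsum has_sum_def by blast
  moreover have "filterlim (\<lambda>k. {n :: int ^ 'd. lnorm n \<le> real k}) (finite_subsets_at_top UNIV) sequentially"
    unfolding filterlim_iff eventually_finite_subsets_at_top
  proof (intro allI impI)
    fix P :: "(int ^ 'd) set \<Rightarrow> bool"
    assume "\<exists>X. finite X \<and> X \<subseteq> UNIV \<and> (\<forall>Y. finite Y \<and> X \<subseteq> Y \<and> Y \<subseteq> UNIV \<longrightarrow> P Y)"
    then obtain X where X: "finite X" "\<And>Y. finite Y \<Longrightarrow> X \<subseteq> Y \<Longrightarrow> P Y" by auto
    obtain N :: nat where N: "\<And>n. n \<in> X \<Longrightarrow> lnorm n \<le> real N"
    proof -
      obtain b where "\<And>n. n \<in> X \<Longrightarrow> lnorm n \<le> b"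
        using finite_imageI[OF X(1), of lnorm] bdd_above_finite[of "lnorm ` X"] by (auto simp: bdd_above_def)
      moreover obtain N where "b \<le> real N" using real_arch_simple by blast
      ultimately show ?thesis using that[of N] by (meson order_trans)
    qed
    have "P {n. lnorm n \<le> real k}" if "N \<le> k" for k
    proof (rule X(2)[OF finite_lattice_ball], rule subsetI)
      fix n assume "n \<in> X"
      from order_trans[OF N[OF this], of "real k"] that show "n \<in> {n. lnorm n \<le> real k}" by simp
    qed
    then show "\<forall>\<^sub>F k in sequentially. P {n. lnorm n \<le> real k}"
      by (auto simp: eventually_sequentially)
  qed
  ultimately show ?thesis by (rule filterlim_compose)
qed

definition cutoff :: "real \<Rightarrow> int ^ 'd \<Rightarrow> real" where
  "cutoff R n = max 0 (min 1 (2 - lnorm n / R))"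

lemma cutoff_bounds: "0 \<le> cutoff R n" "cutoff R n \<le> 1"
  by (simp_all add: cutoff_def)

lemma cutoff_eq_1: "0 < R \<Longrightarrow> lnorm n \<le> R \<Longrightarrow> cutoff R n = 1"
  by (simp add: cutoff_def field_simps)

lemma cutoff_eq_0: "0 < R \<Longrightarrow> 2 * R \<le> lnorm n \<Longrightarrow> cutoff R n = 0"
  by (simp add: cutoff_def field_simps)

text \<open>The cutoff at scale \<open>R\<close> has slope \<open>1 / R\<close> and varies only where \<open>lnorm n\<close> is comparable
  to \<open>R\<close>; hence the weight \<open>1 + lnorm n\<close> costs no more than a constant.\<close>

lemma cutoff_slope:
  assumes R: "1 \<le> R" and m: "\<bar>lnorm n - lnorm m\<bar> \<le> 1"
  shows "(1 + lnorm n) * \<bar>cutoff R n - cutoff R m\<bar> \<le> 4 * (if R - 1 \<le> lnorm m \<and> lnorm m \<le> 2 * R + 1 then 1 else 0)"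
proof (cases "R - 1 \<le> lnorm m \<and> lnorm m \<le> 2 * R + 1")
  case True
  show ?thesis
  proof (cases "lnorm n \<le> 2 * R + 1")
    case n: True
    have "\<bar>cutoff R n - cutoff R m\<bar> \<le> \<bar>lnorm n / R - lnorm m / R\<bar>"
      unfolding cutoff_def by (simp add: max_def min_def abs_if)
    also have "\<dots> = \<bar>lnorm n - lnorm m\<bar> / R" using R by (simp add: diff_divide_distrib[symmetric])
    also have "\<dots> \<le> 1 / R" using m R by (intro divide_right_mono) auto
    finally have "(1 + lnorm n) * \<bar>cutoff R n - cutoff R m\<bar> \<le> (2 * R + 2) * (1 / R)"
      using n R lnorm_nonneg[of n] by (intro mult_mono) auto
    also have "\<dots> \<le> 4" using R by (simp add: field_simps)
    finally show ?thesis using True by simp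
  next
    case False
    then show ?thesis using m R True by (simp add: cutoff_eq_0)
  qed
next
  case False
  then have "cutoff R n = cutoff R m"
    using m R by (cases "lnorm m < R - 1") (simp_all add: cutoff_eq_0 cutoff_eq_1)
  then show ?thesis by simp
qed

text \<open>The function \<open>u\<close> is the normalized \<open>e\<^sup>F \<psi>\<close> times a cutoff at a large radius \<open>R\<close>. The first part of the
  defect in the equation measures how far \<open>F\<close> is from an exact radial gradient; the second,
  \<open>\<sigma>\<close>, comes from the slope of the cutoff and is bounded by the mass beyond \<open>R\<close>.\<close>

lemma truncated_eigenfunction:
  fixes \<psi> F g :: "int ^ 'd \<Rightarrow> real"
  assumes eig: "real_eigenfunction w V x \<psi>"
    and F: "\<And>n. F n \<le> K" and adm: "admissible_weight \<eta> F g" and \<eta>: "(\<eta> \<longlongrightarrow> 0) cofinite"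
    and M: "M = (\<Sum>\<^sub>\<infinity>n. (exp (F n) * \<psi> n)\<^sup>2)" "0 < M" and "0 < \<delta>"
  obtains u \<sigma> where "fsupp u" "sq_sum u \<le> 1" "1/2 \<le> sq_sum u"
    "\<And>n. \<bar>u n\<bar> \<le> exp (F n) * \<bar>\<psi> n\<bar> / sqrt M"
    "fsupp \<sigma>" "sq_sum (\<lambda>n. (1 + lnorm n) * \<sigma> n) \<le> \<delta>"
    "\<And>n. (2 * real CARD('d) - x + V n + w2 w n) * u n - hop_total u n
          - g n * (\<Sum>i\<in>UNIV. real_of_int (n $ i) * hop_diff i u n)
        = (\<Sum>i\<in>UNIV. (exp (F n - F (n - axis i 1)) - 1 - g n * real_of_int (n $ i)) * shift i u n
            + (exp (F n - F (n + axis i 1)) - 1 + g n * real_of_int (n $ i)) * shift_adj i u n) + \<sigma> n"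
proof -
  define \<phi> where "\<phi> n = exp (F n) * \<psi> n / sqrt M" for n
  define a where "a i n = exp (F n - F (n - axis i 1))" for i n
  define b where "b i n = exp (F n - F (n + axis i 1))" for i n
  define pot where "pot n = 2 * real CARD('d) - x + V n + w2 w n" for n
  have summ: "(\<lambda>n. (exp (F n) * \<psi> n)\<^sup>2) summable_on UNIV"
  proof (rule summable_on_comparison_test)
    show "(\<lambda>n. (exp K)\<^sup>2 * (\<psi> n)\<^sup>2) summable_on UNIV"
      using eig by (intro summable_on_cmult_right) (simp add: real_eigenfunction_def)
    show "(exp (F n) * \<psi> n)\<^sup>2 \<le> (exp K)\<^sup>2 * (\<psi> n)\<^sup>2" for n
      unfolding power_mult_distrib using F[of n] by (intro mult_right_mono power_mono) auto
  qed simp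
  have \<phi>2: "(\<phi> n)\<^sup>2 = 1 / M * (exp (F n) * \<psi> n)\<^sup>2" for n
    using M(2) by (simp add: \<phi>_def power_divide)
  have \<phi>_summ: "(\<lambda>n. (\<phi> n)\<^sup>2) summable_on UNIV"
    unfolding \<phi>2 by (intro summable_on_cmult_right summ)
  have \<phi>_sum: "(\<Sum>\<^sub>\<infinity>n. (\<phi> n)\<^sup>2) = 1"
    unfolding \<phi>2 infsum_cmult_right' M(1)[symmetric] using M(2) by simp
  have \<phi>_eq: "pot n * \<phi> n = (\<Sum>i\<in>UNIV. a i n * \<phi> (n - axis i 1) + b i n * \<phi> (n + axis i 1))" for n
  proof -
    have "pot n * \<phi> n = exp (F n) / sqrt M * hop_total \<psi> n"
      using eig unfolding real_eigenfunction_def pot_def \<phi>_def by (metis times_divide_eq_left times_divide_eq_right mult.left_commute)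
    also have "\<dots> = (\<Sum>i\<in>UNIV. a i n * \<phi> (n - axis i 1) + b i n * \<phi> (n + axis i 1))"
      unfolding hop_total_def sum_distrib_left
      by (rule sum.cong) (simp_all add: a_def b_def \<phi>_def hop_sum_def shift_def shift_adj_def exp_diff field_simps add_divide_distrib)
    finally show ?thesis .
  qed
  have adm_n: "0 \<le> g n" "g n * \<bar>real_of_int (n $ i)\<bar> \<le> \<eta> n"
    "(1 + lnorm n) * \<bar>a i n - 1 - g n * real_of_int (n $ i)\<bar> \<le> \<eta> n"
    "(1 + lnorm n) * \<bar>b i n - 1 + g n * real_of_int (n $ i)\<bar> \<le> \<eta> n" for n i
    using adm unfolding admissible_weight_def a_def b_def by blast+
  obtain H where H: "\<And>n. \<eta> n \<le> H"
  proof -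
    have fin: "finite {n. \<not> \<eta> n < 1}"
      using order_tendstoD(2)[OF \<eta>, of 1] by (simp add: eventually_cofinite)
    have "\<eta> n \<le> Max (insert 1 (\<eta> ` {n. \<not> \<eta> n < 1}))" for n
    proof (cases "\<eta> n < 1")
      case True
      then show ?thesis using fin by (intro order_trans[OF less_imp_le Max_ge]) auto
    next
      case False
      then show ?thesis using fin by (intro Max_ge) auto
    qed
    then show ?thesis using that by blast
  qed
  define A where "A = 1 + 2 * H"
  have ab: "\<bar>a i n\<bar> \<le> A" "\<bar>b i n\<bar> \<le> A" for i n
  proof -
    have w: "\<bar>y\<bar> \<le> (1 + lnorm n) * \<bar>y\<bar>" for y
      using mult_right_mono[of 1 "1 + lnorm n" "\<bar>y\<bar>"] lnorm_nonneg[of n] by simp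
    have "\<bar>g n * real_of_int (n $ i)\<bar> \<le> H"
      using adm_n(1)[of n] adm_n(2)[of n i] H[of n] by (simp add: abs_mult)
    then show "\<bar>a i n\<bar> \<le> A" "\<bar>b i n\<bar> \<le> A"
      using adm_n(3,4)[of n i] H[of n] w[of "a i n - 1 - g n * real_of_int (n $ i)"]
        w[of "b i n - 1 + g n * real_of_int (n $ i)"] unfolding A_def by linarith+
  qed
  \<comment> \<open>Where the cutoff at \<open>R k\<close> differs between neighbours, both have norm at least \<open>R k - 1\<close>, hence lie
    outside the ball of radius \<open>k\<close>.\<close>
  define R where "R k = real k + 3" for k :: nat
  have R1: "1 \<le> R k" "0 < R k" for k by (simp_all add: R_def)
  define u where "u k n = cutoff (R k) n * \<phi> n" for k n
  define \<sigma> where "\<sigma> k n = (\<Sum>i\<in>UNIV. a i n * (cutoff (R k) n - cutoff (R k) (n - axis i 1)) * \<phi> (n - axis i 1)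
      + b i n * (cutoff (R k) n - cutoff (R k) (n + axis i 1)) * \<phi> (n + axis i 1))" for k n
  define tail where "tail k n = (if R k - 1 \<le> lnorm n \<and> lnorm n \<le> 2 * R k + 1 then 1 else 0) * \<phi> n" for k n
  have fs: "fsupp (u k)" "fsupp (tail k)" for k
  proof -
    have "lnorm n \<le> 2 * R k + 1" if "u k n \<noteq> 0" for n
      using that cutoff_eq_0[OF R1(2)[of k], of n] by (cases "lnorm n \<le> 2 * R k + 1") (auto simp: u_def)
    moreover have "lnorm n \<le> 2 * R k + 1" if "tail k n \<noteq> 0" for n
      using that by (auto simp: tail_def split: if_splits)
    ultimately show "fsupp (u k)" "fsupp (tail k)"
      unfolding fsupp_def by (auto intro: finite_subset[OF _ finite_lattice_ball[of "2 * R k + 1"]])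
  qed
  define S where "S k = (\<Sum>n\<in>{n. lnorm n \<le> real k}. (\<phi> n)\<^sup>2)" for k
  have S: "S \<longlonglongrightarrow> 1"
    unfolding S_def[abs_def] using lattice_ball_sums[OF \<phi>_summ] by (simp add: \<phi>_sum)
  have tail_le: "sq_sum (tail k) \<le> 1 - S k" for k
  proof -
    let ?X = "{n. tail k n \<noteq> 0}" and ?Y = "{n :: int ^ 'd. lnorm n \<le> real k}"
    have X: "finite ?X" using fs(2) by (simp add: fsupp_def)
    have "sq_sum (tail k) = (\<Sum>n\<in>?X. (\<phi> n)\<^sup>2)"
      by (subst ip_eq_sum[OF X]) (auto simp: tail_def power2_eq_square intro!: sum.cong)
    moreover have "(\<Sum>n\<in>?X. (\<phi> n)\<^sup>2) + S k = (\<Sum>n\<in>?X \<union> ?Y. (\<phi> n)\<^sup>2)"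
      unfolding S_def using X finite_lattice_ball
      by (subst sum.union_disjoint) (auto simp: tail_def R_def)
    moreover have "(\<Sum>n\<in>?X \<union> ?Y. (\<phi> n)\<^sup>2) \<le> 1"
      unfolding \<phi>_sum[symmetric] using X finite_lattice_ball by (intro finite_sum_le_infsum \<phi>_summ) auto
    ultimately show ?thesis by linarith
  qed
  have "(\<lambda>k. 1 - S k) \<longlonglongrightarrow> 1 - 1" by (intro tendsto_intros S)
  then have "(\<lambda>k. sq_sum (tail k)) \<longlonglongrightarrow> 0"
    by (intro tendsto_0_squeeze[OF sq_sum_nonneg tail_le]) simp
  then have tail_null: "l2_null tail" using fs by (simp add: l2_null_def)
  have u_le: "sq_sum (u k) \<le> 1" and u_ge: "S k \<le> sq_sum (u k)" for k
  proof -
    let ?X = "{n. u k n \<noteq> 0}" and ?Y = "{n :: int ^ 'd. lnorm n \<le> real k}"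
    have X: "finite ?X" using fs(1) by (simp add: fsupp_def)
    have eq: "sq_sum (u k) = (\<Sum>n\<in>?X \<union> ?Y. (u k n)\<^sup>2)"
      by (subst ip_eq_sum[where A = "?X \<union> ?Y"]) (use X finite_lattice_ball in \<open>auto simp: power2_eq_square\<close>)
    have "\<bar>u k n\<bar> \<le> \<bar>\<phi> n\<bar>" for n
      using cutoff_bounds[of "R k" n] mult_right_mono[of "cutoff (R k) n" 1 "\<bar>\<phi> n\<bar>"] by (simp add: u_def abs_mult)
    then have "(\<Sum>n\<in>?X \<union> ?Y. (u k n)\<^sup>2) \<le> (\<Sum>n\<in>?X \<union> ?Y. (\<phi> n)\<^sup>2)"
      by (intro sum_mono) (simp add: abs_le_square_iff)
    also have "\<dots> \<le> 1"
      unfolding \<phi>_sum[symmetric] using X finite_lattice_ball by (intro finite_sum_le_infsum \<phi>_summ) auto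
    finally show "sq_sum (u k) \<le> 1" unfolding eq .
    have "S k = (\<Sum>n\<in>?Y. (u k n)\<^sup>2)"
      unfolding S_def by (rule sum.cong) (auto simp: u_def R_def cutoff_eq_1)
    also have "\<dots> \<le> (\<Sum>n\<in>?X \<union> ?Y. (u k n)\<^sup>2)"
      using X finite_lattice_ball by (intro sum_mono2) auto
    finally show "S k \<le> sq_sum (u k)" unfolding eq .
  qed
  have \<sigma>_bound: "\<bar>(1 + lnorm n) * \<sigma> k n\<bar>
      \<le> 4 * A * \<bar>\<Sum>i\<in>UNIV. \<bar>shift i (tail k) n\<bar> + \<bar>shift_adj i (tail k) n\<bar>\<bar>" for k n
  proof -
    have A: "0 \<le> A" using ab(1)[of undefined n] by linarith
    have term_le: "(1 + lnorm n) * \<bar>c * (cutoff (R k) n - cutoff (R k) m) * \<phi> m\<bar> \<le> 4 * A * \<bar>tail k m\<bar>"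
      if "\<bar>lnorm n - lnorm m\<bar> \<le> 1" "\<bar>c\<bar> \<le> A" for m c
    proof -
      let ?i = "if R k - 1 \<le> lnorm m \<and> lnorm m \<le> 2 * R k + 1 then 1 else 0 :: real"
      have "((1 + lnorm n) * \<bar>cutoff (R k) n - cutoff (R k) m\<bar>) * \<bar>c\<bar> \<le> (4 * ?i) * A"
        using that A by (intro mult_mono cutoff_slope R1) auto
      then have "((1 + lnorm n) * \<bar>cutoff (R k) n - cutoff (R k) m\<bar>) * \<bar>c\<bar> * \<bar>\<phi> m\<bar> \<le> (4 * ?i) * A * \<bar>\<phi> m\<bar>"
        by (rule mult_right_mono) simp
      then show ?thesis by (simp only: abs_mult tail_def mult_ac) (simp add: mult_ac)
    qed
    have "\<bar>(1 + lnorm n) * \<sigma> k n\<bar> = (1 + lnorm n) * \<bar>\<sigma> k n\<bar>"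
      using lnorm_nonneg[of n] by (simp add: abs_mult)
    also have "\<dots> \<le> (1 + lnorm n) * (\<Sum>i\<in>UNIV. \<bar>a i n * (cutoff (R k) n - cutoff (R k) (n - axis i 1)) * \<phi> (n - axis i 1)\<bar>
      + \<bar>b i n * (cutoff (R k) n - cutoff (R k) (n + axis i 1)) * \<phi> (n + axis i 1)\<bar>)"
      unfolding \<sigma>_def using lnorm_nonneg[of n]
      by (intro mult_left_mono order_trans[OF sum_abs] sum_mono abs_triangle_ineq) auto
    also have "\<dots> \<le> (\<Sum>i\<in>UNIV. 4 * A * \<bar>tail k (n - axis i 1)\<bar> + 4 * A * \<bar>tail k (n + axis i 1)\<bar>)"
      unfolding sum_distrib_left distrib_left
      using lnorm_step[of n] ab by (intro sum_mono add_mono term_le) (simp_all add: abs_minus_commute)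
    also have "\<dots> = 4 * A * (\<Sum>i\<in>UNIV. \<bar>shift i (tail k) n\<bar> + \<bar>shift_adj i (tail k) n\<bar>)"
      by (simp add: shift_def shift_adj_def sum_distrib_left distrib_left)
    also have "\<dots> = 4 * A * \<bar>\<Sum>i\<in>UNIV. \<bar>shift i (tail k) n\<bar> + \<bar>shift_adj i (tail k) n\<bar>\<bar>"
      by (subst abs_of_nonneg) (auto intro: sum_nonneg)
    finally show ?thesis .
  qed
  have "l2_null (\<lambda>k n. \<Sum>i\<in>UNIV. \<bar>shift i (tail k) n\<bar> + \<bar>shift_adj i (tail k) n\<bar>)"
  proof (intro l2_null_sum l2_null_add)
    show "l2_null (\<lambda>k n. \<bar>shift i (tail k) n\<bar>)" "l2_null (\<lambda>k n. \<bar>shift_adj i (tail k) n\<bar>)" for i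
      by (rule l2_null_dom[OF l2_null_shift(1)[OF tail_null], of _ 1 i], simp)
         (rule l2_null_dom[OF l2_null_shift(2)[OF tail_null], of _ 1 i], simp)
  qed
  then have \<sigma>_null: "l2_null (\<lambda>k n. (1 + lnorm n) * \<sigma> k n)"
    by (rule l2_null_dom[OF _ \<sigma>_bound])
  have "\<forall>\<^sub>F k in sequentially. 1/2 < S k"
    by (rule order_tendstoD(1)[OF S]) simp
  moreover have "\<forall>\<^sub>F k in sequentially. sq_sum (\<lambda>n. (1 + lnorm n) * \<sigma> k n) < \<delta>"
    using \<sigma>_null \<open>0 < \<delta>\<close> by (intro order_tendstoD(2)) (auto simp: l2_null_def)
  ultimately have "\<forall>\<^sub>F k in sequentially. 1/2 < S k \<and> sq_sum (\<lambda>n. (1 + lnorm n) * \<sigma> k n) < \<delta>"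
    by (rule eventually_conj)
  then obtain k where k: "1/2 < S k" "sq_sum (\<lambda>n. (1 + lnorm n) * \<sigma> k n) < \<delta>"
    by (auto simp: eventually_sequentially)
  show ?thesis
  proof (rule that[of "u k" "\<sigma> k"])
    show "fsupp (u k)" "sq_sum (u k) \<le> 1" "1/2 \<le> sq_sum (u k)"
      using fs u_le u_ge[of k] k by auto
    show "\<bar>u k n\<bar> \<le> exp (F n) * \<bar>\<psi> n\<bar> / sqrt M" for n
      using cutoff_bounds[of "R k" n] mult_right_mono[of "cutoff (R k) n" 1 "\<bar>\<phi> n\<bar>"] M(2)
      by (simp add: u_def \<phi>_def abs_mult)
    show "fsupp (\<sigma> k)"
    proof (rule fsupp_mono)
      show "fsupp (\<lambda>n. (1 + lnorm n) * \<sigma> k n)" using \<sigma>_null by (simp add: l2_null_def)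
      show "\<sigma> k n = 0" if "(1 + lnorm n) * \<sigma> k n = 0" for n
        using that lnorm_nonneg[of n] by simp
    qed
    show "sq_sum (\<lambda>n. (1 + lnorm n) * \<sigma> k n) \<le> \<delta>" using k by simp
    fix n
    have pot_u: "(2 * real CARD('d) - x + V n + w2 w n) * u k n = cutoff (R k) n *
        (\<Sum>i\<in>UNIV. a i n * \<phi> (n - axis i 1) + b i n * \<phi> (n + axis i 1))"
      unfolding \<phi>_eq[symmetric] by (simp add: pot_def u_def)
    show "(2 * real CARD('d) - x + V n + w2 w n) * u k n - hop_total (u k) n
          - g n * (\<Sum>i\<in>UNIV. real_of_int (n $ i) * hop_diff i (u k) n)
        = (\<Sum>i\<in>UNIV. (exp (F n - F (n - axis i 1)) - 1 - g n * real_of_int (n $ i)) * shift i (u k) n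
            + (exp (F n - F (n + axis i 1)) - 1 + g n * real_of_int (n $ i)) * shift_adj i (u k) n) + \<sigma> k n"
      unfolding pot_u
      unfolding hop_total_def hop_sum_def hop_diff_def \<sigma>_def a_def[symmetric] b_def[symmetric]
        shift_def shift_adj_def u_def sum_distrib_left sum_subtractf[symmetric] sum.distrib[symmetric]
      by (intro sum.cong) (simp_all add: algebra_simps)
  qed
qed

text \<open>The contradiction behind both finiteness and decay: after truncation with an error tending to
  zero, weighted eigenfunctions that lose all their mass at every fixed point contradict
  \<open>no_escape\<close>, since the truncations keep half of the norm.\<close>

lemma no_escaping_eigenfunctions:
  fixes \<psi> :: "nat \<Rightarrow> int ^ 'd \<Rightarrow> real"
  assumes V: "(V \<longlongrightarrow> 0) cofinite"
    and dV: "\<And>i. ((\<lambda>n. real_of_int (n $ i) * (V n - shift i V n)) \<longlongrightarrow> 0) cofinite"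
    and x: "x \<longlonglongrightarrow> E" "E \<noteq> 2 * real CARD('d)" "2 * real CARD('d) - E \<notin> threshold_sums (UNIV :: 'd set)"
    and eig: "\<And>k. real_eigenfunction w V (x k) (\<psi> k)"
    and F: "\<And>k n. F k n \<le> K k" and adm: "\<And>k. admissible_weight \<eta> (F k) (g k)" and \<eta>: "(\<eta> \<longlongrightarrow> 0) cofinite"
    and M: "\<And>k. M k = (\<Sum>\<^sub>\<infinity>n. (exp (F k n) * \<psi> k n)\<^sup>2)" "\<And>k. 0 < M k"
    and pw: "\<And>n. (\<lambda>k. exp (F k n) * \<bar>\<psi> k n\<bar> / sqrt (M k)) \<longlonglongrightarrow> 0"
  shows False
proof -
  define \<epsilon> where "\<epsilon> k = 2 * real CARD('d) - x k" for k
  define \<alpha> where "\<alpha> k i n = exp (F k n - F k (n - axis i 1)) - 1 - g k n * real_of_int (n $ i)" for k i n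
  define \<beta> where "\<beta> k i n = exp (F k n - F k (n + axis i 1)) - 1 + g k n * real_of_int (n $ i)" for k i n
  define P where "P k u \<sigma> \<longleftrightarrow> fsupp u \<and> sq_sum u \<le> 1 \<and> 1/2 \<le> sq_sum u \<and>
      (\<forall>n. \<bar>u n\<bar> \<le> exp (F k n) * \<bar>\<psi> k n\<bar> / sqrt (M k)) \<and>
      fsupp \<sigma> \<and> sq_sum (\<lambda>n. (1 + lnorm n) * \<sigma> n) \<le> 1 / real (Suc k) \<and>
      (\<forall>n. (\<epsilon> k + V n + w2 w n) * u n - hop_total u n
            - g k n * (\<Sum>i\<in>UNIV. real_of_int (n $ i) * hop_diff i u n)
        = (\<Sum>i\<in>UNIV. \<alpha> k i n * shift i u n + \<beta> k i n * shift_adj i u n) + \<sigma> n)" for k u \<sigma>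
  have "\<exists>u \<sigma>. P k u \<sigma>" for k
    unfolding P_def \<epsilon>_def \<alpha>_def \<beta>_def
    by (rule truncated_eigenfunction[OF eig[of k] F[of k] adm[of k] \<eta> M(1)[of k] M(2)[of k], of "1 / real (Suc k)"])
       (simp, blast)
  then obtain u \<sigma> where P: "\<And>k. P k (u k) (\<sigma> k)" by metis
  have u: "\<And>k. fsupp (u k)" "\<And>k. sq_sum (u k) \<le> 1" "\<And>k. 1/2 \<le> sq_sum (u k)"
      "\<And>k n. \<bar>u k n\<bar> \<le> exp (F k n) * \<bar>\<psi> k n\<bar> / sqrt (M k)"
    and \<sigma>: "\<And>k. fsupp (\<sigma> k)" "\<And>k. sq_sum (\<lambda>n. (1 + lnorm n) * \<sigma> k n) \<le> 1 / real (Suc k)"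
    and eq: "\<And>k n. (\<epsilon> k + V n + w2 w n) * u k n - hop_total (u k) n
            - g k n * (\<Sum>i\<in>UNIV. real_of_int (n $ i) * hop_diff i (u k) n)
        = (\<Sum>i\<in>UNIV. \<alpha> k i n * shift i (u k) n + \<beta> k i n * shift_adj i (u k) n) + \<sigma> k n"
    using P unfolding P_def by blast+
  have bdd: "l2_bounded u" unfolding l2_bounded_def using u(1,2) by blast
  have u0: "(\<lambda>k. u k n) \<longlonglongrightarrow> 0" for n
    using u(4) by (intro Lim_null_comparison[OF always_eventually pw[of n]]) simp
  have adm_k: "0 \<le> g k n" "g k n * \<bar>real_of_int (n $ i)\<bar> \<le> \<eta> n"
    "(1 + lnorm n) * \<bar>\<alpha> k i n\<bar> \<le> \<eta> n" "(1 + lnorm n) * \<bar>\<beta> k i n\<bar> \<le> \<eta> n" for k n i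
    using adm[of k] unfolding admissible_weight_def \<alpha>_def \<beta>_def by blast+
  have lin: "(1 + lnorm n) * ((\<Sum>i\<in>UNIV. \<alpha> k i n * shift i (u k) n + \<beta> k i n * shift_adj i (u k) n) + \<sigma> k n)
      = (\<Sum>i\<in>UNIV. (1 + lnorm n) * \<alpha> k i n * shift i (u k) n + (1 + lnorm n) * \<beta> k i n * shift_adj i (u k) n)
        + (1 + lnorm n) * \<sigma> k n" for k n
    by (simp add: sum_distrib_left distrib_left mult.assoc)
  have "l2_null (\<lambda>k n. (1 + lnorm n) * ((\<Sum>i\<in>UNIV. \<alpha> k i n * shift i (u k) n + \<beta> k i n * shift_adj i (u k) n) + \<sigma> k n))"
    unfolding lin
  proof (intro l2_null_add l2_null_sum)
    have w: "\<bar>1 + lnorm n\<bar> = 1 + lnorm n" for n :: "int ^ 'd" using lnorm_nonneg[of n] by simp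
    show "l2_null (\<lambda>k n. (1 + lnorm n) * \<alpha> k i n * shift i (u k) n)" for i
      by (rule l2_null_of_local[OF l2_bounded_shift(1)[OF bdd, of i] shift_tendsto_0(1)[OF u0] \<eta>])
         (simp add: abs_mult w adm_k mult_right_mono)
    show "l2_null (\<lambda>k n. (1 + lnorm n) * \<beta> k i n * shift_adj i (u k) n)" for i
      by (rule l2_null_of_local[OF l2_bounded_shift(2)[OF bdd, of i] shift_tendsto_0(2)[OF u0] \<eta>])
         (simp add: abs_mult w adm_k mult_right_mono)
    have "(\<lambda>k. sq_sum (\<lambda>n. (1 + lnorm n) * \<sigma> k n)) \<longlonglongrightarrow> 0"
      by (rule tendsto_0_squeeze[OF sq_sum_nonneg \<sigma>(2) LIMSEQ_Suc[OF lim_1_over_n]])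
    then show "l2_null (\<lambda>k n. (1 + lnorm n) * \<sigma> k n)" using \<sigma>(1) by (simp add: l2_null_def)
  qed
  then have null: "l2_null (\<lambda>k n. (1 + lnorm n) * ((\<epsilon> k + V n + w2 w n) * u k n - hop_total (u k) n
            - g k n * (\<Sum>i\<in>UNIV. real_of_int (n $ i) * hop_diff i (u k) n)))"
    unfolding eq .
  have "\<epsilon> \<longlonglongrightarrow> 2 * real CARD('d) - E" unfolding \<epsilon>_def[abs_def] by (intro tendsto_intros x)
  then have "l2_null u"
    by (rule no_escape[OF bdd u0 V dV _ _ x(3) adm_k(1,2) \<eta> refl null]) (use x(2) in simp)
  then have "(\<lambda>k. sq_sum (u k)) \<longlonglongrightarrow> 0" by (simp add: l2_null_def)
  then have "\<forall>\<^sub>F k in sequentially. sq_sum (u k) < 1/2" by (rule order_tendstoD) simp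
  then obtain k where "sq_sum (u k) < 1/2" by (auto simp: eventually_sequentially)
  then show False using u(3)[of k] by simp
qed

section \<open>Multiplicity, number and decay of eigenfunctions\<close>

text \<open>Otherwise there are eigenfunctions, at energies tending to \<open>E\<close>, whose mass in the ball of radius
  \<open>k\<close> is at most the fraction \<open>1 / (k + 1)\<close>; unweighted, they escape to infinity.\<close>

lemma eigenfunction_mass_in_ball:
  fixes V :: "int ^ 'd \<Rightarrow> real"
  assumes V: "(V \<longlongrightarrow> 0) cofinite"
    and dV: "\<And>i. ((\<lambda>n. real_of_int (n $ i) * (V n - shift i V n)) \<longlongrightarrow> 0) cofinite"
    and E: "E \<noteq> 2 * real CARD('d)" "2 * real CARD('d) - E \<notin> threshold_sums (UNIV :: 'd set)"
  obtains \<epsilon> and N :: nat where "0 < \<epsilon>"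
    "\<And>x \<psi>. \<bar>x - E\<bar> < \<epsilon> \<Longrightarrow> real_eigenfunction w V x \<psi> \<Longrightarrow>
       \<epsilon> * (\<Sum>\<^sub>\<infinity>n. (\<psi> n)\<^sup>2) \<le> (\<Sum>n\<in>{n. lnorm n \<le> real N}. (\<psi> n)\<^sup>2)"
proof -
  define Q where "Q k x \<psi> \<longleftrightarrow> \<bar>x - E\<bar> < 1 / real (Suc k) \<and> real_eigenfunction w V x \<psi> \<and>
      (\<Sum>n\<in>{n. lnorm n \<le> real k}. (\<psi> n)\<^sup>2) < 1 / real (Suc k) * (\<Sum>\<^sub>\<infinity>n. (\<psi> n)\<^sup>2)" for k x \<psi>
  have "\<exists>k. \<forall>x \<psi>. \<not> Q k x \<psi>"
  proof (rule ccontr)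
    assume "\<not> ?thesis"
    then obtain x \<psi> where Q: "\<And>k. Q k (x k) (\<psi> k)" by metis
    define M where "M k = (\<Sum>\<^sub>\<infinity>n. (\<psi> k n)\<^sup>2)" for k
    have x: "\<bar>x k - E\<bar> \<le> 1 / real (Suc k)" and eig: "real_eigenfunction w V (x k) (\<psi> k)"
      and mass: "(\<Sum>n\<in>{n. lnorm n \<le> real k}. (\<psi> k n)\<^sup>2) < 1 / real (Suc k) * M k" for k
      using Q[of k] by (auto simp: Q_def M_def)
    have M_pos: "0 < M k" for k
    proof -
      have "0 \<le> (\<Sum>n\<in>{n. lnorm n \<le> real k}. (\<psi> k n)\<^sup>2)" by (rule sum_nonneg) simp
      with mass[of k] have "0 < 1 / real (Suc k) * M k" by linarith
      then show ?thesis by (simp add: zero_less_divide_iff)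
    qed
    have "(\<lambda>k. x k - E) \<longlonglongrightarrow> 0"
      by (rule Lim_null_comparison[OF always_eventually LIMSEQ_Suc[OF lim_1_over_n]]) (use x in simp)
    then have xE: "x \<longlonglongrightarrow> E" by (rule LIM_zero_cancel)
    have pw: "(\<lambda>k. exp 0 * \<bar>\<psi> k n\<bar> / sqrt (M k)) \<longlonglongrightarrow> 0" for n
    proof (rule Lim_null_comparison)
      show "(\<lambda>k. sqrt (1 / real (Suc k))) \<longlonglongrightarrow> 0"
        using tendsto_real_sqrt[OF LIMSEQ_Suc[OF lim_1_over_n]] by simp
      obtain k0 where k0: "lnorm n \<le> real k0" using real_arch_simple by blast
      have "norm (exp 0 * \<bar>\<psi> k n\<bar> / sqrt (M k)) \<le> sqrt (1 / real (Suc k))" if "k0 \<le> k" for k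
      proof -
        have "lnorm n \<le> real k" using k0 that by (meson of_nat_mono order_trans)
        then have "(\<psi> k n)\<^sup>2 \<le> (\<Sum>n\<in>{n. lnorm n \<le> real k}. (\<psi> k n)\<^sup>2)"
          by (intro member_le_sum finite_lattice_ball) auto
        with mass[of k] have "(\<psi> k n)\<^sup>2 / M k \<le> 1 / real (Suc k)"
          using M_pos[of k] by (subst pos_divide_le_eq) auto
        then have "sqrt ((\<psi> k n)\<^sup>2 / M k) \<le> sqrt (1 / real (Suc k))" by (rule real_sqrt_le_mono)
        then show ?thesis using M_pos[of k] by (simp add: real_sqrt_divide)
      qed
      then show "\<forall>\<^sub>F k in sequentially. norm (exp 0 * \<bar>\<psi> k n\<bar> / sqrt (M k)) \<le> sqrt (1 / real (Suc k))"
        unfolding eventually_sequentially by blast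
    qed
    show False
    proof (rule no_escaping_eigenfunctions[OF V dV xE E eig, where F = "\<lambda>_ _. 0" and K = "\<lambda>_. 0"
          and \<eta> = "\<lambda>_. 0" and g = "\<lambda>_ _. 0" and M = M])
      show "admissible_weight (\<lambda>_ :: int ^ 'd. 0) (\<lambda>_. 0) (\<lambda>_. 0)"
        by (simp add: admissible_weight_def)
    qed (use M_pos pw in \<open>simp_all add: M_def\<close>)
  qed
  then obtain k where k: "\<And>x \<psi>. \<not> Q k x \<psi>" by blast
  show ?thesis
  proof (rule that[of "1 / real (Suc k)" k])
    show "1 / real (Suc k) * (\<Sum>\<^sub>\<infinity>n. (\<psi> n)\<^sup>2) \<le> (\<Sum>n\<in>{n. lnorm n \<le> real k}. (\<psi> n)\<^sup>2)"
      if "\<bar>x - E\<bar> < 1 / real (Suc k)" "real_eigenfunction w V x \<psi>" for x \<psi>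
      using k[of x \<psi>] that by (simp add: Q_def del: of_nat_Suc)
  qed simp
qed

text \<open>If the weighted function is not in \<open>\<ell>\<^sup>2\<close>, the norms with the bounded weights
  \<^term>\<open>ramp_weight c\<close> are unbounded as \<open>c \<rightarrow> 0\<close>. Dividing by them makes every fixed value tend to
  zero, so the normalized weighted functions escape.\<close>

lemma eigenfunction_decay:
  fixes V :: "int ^ 'd \<Rightarrow> real"
  assumes V: "(V \<longlongrightarrow> 0) cofinite"
    and dV: "\<And>i. ((\<lambda>n. real_of_int (n $ i) * (V n - shift i V n)) \<longlongrightarrow> 0) cofinite"
    and x: "x \<noteq> 2 * real CARD('d)" "2 * real CARD('d) - x \<notin> threshold_sums (UNIV :: 'd set)"
    and eig: "real_eigenfunction w V x \<psi>"
  shows "(\<lambda>n. (exp (ramp_weight 0 n) * \<psi> n)\<^sup>2) summable_on UNIV"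
proof (rule ccontr)
  assume not: "\<not> ?thesis"
  define c where "c j = 1 / real (Suc j)" for j
  have c: "0 < c j" "0 \<le> c j" for j by (simp_all add: c_def)
  define M where "M j = (\<Sum>\<^sub>\<infinity>n. (exp (ramp_weight (c j) n) * \<psi> n)\<^sup>2)" for j
  have summ: "(\<lambda>n. (exp (ramp_weight (c j) n) * \<psi> n)\<^sup>2) summable_on UNIV" for j
  proof (rule summable_on_comparison_test)
    show "(\<lambda>n. (exp ((1 / c j) powr (1/8)))\<^sup>2 * (\<psi> n)\<^sup>2) summable_on UNIV"
      using eig by (intro summable_on_cmult_right) (simp add: real_eigenfunction_def)
    show "(exp (ramp_weight (c j) n) * \<psi> n)\<^sup>2 \<le> (exp ((1 / c j) powr (1/8)))\<^sup>2 * (\<psi> n)\<^sup>2" for n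
      unfolding power_mult_distrib using ramp_weight_bounded[OF c(1), of j n]
      by (intro mult_right_mono power_mono) auto
  qed simp
  have "\<exists>j. real (Suc k) < M j" for k
  proof (rule ccontr)
    assume "\<not> ?thesis"
    then have le: "M j \<le> real (Suc k)" for j by (simp add: not_less)
    have "(\<lambda>n. (exp (ramp_weight 0 n) * \<psi> n)\<^sup>2) summable_on UNIV"
    proof (rule nonneg_bdd_above_summable_on)
      show "bdd_above (sum (\<lambda>n. (exp (ramp_weight 0 n) * \<psi> n)\<^sup>2) ` {F. F \<subseteq> UNIV \<and> finite F})"
      proof (rule bdd_aboveI2)
        fix A :: "(int ^ 'd) set" assume "A \<in> {F. F \<subseteq> UNIV \<and> finite F}"
        then have A: "finite A" by simp
        have "(\<lambda>j. \<Sum>n\<in>A. (exp (ramp_weight (c j) n) * \<psi> n)\<^sup>2) \<longlonglongrightarrow> (\<Sum>n\<in>A. (exp (ramp_weight 0 n) * \<psi> n)\<^sup>2)"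
          unfolding c_def by (intro tendsto_intros ramp_weight_tendsto)
        moreover have "(\<Sum>n\<in>A. (exp (ramp_weight (c j) n) * \<psi> n)\<^sup>2) \<le> real (Suc k)" for j
          using finite_sum_le_infsum[OF summ[of j] A] le[of j] by (simp add: M_def del: of_nat_Suc)
        ultimately show "(\<Sum>n\<in>A. (exp (ramp_weight 0 n) * \<psi> n)\<^sup>2) \<le> real (Suc k)"
          by (intro LIMSEQ_le_const2) auto
      qed
    qed simp
    then show False using not by simp
  qed
  then obtain j where j: "\<And>k. real (Suc k) < M (j k)" by metis
  have M_pos: "0 < M (j k)" for k by (rule le_less_trans[OF _ j[of k]]) simp
  have pw: "(\<lambda>k. exp (ramp_weight (c (j k)) n) * \<bar>\<psi> n\<bar> / sqrt (M (j k))) \<longlonglongrightarrow> 0" for n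
  proof (rule Lim_null_comparison[OF always_eventually])
    have "(\<lambda>k. sqrt (1 / real (Suc k))) \<longlonglongrightarrow> 0"
      using tendsto_real_sqrt[OF LIMSEQ_Suc[OF lim_1_over_n]] by simp
    then show "(\<lambda>k. exp (ramp_weight 0 n) * \<bar>\<psi> n\<bar> * sqrt (1 / real (Suc k))) \<longlonglongrightarrow> 0"
      by (rule tendsto_mult_right_zero)
    show "\<forall>k. norm (exp (ramp_weight (c (j k)) n) * \<bar>\<psi> n\<bar> / sqrt (M (j k)))
        \<le> exp (ramp_weight 0 n) * \<bar>\<psi> n\<bar> * sqrt (1 / real (Suc k))"
    proof
      fix k
      have "1 / M (j k) \<le> 1 / real (Suc k)" using j[of k] M_pos[of k] by (intro divide_left_mono) auto
      then have "sqrt (1 / M (j k)) \<le> sqrt (1 / real (Suc k))" by (rule real_sqrt_le_mono)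
      moreover have "exp (ramp_weight (c (j k)) n) * \<bar>\<psi> n\<bar> \<le> exp (ramp_weight 0 n) * \<bar>\<psi> n\<bar>"
        using ramp_weight_le[OF c(2)] by (intro mult_right_mono) auto
      ultimately have "exp (ramp_weight (c (j k)) n) * \<bar>\<psi> n\<bar> * sqrt (1 / M (j k))
          \<le> exp (ramp_weight 0 n) * \<bar>\<psi> n\<bar> * sqrt (1 / real (Suc k))"
        by (elim mult_mono[rotated]) (use M_pos[of k] in \<open>simp_all del: of_nat_Suc\<close>)
      then show "norm (exp (ramp_weight (c (j k)) n) * \<bar>\<psi> n\<bar> / sqrt (M (j k)))
        \<le> exp (ramp_weight 0 n) * \<bar>\<psi> n\<bar> * sqrt (1 / real (Suc k))"
        using M_pos[of k] by (simp add: real_sqrt_divide abs_mult del: of_nat_Suc)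
    qed
  qed
  show False
    by (rule no_escaping_eigenfunctions[OF V dV tendsto_const x eig ramp_weight_bounded[OF c(1)]
          ramp_weight_admissible[OF c(2)] ramp_bound_tendsto_0 M_def M_pos pw])
qed

definition sq_summable :: "('a \<Rightarrow> real) \<Rightarrow> bool" where
  "sq_summable f \<longleftrightarrow> (\<lambda>n. (f n)\<^sup>2) summable_on UNIV"

lemma sq_summable_mult:
  assumes "sq_summable f" "sq_summable h"
  shows "(\<lambda>n. f n * h n) summable_on UNIV"
proof -
  have "(\<lambda>n. (f n)\<^sup>2 + (h n)\<^sup>2) summable_on UNIV"
    using assms by (intro summable_on_add) (auto simp: sq_summable_def)
  moreover have "norm (f n * h n) \<le> (f n)\<^sup>2 + (h n)\<^sup>2" for n
  proof -
    have "2 * (\<bar>f n\<bar> * \<bar>h n\<bar>) \<le> (f n)\<^sup>2 + (h n)\<^sup>2"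
      using sum_squares_bound[of "\<bar>f n\<bar>" "\<bar>h n\<bar>"] by simp
    moreover have "0 \<le> \<bar>f n\<bar> * \<bar>h n\<bar>" by simp
    ultimately show ?thesis unfolding real_norm_def abs_mult by linarith
  qed
  ultimately have "(\<lambda>n. norm (f n * h n)) summable_on UNIV"
    by (rule summable_on_comparison_test) auto
  then show ?thesis by (rule abs_summable_summable)
qed

lemma sq_summable_shift:
  assumes "sq_summable f"
  shows "sq_summable (shift i f)" "sq_summable (shift_adj i f)"
  using summable_on_reindex_bij_betw[OF bij_lattice_step(2), of "\<lambda>n. (f n)\<^sup>2" i]
    summable_on_reindex_bij_betw[OF bij_lattice_step(1), of "\<lambda>n. (f n)\<^sup>2" i] assms
  by (simp_all add: sq_summable_def shift_def shift_adj_def)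

lemma has_sum_finite_sum:
  fixes f :: "'i \<Rightarrow> 'a \<Rightarrow> real"
  assumes "\<And>i. i \<in> A \<Longrightarrow> (f i has_sum s i) X"
  shows "((\<lambda>n. \<Sum>i\<in>A. f i n) has_sum (\<Sum>i\<in>A. s i)) X"
  using assms by (induction A rule: infinite_finite_induct) (auto intro!: has_sum_add has_sum_0)

lemma hop_total_has_sum:
  assumes "sq_summable f" "sq_summable h"
  shows "((\<lambda>n. hop_total f n * h n) has_sum (\<Sum>i\<in>UNIV. ip (shift i f) h + ip (shift_adj i f) h)) UNIV"
proof -
  have "((\<lambda>n. shift i f n * h n + shift_adj i f n * h n) has_sum (ip (shift i f) h + ip (shift_adj i f) h)) UNIV" for i
    unfolding ip_def using assms
    by (intro has_sum_add has_sum_infsum sq_summable_mult sq_summable_shift)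
  then have "((\<lambda>n. \<Sum>i\<in>UNIV. shift i f n * h n + shift_adj i f n * h n) has_sum
      (\<Sum>i\<in>UNIV. ip (shift i f) h + ip (shift_adj i f) h)) UNIV"
    by (rule has_sum_finite_sum)
  then show ?thesis
    by (simp add: hop_total_def hop_sum_def sum_distrib_right distrib_right)
qed

text \<open>The hopping operator is symmetric, and the potentials cancel in the difference of the two
  equations multiplied crosswise.\<close>

lemma eigenfunctions_orthogonal:
  assumes f: "real_eigenfunction w V x f" and h: "real_eigenfunction w V y h" and "x \<noteq> y"
  shows "ip f h = 0"
proof -
  have s: "sq_summable f" "sq_summable h"
    using f h by (auto simp: real_eigenfunction_def sq_summable_def)
  have "((\<lambda>n. hop_total f n * h n - hop_total h n * f n) has_sum
      ((\<Sum>i\<in>UNIV. ip (shift i f) h + ip (shift_adj i f) h) - (\<Sum>i\<in>UNIV. ip (shift i h) f + ip (shift_adj i h) f))) UNIV"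
    using has_sum_add[OF hop_total_has_sum[OF s] has_sum_cmult_right[OF hop_total_has_sum[OF s(2,1)], of "- 1"]]
    by simp
  also have "(\<Sum>i\<in>UNIV. ip (shift i h) f + ip (shift_adj i h) f) = (\<Sum>i\<in>UNIV. ip (shift i f) h + ip (shift_adj i f) h)"
    by (rule sum.cong) (simp_all add: ip_shift ip_shift_adj ip_commute[of h])
  also have "(\<lambda>n. hop_total f n * h n - hop_total h n * f n) = (\<lambda>n. (y - x) * (f n * h n))"
  proof
    fix n
    have "hop_total f n = (2 * real CARD('a) - x + V n + w2 w n) * f n"
      "hop_total h n = (2 * real CARD('a) - y + V n + w2 w n) * h n"
      using f h by (simp_all add: real_eigenfunction_def)
    then show "hop_total f n * h n - hop_total h n * f n = (y - x) * (f n * h n)"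
      by (simp only:) (simp add: algebra_simps)
  qed
  finally have "(\<Sum>\<^sub>\<infinity>n. (y - x) * (f n * h n)) = 0" by (simp add: infsumI)
  then show ?thesis using \<open>x \<noteq> y\<close> unfolding infsum_cmult_right' ip_def by simp
qed

text \<open>The reproducing function \<open>\<phi> = \<Sum>\<^sub>x f\<^sub>x(n) f\<^sub>x\<close> has both \<open>\<phi>(n) = S\<close> and \<open>|\<phi>|\<^sup>2 = S\<close>, where \<open>S\<close> is the sum
  in question; hence \<open>S\<^sup>2 \<le> S\<close>.\<close>

lemma Bessel_pointwise:
  fixes f :: "'b \<Rightarrow> 'a \<Rightarrow> real"
  assumes "finite Y" and s: "\<And>x. x \<in> Y \<Longrightarrow> sq_summable (f x)"
    and on: "\<And>x y. x \<in> Y \<Longrightarrow> y \<in> Y \<Longrightarrow> ip (f x) (f y) = (if x = y then 1 else 0)"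
  shows "(\<Sum>x\<in>Y. (f x n)\<^sup>2) \<le> 1"
proof -
  define S where "S = (\<Sum>x\<in>Y. (f x n)\<^sup>2)"
  define \<phi> where "\<phi> m = (\<Sum>x\<in>Y. f x n * f x m)" for m
  have sq: "(\<phi> m)\<^sup>2 = (\<Sum>x\<in>Y. \<Sum>y\<in>Y. f x n * f y n * (f x m * f y m))" for m
    by (simp add: \<phi>_def power2_eq_square sum_product mult_ac)
  have "((\<lambda>m. (\<phi> m)\<^sup>2) has_sum (\<Sum>x\<in>Y. \<Sum>y\<in>Y. f x n * f y n * ip (f x) (f y))) UNIV"
    unfolding sq ip_def using s
    by (intro has_sum_finite_sum has_sum_cmult_right has_sum_infsum sq_summable_mult) auto
  also have "(\<Sum>x\<in>Y. \<Sum>y\<in>Y. f x n * f y n * ip (f x) (f y)) = S"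
    unfolding S_def using \<open>finite Y\<close> by (intro sum.cong) (simp_all add: on power2_eq_square if_distrib sum.delta cong: if_cong)
  finally have hs: "((\<lambda>m. (\<phi> m)\<^sup>2) has_sum S) UNIV" .
  have "(\<phi> n)\<^sup>2 = (\<Sum>m\<in>{n}. (\<phi> m)\<^sup>2)" by simp
  also have "\<dots> \<le> S"
    using finite_sum_le_infsum[OF has_sum_imp_summable[OF hs], of "{n}"] infsumI[OF hs] by simp
  also have "\<phi> n = S" by (simp add: \<phi>_def S_def power2_eq_square)
  finally have "S * S \<le> S * 1" by (simp add: power2_eq_square)
  moreover have "0 \<le> S" unfolding S_def by (rule sum_nonneg) simp
  ultimately have "S \<le> 1" by (metis mult_le_cancel_left_pos not_less order_le_less zero_less_one order.trans less_le)
  then show ?thesis by (simp add: S_def)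
qed

lemma real_eigenfunction_scale:
  assumes "real_eigenfunction w V x f"
  shows "real_eigenfunction w V x (\<lambda>n. c * f n)"
proof -
  have "(\<lambda>n. c\<^sup>2 * (f n)\<^sup>2) summable_on UNIV"
    using assms by (intro summable_on_cmult_right) (simp add: real_eigenfunction_def)
  moreover have "hop_total (\<lambda>n. c * f n) n = c * hop_total f n" for n
    by (simp add: hop_total_def hop_sum_def shift_def shift_adj_def sum_distrib_left distrib_left)
  ultimately show ?thesis
    using assms by (simp add: real_eigenfunction_def power_mult_distrib mult.left_commute)
qed

text \<open>Choose one normalized eigenfunction for each eigenvalue. Each has mass at least \<open>\<epsilon>\<close> on \<open>A\<close>,
  whereas together they have mass at most one at each point of \<open>A\<close>, so there are at most
  \<open>card A / \<epsilon>\<close> of them.\<close>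

lemma finite_eigenvalues:
  fixes V :: "int ^ 'd \<Rightarrow> real"
  assumes "0 < \<epsilon>" and mass: "\<And>x \<psi>. x \<in> I \<Longrightarrow> real_eigenfunction w V x \<psi> \<Longrightarrow>
       \<epsilon> * (\<Sum>\<^sub>\<infinity>n. (\<psi> n)\<^sup>2) \<le> (\<Sum>n\<in>A. (\<psi> n)\<^sup>2)"
  shows "finite {x \<in> I. \<exists>\<psi>. real_eigenfunction w V x \<psi> \<and> \<psi> \<noteq> 0}"
proof (rule finite_if_finite_subsets_card_bdd[THEN conjunct1])
  fix Y assume Y: "Y \<subseteq> {x \<in> I. \<exists>\<psi>. real_eigenfunction w V x \<psi> \<and> \<psi> \<noteq> 0}" "finite Y"
  have "\<exists>f. real_eigenfunction w V x f \<and> (\<Sum>\<^sub>\<infinity>n. (f n)\<^sup>2) = 1" if "x \<in> Y" for x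
  proof -
    obtain \<psi> where \<psi>: "real_eigenfunction w V x \<psi>" "\<psi> \<noteq> 0" using Y(1) \<open>x \<in> Y\<close> by auto
    obtain n where n: "\<psi> n \<noteq> 0" using \<psi>(2) by (auto simp: fun_eq_iff)
    define M where "M = (\<Sum>\<^sub>\<infinity>n. (\<psi> n)\<^sup>2)"
    have le: "(\<Sum>m\<in>{n}. (\<psi> m)\<^sup>2) \<le> M"
      unfolding M_def using \<psi>(1) by (intro finite_sum_le_infsum) (auto simp: real_eigenfunction_def)
    have "0 < M" by (rule less_le_trans[OF _ le]) (use n in simp)
    have "(\<Sum>\<^sub>\<infinity>n. (1 / sqrt M * \<psi> n)\<^sup>2) = 1"
      using \<open>0 < M\<close> unfolding power_mult_distrib infsum_cmult_right' M_def[symmetric] by (simp add: power_divide)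
    then show ?thesis using real_eigenfunction_scale[OF \<psi>(1)] by blast
  qed
  then obtain f where f: "\<And>x. x \<in> Y \<Longrightarrow> real_eigenfunction w V x (f x)"
    "\<And>x. x \<in> Y \<Longrightarrow> (\<Sum>\<^sub>\<infinity>n. (f x n)\<^sup>2) = 1" by metis
  have on: "ip (f x) (f y) = (if x = y then 1 else 0)" if "x \<in> Y" "y \<in> Y" for x y
  proof (cases "x = y")
    case True
    then show ?thesis using f(2)[OF that(1)] by (simp add: ip_def power2_eq_square)
  next
    case False
    then show ?thesis using eigenfunctions_orthogonal[OF f(1)[OF that(1)] f(1)[OF that(2)]] by simp
  qed
  have "\<epsilon> * real (card Y) = (\<Sum>x\<in>Y. \<epsilon> * 1)" by simp
  also have "\<dots> \<le> (\<Sum>x\<in>Y. \<Sum>n\<in>A. (f x n)\<^sup>2)"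
  proof (rule sum_mono)
    fix x assume "x \<in> Y"
    then have "x \<in> I" using Y(1) by auto
    from mass[OF this f(1)[OF \<open>x \<in> Y\<close>]] show "\<epsilon> * 1 \<le> (\<Sum>n\<in>A. (f x n)\<^sup>2)"
      unfolding f(2)[OF \<open>x \<in> Y\<close>] .
  qed
  also have "\<dots> = (\<Sum>n\<in>A. \<Sum>x\<in>Y. (f x n)\<^sup>2)" by (rule sum.swap)
  also have "\<dots> \<le> (\<Sum>n\<in>A. 1)"
    using f(1) by (intro sum_mono Bessel_pointwise Y(2) on) (auto simp: real_eigenfunction_def sq_summable_def)
  finally have "real (card Y) \<le> real (card A) / \<epsilon>" using \<open>0 < \<epsilon>\<close> by (simp add: field_simps)
  then have "real (card Y) \<le> real (nat \<lceil>real (card A) / \<epsilon>\<rceil>)" by linarith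
  then show "card Y \<le> nat \<lceil>real (card A) / \<epsilon>\<rceil>" by simp
qed

section \<open>Complex eigenspaces and thresholds\<close>

lemma real_eigenfunction_Re_Im:
  fixes \<psi> :: "int ^ 'd \<Rightarrow> complex"
  assumes "\<psi> \<in> eigenspace (H2 w V) (complex_of_real x)"
  shows "real_eigenfunction w V x (\<lambda>n. Re (\<psi> n))" "real_eigenfunction w V x (\<lambda>n. Im (\<psi> n))"
proof -
  have summ: "(\<lambda>n. (cmod (\<psi> n))\<^sup>2) summable_on UNIV" and eq: "H2 w V \<psi> n = complex_of_real x * \<psi> n" for n
    using assms by (auto simp: eigenspace_def ell2_def fun_eq_iff)
  have "(\<lambda>n. (Re (\<psi> n))\<^sup>2) summable_on UNIV" "(\<lambda>n. (Im (\<psi> n))\<^sup>2) summable_on UNIV"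
    by (rule summable_on_comparison_test[OF summ]; simp add: cmod_power2)+
  moreover have "(2 * real CARD('d) - x + V n + w2 w n) * Re (\<psi> n) = hop_total (\<lambda>n. Re (\<psi> n)) n"
    "(2 * real CARD('d) - x + V n + w2 w n) * Im (\<psi> n) = hop_total (\<lambda>n. Im (\<psi> n)) n" for n
    using arg_cong[OF eq[of n], of Re] arg_cong[OF eq[of n], of Im]
    by (simp_all add: H2_def Laplacian_def mult_op_def hop_total_def hop_sum_def shift_def shift_adj_def
        sum_subtractf sum.distrib algebra_simps)
  ultimately show "real_eigenfunction w V x (\<lambda>n. Re (\<psi> n))" "real_eigenfunction w V x (\<lambda>n. Im (\<psi> n))"
    by (auto simp: real_eigenfunction_def)
qed

lemma point_spectrum_imp_real_eigenfunction:
  assumes "complex_of_real x \<in> point_spectrum (H2 w V)"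
  shows "\<exists>\<psi>. real_eigenfunction w V x \<psi> \<and> \<psi> \<noteq> 0"
proof -
  obtain \<psi> where \<psi>: "\<psi> \<in> eigenspace (H2 w V) (complex_of_real x)" "\<psi> \<noteq> 0"
    using assms by (auto simp: point_spectrum_def)
  have "(\<lambda>n. Re (\<psi> n)) \<noteq> 0 \<or> (\<lambda>n. Im (\<psi> n)) \<noteq> 0"
    using \<psi>(2) by (auto simp: fun_eq_iff complex_eq_iff)
  then show ?thesis using real_eigenfunction_Re_Im[OF \<psi>(1)] by blast
qed

text \<open>Each condition \<open>f a = 0\<close> lowers the dimension by at most one.\<close>

lemma finite_dimensional_if_determined_on_finite:
  assumes "finite A" and lin: "\<And>f h c. f \<in> X \<Longrightarrow> h \<in> X \<Longrightarrow> (\<lambda>n. f n - c * h n) \<in> X"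
    and "\<And>f. f \<in> X \<Longrightarrow> (\<And>n. n \<in> A \<Longrightarrow> f n = 0) \<Longrightarrow> f = 0"
  shows "finite_dimensional X"
  using assms
proof (induction A arbitrary: X rule: finite_induct)
  case empty
  then have "f = 0" if "f \<in> X" for f using that by blast
  then have "X \<subseteq> cfun.span {}" using cfun.span_zero[of "{}"] by auto
  then show ?case unfolding finite_dimensional_def by blast
next
  case (insert a A)
  define X' where "X' = {f \<in> X. f a = 0}"
  have "finite_dimensional X'"
  proof (rule insert.IH)
    show "(\<lambda>n. f n - c * h n) \<in> X'" if "f \<in> X'" "h \<in> X'" for f h c
      using that insert.prems(1) by (simp add: X'_def)
    show "f = 0" if "f \<in> X'" "\<And>n. n \<in> A \<Longrightarrow> f n = 0" for f
      using that by (intro insert.prems(2)) (auto simp: X'_def)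
  qed
  then obtain B where B: "finite B" "X' \<subseteq> cfun.span B" by (auto simp: finite_dimensional_def)
  show ?case
  proof (cases "\<exists>h\<in>X. h a \<noteq> 0")
    case True
    then obtain h where h: "h \<in> X" "h a \<noteq> 0" by blast
    have "X \<subseteq> cfun.span (insert h B)"
    proof
      fix f assume "f \<in> X"
      then have "(\<lambda>n. f n - f a / h a * h n) \<in> X'"
        using insert.prems(1)[of f h "f a / h a"] h by (simp add: X'_def)
      then have 1: "(\<lambda>n. f n - f a / h a * h n) \<in> cfun.span (insert h B)"
        using B(2) cfun.span_mono[of B "insert h B"] by blast
      have 2: "(\<lambda>n. f a / h a * h n) \<in> cfun.span (insert h B)"
        by (rule cfun.span_scale[OF cfun.span_base]) simp
      have "(\<lambda>n. f n - f a / h a * h n) + (\<lambda>n. f a / h a * h n) \<in> cfun.span (insert h B)"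
        by (rule cfun.span_add[OF 1 2])
      also have "(\<lambda>n. f n - f a / h a * h n) + (\<lambda>n. f a / h a * h n) = f"
        by (simp add: fun_eq_iff)
      finally show "f \<in> cfun.span (insert h B)" .
    qed
    then show ?thesis using B(1) unfolding finite_dimensional_def by blast
  next
    case False
    then have "X = X'" by (auto simp: X'_def)
    then show ?thesis using \<open>finite_dimensional X'\<close> by simp
  qed
qed

lemma eigenspace_H2_diff:
  assumes "f \<in> eigenspace (H2 w V) z" "h \<in> eigenspace (H2 w V) z"
  shows "(\<lambda>n. f n - c * h n) \<in> eigenspace (H2 w V) z"
proof -
  have eq: "H2 w V f n = z * f n" "H2 w V h n = z * h n" for n
    using assms by (auto simp: eigenspace_def fun_eq_iff)
  have "H2 w V (\<lambda>n. f n - c * h n) n = H2 w V f n - c * H2 w V h n" for n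
    by (simp add: H2_def Laplacian_def mult_op_def shift_def shift_adj_def sum_subtractf sum.distrib
        sum_distrib_left algebra_simps)
  then have "H2 w V (\<lambda>n. f n - c * h n) n = z * (f n - c * h n)" for n
    unfolding eq by (simp add: algebra_simps)
  moreover have "(\<lambda>n. f n - c * h n) \<in> ell2"
    using ell2_add[of f "\<lambda>n. (- c) * h n"] ell2_mult[of h "\<lambda>_. - c" "cmod c"] assms
    by (simp add: eigenspace_def)
  ultimately show ?thesis by (simp add: eigenspace_def fun_eq_iff)
qed

lemma real_eigenfunction_eq_0:
  assumes "real_eigenfunction w V x f" "0 < \<epsilon>" "\<epsilon> * (\<Sum>\<^sub>\<infinity>n. (f n)\<^sup>2) \<le> 0"
  shows "f n = 0"
proof -
  have 1: "(\<Sum>m\<in>{n}. (f m)\<^sup>2) \<le> (\<Sum>\<^sub>\<infinity>n. (f n)\<^sup>2)"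
    using assms(1) by (intro finite_sum_le_infsum) (auto simp: real_eigenfunction_def)
  have "(\<Sum>\<^sub>\<infinity>n. (f n)\<^sup>2) \<le> 0" using assms(2,3) by (simp add: mult_le_0_iff)
  from order_trans[OF 1 this] show ?thesis by simp
qed

lemma finite_dimensional_eigenspace:
  assumes "finite A" "0 < \<epsilon>" and mass: "\<And>\<psi>. real_eigenfunction w V x \<psi> \<Longrightarrow>
       \<epsilon> * (\<Sum>\<^sub>\<infinity>n. (\<psi> n)\<^sup>2) \<le> (\<Sum>n\<in>A. (\<psi> n)\<^sup>2)"
  shows "finite_dimensional (eigenspace (H2 w V) (complex_of_real x))"
proof (rule finite_dimensional_if_determined_on_finite[OF \<open>finite A\<close> eigenspace_H2_diff])
  fix f assume f: "f \<in> eigenspace (H2 w V) (complex_of_real x)" "\<And>n. n \<in> A \<Longrightarrow> f n = 0"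
  have "Re (f n) = 0" "Im (f n) = 0" for n
    using mass[OF real_eigenfunction_Re_Im(1)[OF f(1)]] mass[OF real_eigenfunction_Re_Im(2)[OF f(1)]] f(2)
    by (auto intro!: real_eigenfunction_eq_0[OF real_eigenfunction_Re_Im(1)[OF f(1)] \<open>0 < \<epsilon>\<close>]
        real_eigenfunction_eq_0[OF real_eigenfunction_Re_Im(2)[OF f(1)] \<open>0 < \<epsilon>\<close>])
  then show "f = 0" by (simp add: fun_eq_iff complex_eq_iff)
qed

lemma jap_powr: "jap n powr (1/4) = ramp_weight 0 n"
  by (simp add: jap_def ramp_weight_def ramp_def powr_half_sqrt[symmetric] powr_powr)

lemma decays_subexp_if_real_parts:
  assumes "(\<lambda>n. (exp (ramp_weight 0 n) * Re (\<psi> n))\<^sup>2) summable_on UNIV"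
    and "(\<lambda>n. (exp (ramp_weight 0 n) * Im (\<psi> n))\<^sup>2) summable_on UNIV"
  shows "decays_subexp \<psi>"
proof -
  have "exp (2 * 1 * jap n powr (1/4)) * (cmod (\<psi> n))\<^sup>2
      = (exp (ramp_weight 0 n) * Re (\<psi> n))\<^sup>2 + (exp (ramp_weight 0 n) * Im (\<psi> n))\<^sup>2" for n
    unfolding jap_powr by (simp add: cmod_power2 power_mult_distrib distrib_left exp_double)
  then have "(\<lambda>n. exp (2 * 1 * jap n powr (1/4)) * (cmod (\<psi> n))\<^sup>2) summable_on UNIV"
    using summable_on_add[OF assms] by simp
  then show ?thesis
    unfolding decays_subexp_def by (intro exI[of _ 1] exI[of _ "1/4"]) auto
qed

text \<open>If \<open>k\<close> of the \<open>d\<close> signs are negative, the sum is \<open>2 (d - k) - 2 k\<close>.\<close>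

lemma threshold_sums_subset:
  "threshold_sums (UNIV :: 'd::finite set) \<subseteq> (\<lambda>k. 2 * real CARD('d) - 4 * real k) ` {..CARD('d)}"
proof
  fix y assume "y \<in> threshold_sums (UNIV :: 'd set)"
  then obtain s :: "'d \<Rightarrow> real" where s: "y = (\<Sum>i\<in>UNIV. s i)" "\<And>i. s i = 2 \<or> s i = - 2"
    by (auto simp: threshold_sums_def)
  let ?N = "{i. s i = - 2}"
  have "s i = 2 - (if i \<in> ?N then 4 else 0)" for i using s(2)[of i] by auto
  then have "y = (\<Sum>i\<in>UNIV. 2 - (if i \<in> ?N then 4 else 0))" unfolding s(1) by (intro sum.cong) auto
  also have "\<dots> = 2 * real CARD('d) - 4 * real (card ?N)"
    by (simp add: sum_subtractf sum.If_cases)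
  finally show "y \<in> (\<lambda>k. 2 * real CARD('d) - 4 * real k) ` {..CARD('d)}"
    by (auto intro!: image_eqI[of _ _ "card ?N"] card_mono)
qed

lemma mu_H2_neighbourhood:
  assumes "E \<in> mu_H2 CARD('d::finite)"
  obtains \<delta> where "0 < \<delta>" "\<And>x. \<bar>x - E\<bar> < \<delta> \<Longrightarrow>
    x \<noteq> 2 * real CARD('d) \<and> 2 * real CARD('d) - x \<notin> threshold_sums (UNIV :: 'd set)"
proof -
  define T where "T = insert (2 * real CARD('d)) ((\<lambda>k. 4 * real k) ` {..CARD('d)})"
  have "E \<notin> T" using assms by (auto simp: mu_H2_def T_def)
  moreover have "open (- T)" by (intro open_Compl finite_imp_closed) (simp add: T_def)
  ultimately obtain \<delta> where \<delta>: "0 < \<delta>" "\<And>x. dist x E < \<delta> \<Longrightarrow> x \<notin> T"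
    unfolding open_dist by (metis ComplD ComplI)
  show ?thesis
  proof (rule that[OF \<delta>(1)])
    fix x assume "\<bar>x - E\<bar> < \<delta>"
    then have "x \<notin> T" using \<delta>(2) by (simp add: dist_real_def)
    then show "x \<noteq> 2 * real CARD('d) \<and> 2 * real CARD('d) - x \<notin> threshold_sums (UNIV :: 'd set)"
      using threshold_sums_subset[where 'd = 'd] by (auto simp: T_def)
  qed
qed

section \<open>Absence of eigenvalues in dimension one\<close>

text \<open>For consecutive values \<open>a, b\<close> of a solution of \<open>c + a = (e + v + p) b\<close>. With \<open>p = 0\<close> and constant
  \<open>v\<close> the quadratic form \<open>b\<^sup>2 + a\<^sup>2 - (e + v) b a\<close> is conserved. The oscillating \<open>p\<close> changes it by
  \<open>p b (c - a)\<close>, which is \<open>(p / e) (c\<^sup>2 - a\<^sup>2)\<close> to leading order; since \<open>p\<close> changes sign at each step,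
  this is minus the increment of the last summand.\<close>

definition osc_energy :: "real \<Rightarrow> real \<Rightarrow> real \<Rightarrow> real \<Rightarrow> real \<Rightarrow> real" where
  "osc_energy e v p a b = b\<^sup>2 + a\<^sup>2 - (e + v) * (b * a) + p / e * (b\<^sup>2 - a\<^sup>2)"

lemma osc_energy_step:
  assumes "e \<noteq> 0" and rec: "c = (e + v + p) * b - a"
  shows "osc_energy e v' p' b c - osc_energy e v p a b
    = - (p / e) * (v + p) * (b * (c - a)) - (v' - v) * (c * b) + (p' + p) / e * (c\<^sup>2 - b\<^sup>2)"
proof -
  have 1: "c\<^sup>2 - a\<^sup>2 - (e + v) * (b * (c - a)) = (c - a) * (p * b)"
    unfolding rec by (simp add: power2_eq_square algebra_simps)
  have "e * b = c + a - (v + p) * b"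
    unfolding rec by (simp add: algebra_simps)
  then have b: "b = (c + a - (v + p) * b) / e" using \<open>e \<noteq> 0\<close> by (simp add: field_simps)
  have "(c - a) * (p * b) = p * (c - a) * b" by simp
  also have "\<dots> = p * (c - a) * ((c + a - (v + p) * b) / e)" using b by simp
  also have "\<dots> = p / e * (c\<^sup>2 - a\<^sup>2) - p / e * (v + p) * (b * (c - a))"
    using \<open>e \<noteq> 0\<close> by (simp add: field_simps power2_eq_square)
  finally have 2: "(c - a) * (p * b) = p / e * (c\<^sup>2 - a\<^sup>2) - p / e * (v + p) * (b * (c - a))" .
  have "osc_energy e v' p' b c - osc_energy e v p a b
      = (c\<^sup>2 - a\<^sup>2 - (e + v) * (b * (c - a))) - (v' - v) * (c * b)
        + (p' / e * (c\<^sup>2 - b\<^sup>2) - p / e * (b\<^sup>2 - a\<^sup>2))"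
    unfolding osc_energy_def by (simp add: algebra_simps)
  also have "\<dots> = - (p / e) * (v + p) * (b * (c - a)) - (v' - v) * (c * b) + (p' + p) / e * (c\<^sup>2 - b\<^sup>2)"
    unfolding 1 2 by (simp add: algebra_simps add_divide_distrib)
  finally show ?thesis .
qed

lemma abs_mult_le_sum_squares:
  fixes a b :: real
  shows "2 * \<bar>a * b\<bar> \<le> a\<^sup>2 + b\<^sup>2"
  using sum_squares_bound[of "\<bar>a\<bar>" "\<bar>b\<bar>"] by (simp add: abs_mult)

text \<open>Inside the band, \<open>|e| < 2\<close>, the form \<open>b\<^sup>2 + a\<^sup>2 - e b a\<close> is definite, and it stays so under small
  perturbations.\<close>

lemma osc_energy_bounds:
  assumes "e \<noteq> 0" "\<bar>e\<bar> < 2" "\<bar>v\<bar> \<le> \<delta>" "\<bar>p\<bar> \<le> \<delta>" "\<delta> * (1 + 1 / \<bar>e\<bar>) \<le> \<gamma>" "\<gamma> = (1 - \<bar>e\<bar> / 2) / 2"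
  shows "\<gamma> * (a\<^sup>2 + b\<^sup>2) \<le> osc_energy e v p a b" "osc_energy e v p a b \<le> 3 * (a\<^sup>2 + b\<^sup>2)"
proof -
  define X where "X = a\<^sup>2 + b\<^sup>2"
  have X: "0 \<le> X" by (simp add: X_def)
  have \<delta>: "0 \<le> \<delta>" using assms(3) by linarith
  have 1: "\<bar>(e + v) * (b * a)\<bar> \<le> (\<bar>e\<bar> + \<delta>) * (X / 2)"
    unfolding abs_mult[of "e + v"]
  proof (rule mult_mono)
    show "\<bar>e + v\<bar> \<le> \<bar>e\<bar> + \<delta>" using assms(3) by linarith
    show "\<bar>b * a\<bar> \<le> X / 2" using abs_mult_le_sum_squares[of b a] by (simp add: X_def)
  qed (use \<delta> in auto)
  have 2: "\<bar>p / e * (b\<^sup>2 - a\<^sup>2)\<bar> \<le> \<delta> / \<bar>e\<bar> * X"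
    unfolding abs_mult[of "p / e"]
  proof (rule mult_mono)
    show "\<bar>p / e\<bar> \<le> \<delta> / \<bar>e\<bar>" using assms(4) by (simp add: divide_right_mono)
    show "\<bar>b\<^sup>2 - a\<^sup>2\<bar> \<le> X" by (simp add: abs_le_iff X_def)
  qed (use \<delta> in auto)
  have 3: "\<delta> * X + \<delta> / \<bar>e\<bar> * X \<le> \<gamma> * X"
    using mult_right_mono[OF assms(5) X] by (simp add: algebra_simps)
  have "(1 - t / 2) / 2 * X = X / 2 - t * X / 4" for t by (simp add: field_simps)
  then have 4: "\<gamma> * X = X / 2 - \<bar>e\<bar> * X / 4" unfolding assms(6) .
  have 5: "0 \<le> \<delta> * X" "0 \<le> \<bar>e\<bar> * X" "\<bar>e\<bar> * X \<le> 2 * X"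
    using mult_nonneg_nonneg[OF \<delta> X] mult_nonneg_nonneg[OF abs_ge_zero X]
      mult_right_mono[OF less_imp_le[OF assms(2)] X] by blast+
  have 6: "(\<bar>e\<bar> + \<delta>) * (X / 2) = \<bar>e\<bar> * X / 2 + \<delta> * X / 2" by (simp add: algebra_simps add_divide_distrib)
  have eq: "osc_energy e v p a b = X - (e + v) * (b * a) + p / e * (b\<^sup>2 - a\<^sup>2)"
    by (simp add: osc_energy_def X_def)
  note le = abs_le_D1[OF 1, unfolded 6] abs_le_D2[OF 1, unfolded 6] abs_le_D1[OF 2] abs_le_D2[OF 2]
  have arith: "g \<le> X - s + t \<and> X - s + t \<le> 3 * X"
    if "s \<le> y / 2 + d / 2" "- s \<le> y / 2 + d / 2" "t \<le> f" "- t \<le> f" "d + f \<le> g"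
      "g = X / 2 - y / 4" "0 \<le> d" "0 \<le> y" "y \<le> 2 * X" for s t y d f g
    using that X by linarith
  show "\<gamma> * (a\<^sup>2 + b\<^sup>2) \<le> osc_energy e v p a b" "osc_energy e v p a b \<le> 3 * (a\<^sup>2 + b\<^sup>2)"
    unfolding eq X_def[symmetric] using arith[OF le 3 4 5] by simp_all
qed

lemma osc_energy_almost_monotone:
  assumes e: "e \<noteq> 0" "\<bar>e\<bar> < 2" and rec: "c = (e + v + p) * b - a" and j: "0 < j"
    and small: "\<bar>v\<bar> \<le> \<delta>" "\<bar>p\<bar> \<le> \<delta>" "j * \<bar>v' - v\<bar> \<le> \<delta>" "j * \<bar>p' + p\<bar> \<le> \<delta>" "\<delta> \<le> 1/2"
    and p: "j * \<bar>p\<bar> \<le> w"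
  shows "j * \<bar>osc_energy e v' p' b c - osc_energy e v p a b\<bar>
    \<le> 19 * \<delta> * (2 * w / \<bar>e\<bar> + 1 + 1 / \<bar>e\<bar>) * (a\<^sup>2 + b\<^sup>2)"
proof -
  define Z where "Z = a\<^sup>2 + b\<^sup>2 + c\<^sup>2"
  have \<delta>: "0 \<le> \<delta>" using small(1) by linarith
  have w: "0 \<le> w" using p j by (meson abs_ge_zero mult_nonneg_nonneg order_trans less_imp_le)
  have "c\<^sup>2 \<le> 18 * (a\<^sup>2 + b\<^sup>2)"
  proof -
    have "\<bar>e + v + p\<bar> \<le> 3" using e small by linarith
    then have q: "(e + v + p)\<^sup>2 \<le> 3\<^sup>2" using abs_le_square_iff[of "e + v + p" 3] by simp
    have "c\<^sup>2 \<le> 2 * ((e + v + p) * b)\<^sup>2 + 2 * a\<^sup>2"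
      using sum_squares_bound[of "(e + v + p) * b" "- a"] unfolding rec by (simp add: power2_diff)
    also have "((e + v + p) * b)\<^sup>2 \<le> 9 * b\<^sup>2"
      unfolding power_mult_distrib using mult_right_mono[OF q zero_le_power2[of b]] by simp
    finally show ?thesis by (smt (verit) zero_le_power2)
  qed
  then have Z: "Z \<le> 19 * (a\<^sup>2 + b\<^sup>2)" unfolding Z_def by simp
  have s: "\<bar>b * (c - a)\<bar> \<le> Z" "\<bar>c * b\<bar> \<le> Z" "\<bar>c\<^sup>2 - b\<^sup>2\<bar> \<le> Z" "0 \<le> Z"
  proof -
    have "\<bar>b * (c - a)\<bar> \<le> \<bar>b * c\<bar> + \<bar>b * a\<bar>"
      using abs_triangle_ineq4[of "b * c" "b * a"] by (simp add: algebra_simps)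
    then show "\<bar>b * (c - a)\<bar> \<le> Z"
      using abs_mult_le_sum_squares[of b c] abs_mult_le_sum_squares[of b a] unfolding Z_def by (smt (verit) zero_le_power2)
    show "\<bar>c * b\<bar> \<le> Z"
      using abs_mult_le_sum_squares[of c b] unfolding Z_def by (smt (verit) zero_le_power2)
    show "\<bar>c\<^sup>2 - b\<^sup>2\<bar> \<le> Z" unfolding Z_def by (simp add: abs_le_iff)
    show "0 \<le> Z" unfolding Z_def by simp
  qed
  have t1: "j * \<bar>- (p / e) * (v + p) * (b * (c - a))\<bar> \<le> w / \<bar>e\<bar> * (2 * \<delta>) * Z"
  proof -
    have "j * \<bar>- (p / e) * (v + p) * (b * (c - a))\<bar> = (j * \<bar>p\<bar>) / \<bar>e\<bar> * \<bar>v + p\<bar> * \<bar>b * (c - a)\<bar>"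
      by (simp add: abs_mult)
    also have "\<dots> \<le> w / \<bar>e\<bar> * (2 * \<delta>) * Z"
    proof (intro mult_mono divide_right_mono p s)
      show "\<bar>v + p\<bar> \<le> 2 * \<delta>" using small by linarith
    qed (use j w \<delta> in auto)
    finally show ?thesis .
  qed
  have t2: "j * \<bar>(v' - v) * (c * b)\<bar> \<le> \<delta> * Z"
  proof -
    have "j * \<bar>v' - v\<bar> * \<bar>c * b\<bar> \<le> \<delta> * Z" by (rule mult_mono[OF small(3) s(2) \<delta>]) simp
    then show ?thesis by (simp add: abs_mult mult.assoc)
  qed
  have t3: "j * \<bar>(p' + p) / e * (c\<^sup>2 - b\<^sup>2)\<bar> \<le> \<delta> / \<bar>e\<bar> * Z"
  proof -
    have "j * \<bar>(p' + p) / e * (c\<^sup>2 - b\<^sup>2)\<bar> = (j * \<bar>p' + p\<bar>) / \<bar>e\<bar> * \<bar>c\<^sup>2 - b\<^sup>2\<bar>"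
      by (simp add: abs_mult)
    also have "\<dots> \<le> \<delta> / \<bar>e\<bar> * Z"
      using \<delta> by (intro mult_mono divide_right_mono small(4) s(3)) auto
    finally show ?thesis .
  qed
  have "j * \<bar>osc_energy e v' p' b c - osc_energy e v p a b\<bar>
      \<le> j * (\<bar>- (p / e) * (v + p) * (b * (c - a))\<bar> + \<bar>(v' - v) * (c * b)\<bar> + \<bar>(p' + p) / e * (c\<^sup>2 - b\<^sup>2)\<bar>)"
  proof (rule mult_left_mono)
    have "\<bar>x - y + z\<bar> \<le> \<bar>x\<bar> + \<bar>y\<bar> + \<bar>z\<bar>" for x y z :: real by linarith
    then show "\<bar>osc_energy e v' p' b c - osc_energy e v p a b\<bar>
      \<le> \<bar>- (p / e) * (v + p) * (b * (c - a))\<bar> + \<bar>(v' - v) * (c * b)\<bar> + \<bar>(p' + p) / e * (c\<^sup>2 - b\<^sup>2)\<bar>"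
      unfolding osc_energy_step[OF e(1) rec] .
  qed (use j in simp)
  also have "\<dots> \<le> w / \<bar>e\<bar> * (2 * \<delta>) * Z + \<delta> * Z + \<delta> / \<bar>e\<bar> * Z"
    unfolding distrib_left[of j] by (intro add_mono t1 t2 t3)
  also have "\<dots> = \<delta> * (2 * w / \<bar>e\<bar> + 1 + 1 / \<bar>e\<bar>) * Z"
    using e by (simp add: field_simps)
  also have "\<dots> \<le> \<delta> * (2 * w / \<bar>e\<bar> + 1 + 1 / \<bar>e\<bar>) * (19 * (a\<^sup>2 + b\<^sup>2))"
    using Z \<delta> w by (intro mult_left_mono) auto
  also have "x * y * (19 * t) = 19 * x * y * t" for x y t :: real by simp
  finally show ?thesis .
qed

text \<open>The energy \<open>Q\<^sub>j\<close> changes by at most \<open>Q\<^sub>j / (2 j)\<close>, so \<open>j Q\<^sub>j\<close> is eventually nondecreasing. If it is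
  ever positive, \<open>Q\<^sub>j\<close> is bounded below by a multiple of \<open>1 / j\<close> and the harmonic series diverges.\<close>

lemma square_summable_solution_vanishes:
  fixes u v p :: "nat \<Rightarrow> real"
  assumes e: "e \<noteq> 0" "\<bar>e\<bar> < 2"
    and rec: "\<And>j. u (Suc (Suc j)) = (e + v (Suc j) + p (Suc j)) * u (Suc j) - u j"
    and p: "\<And>j. p j = w * (- 1) ^ j / real j"
    and v: "v \<longlonglongrightarrow> 0" "(\<lambda>j. real (Suc j) * (v (Suc j) - v j)) \<longlonglongrightarrow> 0"
    and u: "summable (\<lambda>j. (u j)\<^sup>2)"
  shows "\<exists>J. \<forall>j\<ge>J. u j = 0"
proof -
  define \<gamma> where "\<gamma> = (1 - \<bar>e\<bar> / 2) / 2"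
  define G where "G = 2 * \<bar>w\<bar> / \<bar>e\<bar> + 1 + 1 / \<bar>e\<bar>"
  \<comment> \<open>Chosen so that the relative change \<open>19 \<delta> G / \<gamma>\<close> of the energy, times \<open>j\<close>, is \<open>1/2\<close>.\<close>
  define \<delta> where "\<delta> = \<gamma> / (38 * G)"
  have \<gamma>: "0 < \<gamma>" "\<gamma> \<le> 1/2" using e by (auto simp: \<gamma>_def)
  have G: "1 + 1 / \<bar>e\<bar> \<le> G" "1 \<le> G" by (simp_all add: G_def)
  have \<delta>: "0 < \<delta>" "19 * \<delta> * G = \<gamma> / 2" using \<gamma> G by (simp_all add: \<delta>_def)
  have "\<delta> * (1 + 1 / \<bar>e\<bar>) \<le> \<delta> * G" "\<delta> * 1 \<le> \<delta> * G" using G \<delta>(1) by (intro mult_left_mono; simp)+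
  then have \<delta>': "\<delta> * (1 + 1 / \<bar>e\<bar>) \<le> \<gamma>" "\<delta> \<le> 1/2" using \<delta> \<gamma> by linarith+
  have w0: "(\<lambda>j. \<bar>w\<bar> / real j) \<longlonglongrightarrow> 0"
    using tendsto_mult_right_zero[OF lim_1_over_n, of "\<bar>w\<bar>"] by simp
  have ev: "\<forall>\<^sub>F j in sequentially. \<bar>v j\<bar> < \<delta> \<and> real (Suc j) * \<bar>v (Suc j) - v j\<bar> < \<delta> \<and> \<bar>w\<bar> / real j < \<delta> \<and> 1 \<le> j"
    using tendstoD[OF v(1) \<delta>(1)] tendstoD[OF v(2) \<delta>(1)] tendstoD[OF w0 \<delta>(1)] eventually_ge_at_top[of 1]
    by eventually_elim (simp add: abs_mult)
  then obtain J where J: "\<And>j. J \<le> j \<Longrightarrow> \<bar>v j\<bar> < \<delta>"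
    "\<And>j. J \<le> j \<Longrightarrow> real (Suc j) * \<bar>v (Suc j) - v j\<bar> < \<delta>"
    "\<And>j. J \<le> j \<Longrightarrow> \<bar>w\<bar> / real j < \<delta>" "\<And>j. J \<le> j \<Longrightarrow> 1 \<le> j"
    unfolding eventually_sequentially by blast
  define X where "X j = (u (j - 1))\<^sup>2 + (u j)\<^sup>2" for j
  define Q where "Q j = osc_energy e (v j) (p j) (u (j - 1)) (u j)" for j
  have abs_p: "\<bar>p j\<bar> = \<bar>w\<bar> / real j" for j by (simp add: p abs_mult power_abs)
  have bounds: "\<gamma> * X j \<le> Q j" "Q j \<le> 3 * X j" if "J \<le> j" for j
  proof -
    have "\<bar>v j\<bar> \<le> \<delta>" "\<bar>p j\<bar> \<le> \<delta>" using J[OF that] abs_p[of j] by linarith+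
    from osc_energy_bounds[OF e this \<delta>'(1) \<gamma>_def] show "\<gamma> * X j \<le> Q j" "Q j \<le> 3 * X j"
      by (simp_all add: X_def Q_def)
  qed
  have step: "real j * Q j \<le> real (Suc j) * Q (Suc j)" if "J \<le> j" for j
  proof -
    have j1: "1 \<le> real j" using J(4)[OF that] by simp
    have "j = Suc (j - 1)" using J(4)[OF that] by simp
    then have r: "u (Suc j) = (e + v j + p j) * u j - u (j - 1)" using rec[of "j - 1"] by simp
    have "p (Suc j) + p j = - (w * (- 1) ^ j) * (1 / real (Suc j) - 1 / real j)"
      by (simp add: p algebra_simps)
    also have "1 / real (Suc j) - 1 / real j = - (1 / (real j * real (Suc j)))"
      using j1 by (simp add: field_simps)
    finally have "\<bar>p (Suc j) + p j\<bar> = \<bar>w\<bar> / (real j * real (Suc j))"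
      by (simp add: abs_mult power_abs)
    then have "real j * \<bar>p (Suc j) + p j\<bar> = \<bar>w\<bar> / real (Suc j)" using j1 by (simp del: of_nat_Suc)
    also have "\<dots> \<le> \<delta>" using J(3)[of "Suc j"] that by simp
    finally have pp: "real j * \<bar>p (Suc j) + p j\<bar> \<le> \<delta>" .
    have "real j * \<bar>v (Suc j) - v j\<bar> \<le> real (Suc j) * \<bar>v (Suc j) - v j\<bar>"
      by (rule mult_right_mono) auto
    then have vv: "real j * \<bar>v (Suc j) - v j\<bar> \<le> \<delta>" using J(2)[OF that] by linarith
    have "\<bar>v j\<bar> \<le> \<delta>" "\<bar>p j\<bar> \<le> \<delta>" using J[OF that] abs_p[of j] by linarith+
    moreover have "0 < real j" "real j * \<bar>p j\<bar> \<le> \<bar>w\<bar>" using j1 by (simp_all add: abs_p)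
    ultimately have "real j * \<bar>Q (Suc j) - Q j\<bar> \<le> 19 * \<delta> * G * X j"
      using osc_energy_almost_monotone[OF e r _ _ _ vv pp \<delta>'(2)] by (simp add: Q_def X_def G_def)
    also have "\<dots> = \<gamma> * X j / 2" using \<delta>(2) by simp
    also have "\<dots> \<le> Q j / 2" using bounds(1)[OF that] by simp
    finally have d: "real j * \<bar>Q (Suc j) - Q j\<bar> \<le> Q j / 2" .
    have Q0: "0 \<le> Q j" using bounds(1)[OF that] \<gamma> by (smt (verit) X_def mult_nonneg_nonneg zero_le_power2)
    have "\<bar>Q (Suc j) - Q j\<bar> \<le> real j * \<bar>Q (Suc j) - Q j\<bar>"
      using mult_right_mono[OF j1, of "\<bar>Q (Suc j) - Q j\<bar>"] by simp
    with d have "\<bar>Q (Suc j) - Q j\<bar> \<le> Q j / 2" by linarith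
    moreover have "real (Suc j) * Q (Suc j) = real j * Q j + Q j + real j * (Q (Suc j) - Q j) + (Q (Suc j) - Q j)"
      by (simp add: algebra_simps)
    moreover have "real j * (Q (Suc j) - Q j) \<ge> - (Q j / 2)"
      using d j1 abs_mult[of "real j" "Q (Suc j) - Q j"] by (simp add: abs_le_iff)
    ultimately show ?thesis using Q0 by linarith
  qed
  have "u j = 0" if "J \<le> j" for j
  proof (rule ccontr)
    assume "u j \<noteq> 0"
    then have "0 < X j" by (simp add: X_def add_nonneg_pos)
    then have "0 < Q j" using bounds(1)[OF that] \<gamma> by (smt (verit) mult_pos_pos)
    define c where "c = real j * Q j / 3"
    have "0 < c" using \<open>0 < Q j\<close> J(4)[OF that] by (simp add: c_def)
    have grow: "real j * Q j \<le> real i * Q i" if "j \<le> i" for i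
      using that
    proof (induction i rule: dec_induct)
      case (step i)
      then show ?case using \<open>J \<le> j\<close> \<open>\<And>j. J \<le> j \<Longrightarrow> real j * Q j \<le> real (Suc j) * Q (Suc j)\<close>[of i] by linarith
    qed simp
    have low: "c * (1 / real i) \<le> X i" if "j \<le> i" for i
    proof -
      have "0 < real i" using J(4)[of i] \<open>J \<le> j\<close> that by simp
      moreover have "3 * c \<le> real i * (3 * X i)"
        using grow[OF that] mult_left_mono[OF bounds(2)[of i], of "real i"] \<open>J \<le> j\<close> that by (simp add: c_def)
      ultimately show ?thesis by (simp add: field_simps)
    qed
    have "summable (\<lambda>i. (u i)\<^sup>2 + (u (Suc i))\<^sup>2)"
      using u summable_Suc_iff[of "\<lambda>i. (u i)\<^sup>2"] by (intro summable_add) auto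
    then have "summable (\<lambda>i. X (Suc i))" by (simp add: X_def)
    then have "summable (\<lambda>i. c * (1 / real (Suc i)))"
    proof (rule summable_comparison_test'[where N = j])
      show "norm (c * (1 / real (Suc i))) \<le> X (Suc i)" if "j \<le> i" for i
        using low[of "Suc i"] \<open>0 < c\<close> that by simp
    qed
    from summable_mult[OF this, of "1 / c"] have "summable (\<lambda>i. 1 / real (Suc i))"
      using \<open>0 < c\<close> by simp
    then have "summable (\<lambda>i. 1 / real i)"
      using summable_Suc_iff[of "\<lambda>i. 1 / real i"] by simp
    then show False using not_summable_harmonic[where 'a = real] by (simp add: inverse_eq_divide)
  qed
  then show ?thesis by blast
qed

text \<open>A square-summable solution vanishes near \<open>+ \<infinity>\<close>; running the recurrence backwards from two
  consecutive zeros gives zero everywhere.\<close>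

lemma no_eigenfunction_dim_1:
  fixes V :: "int ^ 'd \<Rightarrow> real"
  assumes card: "CARD('d) = 1" and x: "x \<in> {0<..<4} - {2}"
    and V: "(V \<longlongrightarrow> 0) cofinite"
    and dV: "\<And>i. ((\<lambda>n. real_of_int (n $ i) * (V n - shift i V n)) \<longlongrightarrow> 0) cofinite"
    and eig: "real_eigenfunction w V x \<psi>"
  shows "\<psi> = 0"
proof -
  obtain i :: 'd where i: "(UNIV :: 'd set) = {i}" using card by (auto simp: card_1_singleton_iff)
  have all_i: "k = i" for k :: 'd using i by auto
  define \<zeta> where "\<zeta> k = \<psi> (axis i k)" for k :: int
  have ax: "axis i (k + 1) = axis i k + axis i (1::int)" "axis i (k - 1) = axis i k - axis i (1::int)" for k
    by (simp_all add: vec_eq_iff axis_def)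
  have rec: "(2 - x + V (axis i k) + w2 w (axis i k)) * \<zeta> k = \<zeta> (k - 1) + \<zeta> (k + 1)" for k
    using eig card by (simp add: real_eigenfunction_def hop_total_def i hop_sum_def shift_def shift_adj_def \<zeta>_def ax)
  have w2_axis: "w2 w (axis i (int j)) = w * (- 1) ^ j / real j" for j
    by (simp add: w2_eq checker_def lnorm_def i)
  have inj: "inj (\<lambda>j. axis i (int j))" by (auto simp: inj_def axis_eq_axis)
  have lim: "filterlim (\<lambda>j. axis i (int j)) cofinite sequentially"
    unfolding filterlim_iff eventually_cofinite cofinite_eq_sequentially[symmetric]
  proof (intro allI impI)
    fix P :: "int ^ 'd \<Rightarrow> bool" assume "finite {x. \<not> P x}"
    then have "finite ((\<lambda>j. axis i (int j)) -` {x. \<not> P x})" using inj by (intro finite_vimageI)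
    then show "finite {j. \<not> P (axis i (int j))}" by (simp add: vimage_def)
  qed
  have v0: "(\<lambda>j. V (axis i (int j))) \<longlonglongrightarrow> 0" by (rule filterlim_compose[OF V lim])
  have "(\<lambda>j. real_of_int (axis i (int (Suc j)) $ i) * (V (axis i (int (Suc j))) - shift i V (axis i (int (Suc j))))) \<longlonglongrightarrow> 0"
    by (rule LIMSEQ_Suc[OF filterlim_compose[OF dV lim]])
  moreover have "axis i (int (Suc j)) - axis i (1::int) = axis i (int j)" for j
    by (simp add: vec_eq_iff axis_def)
  ultimately have v1: "(\<lambda>j. real (Suc j) * (V (axis i (int (Suc j))) - V (axis i (int j)))) \<longlonglongrightarrow> 0"
    by (simp add: shift_def)
  have "(\<lambda>n. (\<psi> n)\<^sup>2) summable_on range (\<lambda>j. axis i (int j))"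
    by (rule summable_on_subset_banach[OF conjunct1[OF eig[unfolded real_eigenfunction_def]]]) simp
  then have "(\<lambda>j. (\<zeta> (int j))\<^sup>2) summable_on UNIV"
    using summable_on_reindex[OF inj, of "\<lambda>n. (\<psi> n)\<^sup>2"] by (simp add: o_def \<zeta>_def)
  then have summ: "summable (\<lambda>j. (\<zeta> (int j))\<^sup>2)" by (rule summable_on_imp_summable)
  have rec_nat: "\<zeta> (int (Suc (Suc j))) = (2 - x + V (axis i (int (Suc j))) + w2 w (axis i (int (Suc j)))) * \<zeta> (int (Suc j)) - \<zeta> (int j)" for j
    using rec[of "int (Suc j)"] by (simp add: add.commute)
  obtain J where J: "\<And>j. J \<le> j \<Longrightarrow> \<zeta> (int j) = 0"
  proof -
    have "2 - x \<noteq> 0" "\<bar>2 - x\<bar> < 2" using x by (auto simp: abs_less_iff)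
    from square_summable_solution_vanishes[OF this rec_nat w2_axis v0 v1 summ] show ?thesis
      using that by blast
  qed
  have large: "\<zeta> k = 0" if "int J \<le> k" for k
    using J[of "nat k"] that by simp
  have "\<zeta> k = 0 \<and> \<zeta> (k + 1) = 0" if "k \<le> int J" for k
    using that
  proof (induction k rule: int_le_induct)
    case base
    then show ?case using large by simp
  next
    case (step k)
    then show ?case using rec[of k] by simp
  qed
  then have "\<zeta> k = 0" for k using large by (cases "k \<le> int J") auto
  moreover have "n = axis i (n $ i)" for n :: "int ^ 'd"
    unfolding vec_eq_iff
  proof
    fix k show "n $ k = axis i (n $ i) $ k" unfolding all_i[of k] by (simp add: axis_def)
  qed
  ultimately show "\<psi> = 0" unfolding \<zeta>_def by (metis ext zero_fun_apply)
qed

section \<open>Eigenvalues of the operator\<close>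

theorem proposition1p2:
  fixes V :: "int ^ 'd \<Rightarrow> real" and w q r :: real and m :: nat
  assumes V_bounded: "bounded (range V)"
    and exponents: "0 \<le> r" "r < q"
    and V_decay: "V \<in> O[lat_infinity](\<lambda>n. decay_rate m q r (lnorm n))"
    and V_diff_decay: "\<And>i. (\<lambda>n. real_of_int (n $ i) * (V n - shift i V n))
                          \<in> O[lat_infinity](\<lambda>n. decay_rate m q r (lnorm n))"
  shows "(\<forall>E \<in> mu_H2 CARD('d). \<exists>I. open I \<and> is_interval I \<and> E \<in> I \<and>
            finite {x \<in> I. complex_of_real x \<in> point_spectrum (H2 w V)} \<and>
            (\<forall>x \<in> I. finite_dimensional (eigenspace (H2 w V) (complex_of_real x))) \<and>
            (\<forall>x \<in> I. \<forall>\<psi> \<in> eigenspace (H2 w V) (complex_of_real x). decays_subexp \<psi>))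
       \<and> (CARD('d) = 1 \<longrightarrow>
            (\<forall>x \<in> {0<..<4} - {2}. complex_of_real x \<notin> point_spectrum (H2 w V)))"
proof (intro conjI ballI impI)
  have V: "(V \<longlongrightarrow> 0) cofinite"
    by (rule tendsto_0_of_bigo_decay[OF exponents V_decay])
  have dV: "((\<lambda>n. real_of_int (n $ i) * (V n - shift i V n)) \<longlongrightarrow> 0) cofinite" for i
    by (rule tendsto_0_of_bigo_decay[OF exponents V_diff_decay])
  show "complex_of_real x \<notin> point_spectrum (H2 w V)" if "CARD('d) = 1" "x \<in> {0<..<4} - {2}" for x
    using point_spectrum_imp_real_eigenfunction no_eigenfunction_dim_1[OF that V dV] by blast
  fix E assume E: "E \<in> mu_H2 CARD('d)"
  obtain \<delta> where \<delta>: "0 < \<delta>" "\<And>x. \<bar>x - E\<bar> < \<delta> \<Longrightarrow>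
      x \<noteq> 2 * real CARD('d) \<and> 2 * real CARD('d) - x \<notin> threshold_sums (UNIV :: 'd set)"
    using mu_H2_neighbourhood[OF E] by blast
  have E': "E \<noteq> 2 * real CARD('d)" "2 * real CARD('d) - E \<notin> threshold_sums (UNIV :: 'd set)"
    using \<delta>(2)[of E] \<delta>(1) by auto
  obtain \<epsilon> and N :: nat where \<epsilon>: "0 < \<epsilon>"
    and mass: "\<And>x \<psi>. \<bar>x - E\<bar> < \<epsilon> \<Longrightarrow> real_eigenfunction w V x \<psi> \<Longrightarrow>
       \<epsilon> * (\<Sum>\<^sub>\<infinity>n. (\<psi> n)\<^sup>2) \<le> (\<Sum>n\<in>{n. lnorm n \<le> real N}. (\<psi> n)\<^sup>2)"
    using eigenfunction_mass_in_ball[OF V dV E'] by blast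
  define I where "I = ball E (min \<delta> \<epsilon>)"
  have I: "\<bar>x - E\<bar> < \<delta>" "\<bar>x - E\<bar> < \<epsilon>" if "x \<in> I" for x
    using that by (auto simp: I_def dist_real_def)
  show "\<exists>I. open I \<and> is_interval I \<and> E \<in> I \<and>
            finite {x \<in> I. complex_of_real x \<in> point_spectrum (H2 w V)} \<and>
            (\<forall>x \<in> I. finite_dimensional (eigenspace (H2 w V) (complex_of_real x))) \<and>
            (\<forall>x \<in> I. \<forall>\<psi> \<in> eigenspace (H2 w V) (complex_of_real x). decays_subexp \<psi>)"
  proof (intro exI[of _ I] conjI ballI)
    show "open I" "is_interval I" "E \<in> I"
      using \<delta>(1) \<epsilon> by (simp_all add: I_def is_interval_ball_real)
    have "finite {x \<in> I. \<exists>\<psi>. real_eigenfunction w V x \<psi> \<and> \<psi> \<noteq> 0}"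
      by (rule finite_eigenvalues[OF \<epsilon> mass[OF I(2)]])
    then show "finite {x \<in> I. complex_of_real x \<in> point_spectrum (H2 w V)}"
      by (rule rev_finite_subset) (use point_spectrum_imp_real_eigenfunction in blast)
    fix x assume x: "x \<in> I"
    show "finite_dimensional (eigenspace (H2 w V) (complex_of_real x))"
      by (rule finite_dimensional_eigenspace[OF finite_lattice_ball \<epsilon> mass[OF I(2)[OF x]]])
    fix \<psi> assume \<psi>: "\<psi> \<in> eigenspace (H2 w V) (complex_of_real x)"
    note x' = conjunct1[OF \<delta>(2)[OF I(1)[OF x]]] conjunct2[OF \<delta>(2)[OF I(1)[OF x]]]
    show "decays_subexp \<psi>"
      by (rule decays_subexp_if_real_parts[OF
            eigenfunction_decay[OF V dV x' real_eigenfunction_Re_Im(1)[OF \<psi>]]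
            eigenfunction_decay[OF V dV x' real_eigenfunction_Re_Im(2)[OF \<psi>]]])
  qed
qed

end
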